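(* Let $\Gamma$ be a finite simplicial graph, and let $X$ be either the Davis complex of the right-angled Coxeter group $W_\Gamma$, where $W_\Gamma$ is infinite, or the universal cover of the Salvetti complex of the right-angled Artin group $A_\Gamma$. Then $B(X)=\partial X$ if and only if the corresponding group ($W_\Gamma$, respectively $A_\Gamma$) does not split as a direct product (of two nontrivial groups).
   Context: For a finite simplicial graph $\Gamma$ with vertex set $S$ and edge set $E$: $W_\Gamma=\langle S\mid s^2=1\ (s\in S),\ st=ts\ ((s,t)\in E)\rangle$ and $A_\Gamma=\langle S\mid st=ts\ ((s,t)\in E)\rangle$. The Davis complex $\Sigma_\Gamma$ of $W_\Gamma$ is the CAT(0) cube complex with vertex set $W_\Gamma$, an edge between $w$ and $ws$ for each $w\in W_\Gamma$, $s\in S$, and a cube with vertex set $w\langle T\rangle$ for each $w\in W_\Gamma$ and each set $T\subset S$ of pairwise adjacent vertices of $\Gamma$. The Salvetti complex of $A_\Gamma$ is the usual nonpositively curved cube complex with one vertex, one oriented loop for each $s\in S$, and one $n$-torus for each set of $n$ pairwise adjacent vertices of $\Gamma$; its universal cover is a CAT(0) cube complex with 1-skeleton the Cayley graph of $A_\Gamma$ with respect to $S$. Boundaries. For a hyperplane $\hat h$ of a CAT(0) cube complex $X$, the closures $h,h^*$ of the components of $X\setminus \hat h$ are its halfspaces. An ultrafilter on $X$ is a set $\alpha$ of halfspaces such that for every halfspace $h$ exactly one of $h,h^*$ is in $\alpha$, and if $h\in\alpha$, $h\subset k$ then $k\in\alpha$. $\mathcal{U}(X)$ is the set of ultrafilters,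 with topology having as basis $\mathcal{U}(X)$ together with the sets $\mathcal{U}_H=\{\alpha:H\subset\alpha\}$, $H$ a finite set of halfspaces. The Roller boundary $\partial X$ is the set of ultrafilters containing an infinite strictly descending chain of halfspaces (i.e. failing the descending chain condition). An ultrafilter $\alpha$ is non-terminating if for every $h\in\alpha$ there is $k\in\alpha$ with $k\subsetneq h$. $B(X)$ is the closure in $\mathcal{U}(X)$ of the set of non-terminating ultrafilters in $\partial X$. *)

theory Defs
  imports
    "HOL-Analysis.Analysis"
    "HOL-Algebra.Generated_Groups"
    "Graph_Theory.Pair_Digraph"
begin

section \<open>Groups given by presentations\<close>

text \<open>Letters \<open>(s, True)\<close> and \<open>(s, False)\<close> stand for \<open>s\<close> and its formal inverse;
  a relation \<open>l = r\<close> is a pair \<open>(l, r)\<close> of words.\<close>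

type_synonym 'a word = "('a \<times> bool) list"

definition words :: "'a set \<Rightarrow> 'a word set" where
  "words S = lists (S \<times> UNIV)"

inductive_set pres_rel :: "'a set \<Rightarrow> ('a word \<times> 'a word) set \<Rightarrow> ('a word \<times> 'a word) set"
  for S R where
  refl: "w \<in> words S \<Longrightarrow> (w, w) \<in> pres_rel S R"
| sym: "(v, w) \<in> pres_rel S R \<Longrightarrow> (w, v) \<in> pres_rel S R"
| trans: "(u, v) \<in> pres_rel S R \<Longrightarrow> (v, w) \<in> pres_rel S R \<Longrightarrow> (u, w) \<in> pres_rel S R"
| cancel: "u \<in> words S \<Longrightarrow> v \<in> words S \<Longrightarrow> s \<in> S \<Longrightarrow>
    (u @ [(s, b), (s, \<not> b)] @ v, u @ v) \<in> pres_rel S R"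
| rel: "u \<in> words S \<Longrightarrow> v \<in> words S \<Longrightarrow> l \<in> words S \<Longrightarrow> r \<in> words S \<Longrightarrow> (l, r) \<in> R \<Longrightarrow>
    (u @ l @ v, u @ r @ v) \<in> pres_rel S R"

definition presented_group :: "'a set \<Rightarrow> ('a word \<times> 'a word) set \<Rightarrow> 'a word set monoid" where
  "presented_group S R =
    \<lparr>carrier = words S // pres_rel S R,
     mult = (\<lambda>A B. {w. \<exists>u\<in>A. \<exists>v\<in>B. (u @ v, w) \<in> pres_rel S R}),
     one = pres_rel S R `` {[]}\<rparr>"

definition presented_gen :: "'a set \<Rightarrow> ('a word \<times> 'a word) set \<Rightarrow> 'a \<Rightarrow> 'a word set" where
  "presented_gen S R s = pres_rel S R `` {[(s, True)]}"

lemma pres_rel_words: "(v, w) \<in> pres_rel S R \<Longrightarrow> v \<in> words S \<and> w \<in> words S"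
  by (induction rule: pres_rel.induct) (auto simp: words_def)

lemma equiv_pres_rel: "equiv (words S) (pres_rel S R)"
  by (intro equivI refl_onI symI transI subsetI)
     (auto dest: pres_rel_words pres_rel.sym intro: pres_rel.refl pres_rel.trans)

lemma pres_rel_context:
  assumes "(v, w) \<in> pres_rel S R" "x \<in> words S" "y \<in> words S"
  shows "(x @ v @ y, x @ w @ y) \<in> pres_rel S R"
  using assms
proof (induction rule: pres_rel.induct)
  case (cancel u v s b)
  then show ?case
    using pres_rel.cancel[of "x @ u" S "v @ y" s b R] by (simp add: words_def)
next
  case (rel u v l r)
  then show ?case
    using pres_rel.rel[of "x @ u" S "v @ y" l r R] by (simp add: words_def)
qed (auto simp: words_def intro: pres_rel.refl pres_rel.sym pres_rel.trans)

lemma pres_rel_append: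
  assumes "(u, u') \<in> pres_rel S R" "(v, v') \<in> pres_rel S R"
  shows "(u @ v, u' @ v') \<in> pres_rel S R"
proof -
  have W: "[] \<in> words S" "u' \<in> words S" "v \<in> words S"
    using assms pres_rel_words by (fastforce simp: words_def)+
  have "(u @ v, u' @ v) \<in> pres_rel S R"
    using pres_rel_context[OF assms(1) W(1,3)] by simp
  moreover have "(u' @ v, u' @ v') \<in> pres_rel S R"
    using pres_rel_context[OF assms(2) W(2,1)] by simp
  ultimately show ?thesis by (rule pres_rel.trans)
qed

lemma presented_mult:
  assumes "u \<in> words S" "v \<in> words S"
  shows "pres_rel S R `` {u} \<otimes>\<^bsub>presented_group S R\<^esub> pres_rel S R `` {v} = pres_rel S R `` {u @ v}"
  using assms
  by (auto simp: presented_group_def intro: pres_rel.refl pres_rel.trans pres_rel_append)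

lemma pres_rel_inverse:
  "w \<in> words S \<Longrightarrow> (rev (map (\<lambda>(s, b). (s, \<not> b)) w) @ w, []) \<in> pres_rel S R"
proof (induction w)
  case Nil
  then show ?case by (auto simp: words_def intro: pres_rel.refl)
next
  case (Cons a w)
  obtain s b where a: "a = (s, b)" by fastforce
  have W: "w \<in> words S" "s \<in> S" "rev (map (\<lambda>(s, b). (s, \<not> b)) w) \<in> words S"
    using Cons.prems a by (auto simp: words_def)
  show ?case
    using pres_rel.trans[OF pres_rel.cancel[OF W(3,1,2), of "\<not> b"] Cons.IH[OF W(1)]]
    by (simp add: a)
qed

lemma group_presented_group: "group (presented_group S R)"
proof (rule groupI)
  let ?G = "presented_group S R" and ?cl = "\<lambda>w. pres_rel S R `` {w}"
  have N: "[] \<in> words S" and app: "\<And>u v. u \<in> words S \<Longrightarrow> v \<in> words S \<Longrightarrow> u @ v \<in> words S"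
    by (auto simp: words_def)
  have one: "\<one>\<^bsub>?G\<^esub> = ?cl []"
    by (simp add: presented_group_def)
  have carr: "\<And>w. w \<in> words S \<Longrightarrow> ?cl w \<in> carrier ?G"
    by (simp add: presented_group_def quotientI)
  have carrE: "\<exists>w\<in>words S. A = ?cl w" if "A \<in> carrier ?G" for A
    using that by (auto simp: presented_group_def elim: quotientE)
  show "\<one>\<^bsub>?G\<^esub> \<in> carrier ?G"
    by (simp add: one carr N)
  fix A assume "A \<in> carrier ?G"
  then obtain u where u: "u \<in> words S" "A = ?cl u" using carrE by blast
  show "\<one>\<^bsub>?G\<^esub> \<otimes>\<^bsub>?G\<^esub> A = A"
    by (simp add: one u presented_mult N)
  let ?v = "rev (map (\<lambda>(s, b). (s, \<not> b)) u)"
  have v: "?v \<in> words S" using u by (auto simp: words_def)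
  have "?cl (?v @ u) = ?cl []"
    by (rule equiv_class_eq[OF equiv_pres_rel pres_rel_inverse[OF u(1)]])
  then show "\<exists>B\<in>carrier ?G. B \<otimes>\<^bsub>?G\<^esub> A = \<one>\<^bsub>?G\<^esub>"
    using carr[OF v] presented_mult[OF v u(1)] u(2) one by metis
  fix B assume "B \<in> carrier ?G"
  then obtain v where v: "v \<in> words S" "B = ?cl v" using carrE by blast
  show "A \<otimes>\<^bsub>?G\<^esub> B \<in> carrier ?G"
    by (simp add: u v presented_mult carr app)
  fix C assume "C \<in> carrier ?G"
  then obtain w where w: "w \<in> words S" "C = ?cl w" using carrE by blast
  show "A \<otimes>\<^bsub>?G\<^esub> B \<otimes>\<^bsub>?G\<^esub> C = A \<otimes>\<^bsub>?G\<^esub> (B \<otimes>\<^bsub>?G\<^esub> C)"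
    by (simp add: u v w presented_mult app)
qed

text \<open>Both factors embed in \<open>G\<close>, so it is no restriction that \<open>H\<close> and \<open>K\<close> have elements of
  the same type as \<open>G\<close>.\<close>

definition splits_as_direct_product :: "'g monoid \<Rightarrow> bool" where
  "splits_as_direct_product G \<longleftrightarrow>
    (\<exists>(H :: 'g monoid) (K :: 'g monoid). group H \<and> group K \<and>
      carrier H \<noteq> {\<one>\<^bsub>H\<^esub>} \<and> carrier K \<noteq> {\<one>\<^bsub>K\<^esub>} \<and> G \<cong> H \<times>\<times> K)"


section \<open>Right-angled Coxeter groups and right-angled Artin groups\<close>

definition raag_rels :: "'a pair_pre_digraph \<Rightarrow> ('a word \<times> 'a word) set" where
  "raag_rels \<Gamma> = {([(s, True), (t, True)], [(t, True), (s, True)]) | s t. (s, t) \<in> parcs \<Gamma>}"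

definition racg_rels :: "'a pair_pre_digraph \<Rightarrow> ('a word \<times> 'a word) set" where
  "racg_rels \<Gamma> = {([(s, True), (s, True)], []) | s. s \<in> pverts \<Gamma>} \<union> raag_rels \<Gamma>"

definition raag :: "'a pair_pre_digraph \<Rightarrow> 'a word set monoid" where
  "raag \<Gamma> = presented_group (pverts \<Gamma>) (raag_rels \<Gamma>)"

definition raag_gen :: "'a pair_pre_digraph \<Rightarrow> 'a \<Rightarrow> 'a word set" where
  "raag_gen \<Gamma> = presented_gen (pverts \<Gamma>) (raag_rels \<Gamma>)"

definition racg :: "'a pair_pre_digraph \<Rightarrow> 'a word set monoid" where
  "racg \<Gamma> = presented_group (pverts \<Gamma>) (racg_rels \<Gamma>)"

definition racg_gen :: "'a pair_pre_digraph \<Rightarrow> 'a \<Rightarrow> 'a word set" where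
  "racg_gen \<Gamma> = presented_gen (pverts \<Gamma>) (racg_rels \<Gamma>)"

definition clique :: "'a pair_pre_digraph \<Rightarrow> 'a set \<Rightarrow> bool" where
  "clique \<Gamma> T \<longleftrightarrow> T \<subseteq> pverts \<Gamma> \<and> pairwise (\<lambda>s t. (s, t) \<in> parcs \<Gamma>) T"


section \<open>Cube complexes\<close>

text \<open>A cube complex in which every cube is embedded and determined by its vertex set (as is the
  case for CAT(0) cube complexes) is represented by the set \<open>K\<close> of the vertex sets of all its
  cubes, including the vertices (singletons) and edges (two-element sets). The cube structure on
  a vertex set is recovered from the 1-skeleton: a chart identifies the vertices of
  \<open>[0,1]\<^sup>n\<close>, written as subsets of \<open>{..<n}\<close>, with the vertices of the cube.\<close>

definition edges :: "'v set set \<Rightarrow> 'v set set" where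
  "edges K = {e \<in> K. card e = 2}"

definition cube_chart :: "'v set set \<Rightarrow> nat \<Rightarrow> (nat set \<Rightarrow> 'v) \<Rightarrow> bool" where
  "cube_chart K n c \<longleftrightarrow>
    c ` Pow {..<n} \<in> K \<and> inj_on c (Pow {..<n}) \<and>
    (\<forall>A\<in>Pow {..<n}. \<forall>B\<in>Pow {..<n}. {c A, c B} \<in> edges K \<longleftrightarrow> card ((A - B) \<union> (B - A)) = 1)"

text \<open>Points of the geometric realization are represented by functions on the vertices: the point
  of the cube \<open>c\<close> with coordinates \<open>t \<in> [0,1]\<^sup>n\<close> is sent to its multilinear barycentric coordinates
  with respect to the vertices of the cube. This embeds every cube and is compatible with passing
  to faces and with changing the chart. The realization carries the topology of pointwise
  convergence; for locally finite complexes (such as the ones considered here) this is the usual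
  topology, because \<open>{x. x v > 0}\<close> is then the open star of the vertex \<open>v\<close>, which meets only
  finitely many cubes.\<close>

definition cube_point :: "nat \<Rightarrow> (nat set \<Rightarrow> 'v) \<Rightarrow> (nat \<Rightarrow> real) \<Rightarrow> 'v \<Rightarrow> real" where
  "cube_point n c t = (\<lambda>v. \<Sum>A | A \<subseteq> {..<n} \<and> c A = v. \<Prod>i<n. if i \<in> A then t i else 1 - t i)"

definition unit_cube :: "nat \<Rightarrow> (nat \<Rightarrow> real) set" where
  "unit_cube n = {t. \<forall>i<n. 0 \<le> t i \<and> t i \<le> 1}"

definition realization :: "'v set set \<Rightarrow> ('v \<Rightarrow> real) set" where
  "realization K = {cube_point n c t | n c t. cube_chart K n c \<and> t \<in> unit_cube n}"

definition midcubes :: "'v set set \<Rightarrow> ('v \<Rightarrow> real) set set" where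
  "midcubes K =
    {cube_point n c ` {t \<in> unit_cube n. t j = 1 / 2} | n c j. cube_chart K n c \<and> j < n}"

text \<open>A midcube is contained in another one exactly if it is a face of it. Hyperplanes are the
  unions of the classes of the equivalence relation on midcubes generated by being a face.\<close>

definition midcube_face :: "'v set set \<Rightarrow> (('v \<Rightarrow> real) set \<times> ('v \<Rightarrow> real) set) set" where
  "midcube_face K = {(M, N). M \<in> midcubes K \<and> N \<in> midcubes K \<and> M \<subseteq> N}"

definition hyperplanes :: "'v set set \<Rightarrow> ('v \<Rightarrow> real) set set" where
  "hyperplanes K = {\<Union> ((midcube_face K \<union> (midcube_face K)\<inverse>)\<^sup>* `` {M}) | M. M \<in> midcubes K}"

definition halfspaces_of :: "'v set set \<Rightarrow> ('v \<Rightarrow> real) set \<Rightarrow> ('v \<Rightarrow> real) set set" where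
  "halfspaces_of K J =
    (\<lambda>C. top_of_set (realization K) closure_of C) ` components (realization K - J)"

definition halfspaces :: "'v set set \<Rightarrow> ('v \<Rightarrow> real) set set" where
  "halfspaces K = (\<Union>J\<in>hyperplanes K. halfspaces_of K J)"


section \<open>Ultrafilters and the Roller boundary\<close>

definition ultrafilters :: "'v set set \<Rightarrow> ('v \<Rightarrow> real) set set set" where
  "ultrafilters K = {\<alpha>. \<alpha> \<subseteq> halfspaces K \<and>
    (\<forall>J\<in>hyperplanes K. \<exists>!h. h \<in> halfspaces_of K J \<and> h \<in> \<alpha>) \<and>
    (\<forall>h\<in>\<alpha>. \<forall>k\<in>halfspaces K. h \<subseteq> k \<longrightarrow> k \<in> \<alpha>)}"

text \<open>The generating family is closed under binary intersections, hence a basis.\<close>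

definition ultrafilter_topology :: "'v set set \<Rightarrow> ('v \<Rightarrow> real) set set topology" where
  "ultrafilter_topology K = topology_generated_by
    (insert (ultrafilters K)
      {{\<alpha> \<in> ultrafilters K. H \<subseteq> \<alpha>} | H. finite H \<and> H \<subseteq> halfspaces K})"

definition roller_boundary :: "'v set set \<Rightarrow> ('v \<Rightarrow> real) set set set" where
  "roller_boundary K =
    {\<alpha> \<in> ultrafilters K. \<exists>h :: nat \<Rightarrow> _. (\<forall>n. h n \<in> \<alpha>) \<and> (\<forall>n. h (Suc n) \<subset> h n)}"

definition non_terminating :: "('v \<Rightarrow> real) set set \<Rightarrow> bool" where
  "non_terminating \<alpha> \<longleftrightarrow> (\<forall>h\<in>\<alpha>. \<exists>k\<in>\<alpha>. k \<subset> h)"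

definition B_boundary :: "'v set set \<Rightarrow> ('v \<Rightarrow> real) set set set" where
  "B_boundary K =
    ultrafilter_topology K closure_of {\<alpha> \<in> roller_boundary K. non_terminating \<alpha>}"


section \<open>The two complexes\<close>

definition davis_complex :: "'a pair_pre_digraph \<Rightarrow> 'a word set set set" where
  "davis_complex \<Gamma> =
    {w <#\<^bsub>racg \<Gamma>\<^esub> generate (racg \<Gamma>) (racg_gen \<Gamma> ` T) | w T. w \<in> carrier (racg \<Gamma>) \<and> clique \<Gamma> T}"

text \<open>The universal cover of the Salvetti complex, as the complex of edge-path homotopy classes.
  Edge paths in the Salvetti complex are the words in the generators and their inverses, and homotopy
  of edge paths is generated by cancellation of backtracks and by the squares \<open>st = ts\<close>; so the
  vertices of the universal cover are the elements of the right-angled Artin group, with an edge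
  from \<open>g\<close> to \<open>gs\<close> for every lift of the loop \<open>s\<close>. The lift starting at \<open>g\<close> of the torus
  belonging to a clique \<open>T\<close> is a cube, whose vertices are the products of \<open>g\<close> with the products
  of subsets of \<open>T\<close>; enumerations of one subset in different orders have the same product.\<close>

definition salvetti_universal_cover :: "'a pair_pre_digraph \<Rightarrow> 'a word set set set" where
  "salvetti_universal_cover \<Gamma> =
    {g <#\<^bsub>raag \<Gamma>\<^esub> {foldr (\<lambda>s x. raag_gen \<Gamma> s \<otimes>\<^bsub>raag \<Gamma>\<^esub> x) ss \<one>\<^bsub>raag \<Gamma>\<^esub> | ss. distinct ss \<and> set ss \<subseteq> T}
      | g T. g \<in> carrier (raag \<Gamma>) \<and> clique \<Gamma> T}"

end

theory Submission
  imports Defs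
begin

text \<open>
  Both complexes are instances of one structure. Label every edge of the Davis complex by its
  generator: a label then acts on the vertices as an involution, adjacent labels commute, and two
  label words lead from a vertex to the same vertex only if these two rules force it. The universal
  cover of the Salvetti complex has this structure as well, if the edge between \<open>g\<close> and \<open>gs\<close> is
  labelled by \<open>s\<close> together with the parity of the exponent of \<open>s\<close> at that end of the edge from which
  \<open>s\<close> leads away; it looks like the Davis complex of the graph that has two non-adjacent copies
  of every vertex. The locale \<open>right_angled\<close> states these rules. Parallel edges form walls, a wall
  cuts the vertices into two halfspaces, and everything rests on two facts about them: a shortest
  path crosses no wall twice, and two walls cross only if their labels are adjacent
  (\<open>transverse_adj\<close>).

  The topological definitions are reduced to vertex sets in the locale \<open>cube_halfspaces\<close>: a halfspace
  \<open>h\<close> of vertices extends to a continuous function \<open>coord h\<close> on the realization, the total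
  barycentric weight of the vertices in \<open>h\<close>. Its level set \<open>1 / 2\<close> is the hyperplane, the two
  sides of it are connected, and inclusion of halfspaces can be read off from the vertices. So
  \<open>B(X) = \<partial>X\<close> becomes a statement about families of vertex sets (\<open>B_boundary_eq_iff\<close>).

  That statement holds exactly if the graph of labels is not a join (\<open>bottomless_dense_iff\<close>). In a
  join with parts \<open>A\<close> and \<open>B\<close> every \<open>A\<close>-wall crosses every \<open>B\<close>-wall. An ultrafilter that escapes to
  infinity through \<open>A\<close>-walls but stays at one vertex with respect to \<open>B\<close>-walls then has a
  neighbourhood without non-terminating ultrafilters. If the graph is not a join, its complement is
  connected. Let \<open>\<omega>\<close> be a point of the Roller boundary and \<open>H\<close> a finite subset of it. A halfspace \<open>k\<close>
  far down a descending chain in \<open>\<omega>\<close> is contained in, or crosses, each member of \<open>H\<close>. Start at an edge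
  that enters \<open>k\<close> inside all members of \<open>H\<close>, and follow an infinite walk in the complement graph that
  meets every label again and again. Consecutive walls along it do not cross, so the
  halfspaces entered are nested, and as soon as the walk meets the label of a member of \<open>H\<close>, the
  halfspace entered is inside that member. The limit of the ray is non-terminating and contains \<open>H\<close>.
  Finally, an ultrafilter outside the Roller boundary is a vertex (\<open>vertex_or_unbounded\<close>), and the
  halfspaces at a vertex isolate it from the non-terminating ultrafilters.

  The same condition decides whether the group splits. A join gives a product decomposition directly
  from the presentation. If the graph is not a join, a closed walk in its complement through all
  labels spells an element \<open>g\<close> which moves along a chain of nested halfspaces. An element commuting
  with \<open>g\<close> stays near this chain, hence shifts it; the shift determines the element, and so the
  centralizer of \<open>g\<close> embeds into the integers. In a product of two nontrivial groups, the
  centralizer of every element contains two nontrivial elements with trivially intersecting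
  cyclic subgroups, which is impossible in an infinite cyclic group.
\<close>

section \<open>Labelled vertices and walls\<close>

text \<open>The congruence of label words in which labels are involutions and adjacent labels commute. It serves
  both groups, whose presentations are compared with it later.\<close>

inductive word_eq :: "'l set \<Rightarrow> ('l \<Rightarrow> 'l \<Rightarrow> bool) \<Rightarrow> 'l list \<Rightarrow> 'l list \<Rightarrow> bool" for L adj where
  word_refl: "w \<in> lists L \<Longrightarrow> word_eq L adj w w"
| word_sym: "word_eq L adj u w \<Longrightarrow> word_eq L adj w u"
| word_trans: "word_eq L adj u v \<Longrightarrow> word_eq L adj v w \<Longrightarrow> word_eq L adj u w"
| cancel: "u \<in> lists L \<Longrightarrow> v \<in> lists L \<Longrightarrow> x \<in> L \<Longrightarrow> word_eq L adj (u @ [x, x] @ v) (u @ v)"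
| swap: "u \<in> lists L \<Longrightarrow> v \<in> lists L \<Longrightarrow> adj x y \<Longrightarrow> word_eq L adj (u @ [x, y] @ v) (u @ [y, x] @ v)"

lemma count_list_distinct: "distinct xs \<Longrightarrow> x \<in> set xs \<Longrightarrow> count_list xs x = 1"
  by (induction xs) auto

text \<open>The vertices are permuted by the labels as by the elements of a right-angled Coxeter group acting
  simply transitively from the right: \<open>reach\<close> is transitivity, and \<open>universal\<close> says that the action is
  free. The structure refers to a base point only, but it looks the same from every vertex.\<close>

locale right_angled =
  fixes L :: "'l set" and adj :: "'l \<Rightarrow> 'l \<Rightarrow> bool" and V :: "'v set"
    and step :: "'v \<Rightarrow> 'l \<Rightarrow> 'v" and base :: 'v
  assumes finite_L: "finite L"
    and adj_L: "adj x y \<Longrightarrow> x \<in> L"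
    and adj_sym: "adj x y \<Longrightarrow> adj y x"
    and adj_irrefl: "\<not> adj x x"
    and base: "base \<in> V"
    and step_V: "v \<in> V \<Longrightarrow> x \<in> L \<Longrightarrow> step v x \<in> V"
    and step_step: "v \<in> V \<Longrightarrow> x \<in> L \<Longrightarrow> step (step v x) x = v"
    and step_commute: "v \<in> V \<Longrightarrow> adj x y \<Longrightarrow> step (step v x) y = step (step v y) x"
    and reach: "v \<in> V \<Longrightarrow> \<exists>w\<in>lists L. v = foldl step base w"
    and universal: "u \<in> lists L \<Longrightarrow> w \<in> lists L \<Longrightarrow> foldl step base u = foldl step base w \<Longrightarrow>
      word_eq L adj u w"
begin

abbreviation path :: "'v \<Rightarrow> 'l list \<Rightarrow> 'v" where
  "path \<equiv> foldl step"

text \<open>The labels that lead from an edge labelled \<open>x\<close> to an edge of the same wall.\<close>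

definition star :: "'l \<Rightarrow> 'l set" where
  "star x = insert x {y. adj x y}"

text \<open>The class of the edge at \<open>v\<close> with label \<open>x\<close> under opposite sides of squares. The opposite edges are
  exactly those reached by labels in \<open>star x\<close>, so the orbit of \<open>v\<close> under \<open>star x\<close>, together with the
  label, identifies the class.\<close>

definition wall :: "'v \<Rightarrow> 'l \<Rightarrow> 'v set \<times> 'l" where
  "wall v x = ({path v w | w. w \<in> lists (star x)}, x)"

primrec walls :: "'v \<Rightarrow> 'l list \<Rightarrow> ('v set \<times> 'l) list" where
  "walls v [] = []"
| "walls v (x # w) = wall v x # walls (step v x) w"

lemma star_L: "x \<in> L \<Longrightarrow> star x \<subseteq> L"
  using adj_L adj_sym by (auto simp: star_def)

lemma path_V: "v \<in> V \<Longrightarrow> w \<in> lists L \<Longrightarrow> path v w \<in> V"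
  by (induction w arbitrary: v) (auto simp: step_V)

lemma path_rev: "v \<in> V \<Longrightarrow> w \<in> lists L \<Longrightarrow> path (path v w) (rev w) = v"
proof (induction w arbitrary: v)
  case (Cons x w)
  then show ?case using Cons.IH[of "step v x"] by (simp add: step_V step_step)
qed simp

lemma connect: 
  assumes "u \<in> V" "v \<in> V" shows "\<exists>w\<in>lists L. v = path u w"
proof -
  obtain p q where pq: "p \<in> lists L" "q \<in> lists L" "u = path base p" "v = path base q"
    using reach assms by metis
  have "path u (rev p @ q) = v" using pq path_rev[OF base, of p] by simp
  then show ?thesis using pq by (intro bexI[of _ "rev p @ q"]) auto
qed

lemma walls_append: "walls v (u @ w) = walls v u @ walls (path v u) w"
  by (induction u arbitrary: v) auto

lemma walls_labels: "map snd (walls v w) = w"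
  by (induction w arbitrary: v) (auto simp: wall_def)

lemma wall_path:
  assumes "v \<in> V" "x \<in> L" "w \<in> lists (star x)"
  shows "wall (path v w) x = wall v x"
proof -
  have wL: "w \<in> lists L" using assms star_L by auto
  have "path v u = path (path v w) (rev w @ u)" for u
    using path_rev[OF assms(1) wL] by simp
  then have "{path v u |u. u \<in> lists (star x)} \<subseteq> {path (path v w) u |u. u \<in> lists (star x)}"
    using assms(3) by (smt (verit, ccfv_threshold) Collect_mono_iff append_in_lists_conv in_lists_conv_set set_rev)
  moreover have "path (path v w) u = path v (w @ u)" for u by simp
  then have "{path (path v w) u |u. u \<in> lists (star x)} \<subseteq> {path v u |u. u \<in> lists (star x)}"
    using assms(3) by (smt (verit, ccfv_threshold) Collect_mono_iff append_in_lists_conv)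
  ultimately show ?thesis by (simp add: wall_def)
qed

lemma wall_step_same: "v \<in> V \<Longrightarrow> x \<in> L \<Longrightarrow> wall (step v x) x = wall v x"
  using wall_path[of v x "[x]"] by (simp add: star_def)

lemma wall_step_adj: "v \<in> V \<Longrightarrow> adj x y \<Longrightarrow> wall (step v y) x = wall v x"
  using wall_path[of v x "[y]"] by (simp add: star_def adj_L)

lemma wall_label: "wall v x = wall v' y \<Longrightarrow> x = y"
  by (simp add: wall_def)

lemma wall_eqD:
  assumes "wall v x = wall v' y"
  obtains w where "w \<in> lists (star x)" "v' = path v w"
proof -
  have "v' \<in> fst (wall v' y)" by (auto simp: wall_def intro!: exI[of _ "[]"])
  then have "v' \<in> fst (wall v x)" using assms by simp
  then show thesis using that by (auto simp: wall_def)
qed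

text \<open>Cancelling a backtrack \<open>xx\<close> removes two crossings of one wall, and going the other way around a
  square crosses the same two walls in the other order. So the parity of the number of crossings of
  each wall depends only on the end points.\<close>

lemma word_eq_invariants:
  assumes "word_eq L adj u w"
  shows "\<forall>v\<in>V. path v u = path v w \<and> even (count_list (walls v u) J) = even (count_list (walls v w) J)
    \<and> even (length u) = even (length w)"
  using assms
proof (induction rule: word_eq.induct)
  case (cancel u v x)
  then show ?case 
    by (auto simp: walls_append step_step path_V wall_step_same)
next
  case (swap u v x y)
  have L: "x \<in> L" "y \<in> L" using swap adj_L adj_sym by blast+
  show ?case
  proof
    fix p assume "p \<in> V"
    then have q: "path p u \<in> V" using swap path_V by blast
    have "wall (step (path p u) y) x = wall (path p u) x" "wall (step (path p u) x) y = wall (path p u) y"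
      using wall_step_adj[OF q] swap adj_sym by blast+
    then show "path p (u @ [x, y] @ v) = path p (u @ [y, x] @ v) \<and>
      even (count_list (walls p (u @ [x, y] @ v)) J) = even (count_list (walls p (u @ [y, x] @ v)) J)
      \<and> even (length (u @ [x, y] @ v)) = even (length (u @ [y, x] @ v))"
      using step_commute[OF q swap(3)] by (simp add: walls_append)
  qed
qed auto

lemma same_end_word_eq:
  assumes "v \<in> V" "u \<in> lists L" "w \<in> lists L" "path v u = path v w"
  obtains p where "p \<in> lists L" "v = path base p" "word_eq L adj (p @ u) (p @ w)"
proof -
  obtain p where p: "p \<in> lists L" "v = path base p" using reach assms(1) by blast
  have "word_eq L adj (p @ u) (p @ w)"
    using assms p by (intro universal) auto
  then show thesis using that p by blast
qed

lemma same_end_parity: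
  assumes "v \<in> V" "u \<in> lists L" "w \<in> lists L" "path v u = path v w"
  shows "even (count_list (walls v u) J) = even (count_list (walls v w) J)"
    and "even (length u) = even (length w)"
proof -
  obtain p where p: "p \<in> lists L" "v = path base p" "word_eq L adj (p @ u) (p @ w)"
    using same_end_word_eq[OF assms] .
  show "even (count_list (walls v u) J) = even (count_list (walls v w) J)"
     "even (length u) = even (length w)"
    using word_eq_invariants[OF p(3), of J] base p(2) by (auto simp: walls_append)
qed

text \<open>Crossing parity, which by \<open>same_end_parity\<close> does not depend on the path.\<close>

definition sep :: "'v set \<times> 'l \<Rightarrow> 'v \<Rightarrow> 'v \<Rightarrow> bool" where
  "sep J a b \<longleftrightarrow> (\<exists>w\<in>lists L. b = path a w \<and> odd (count_list (walls a w) J))"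

lemma sep_path: "a \<in> V \<Longrightarrow> w \<in> lists L \<Longrightarrow> sep J a (path a w) \<longleftrightarrow> odd (count_list (walls a w) J)"
  unfolding sep_def using same_end_parity(1) by blast

lemma sep_trans:
  assumes "a \<in> V" "b \<in> V" "c \<in> V" shows "sep J a c \<longleftrightarrow> (sep J a b \<noteq> sep J b c)"
proof -
  obtain u w where u: "u \<in> lists L" "b = path a u" and w: "w \<in> lists L" "c = path b w"
    using connect assms by metis
  have "c = path a (u @ w)" using u w by simp
  moreover have "sep J a (path a (u @ w)) \<longleftrightarrow> odd (count_list (walls a (u @ w)) J)"
    using sep_path[OF assms(1), of "u @ w" J] u w by simp
  ultimately show ?thesis
    using sep_path[OF assms(1) u(1)] sep_path[OF assms(2) w(1)] u(2) w(2) by (auto simp: walls_append)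
qed

lemma sep_refl: "a \<in> V \<Longrightarrow> \<not> sep J a a"
  using sep_path[of a "[]"] by simp

lemma sep_sym: "a \<in> V \<Longrightarrow> b \<in> V \<Longrightarrow> sep J a b = sep J b a"
  using sep_trans sep_refl by blast

lemma sep_step: "v \<in> V \<Longrightarrow> x \<in> L \<Longrightarrow> sep J v (step v x) \<longleftrightarrow> J = wall v x"
  using sep_path[of v "[x]" J] by auto

lemma step_neq: "v \<in> V \<Longrightarrow> x \<in> L \<Longrightarrow> step v x \<noteq> v"
  using sep_step sep_refl by metis

text \<open>If a path crosses no wall twice, every wall on it separates its end points, so every other path
  between them crosses that wall too and has to use its label.\<close>

lemma distinct_support:
  assumes "v \<in> V" "w \<in> lists L" "s \<in> lists L" "path v w = path v s" "distinct (walls v w)"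
  shows "set w \<subseteq> set s"
proof
  fix y assume "y \<in> set w"
  then obtain J where J: "J \<in> set (walls v w)" "snd J = y"
    using walls_labels[of v w] by (metis image_iff set_map)
  have "count_list (walls v w) J = 1"
    using count_list_distinct[OF assms(5) J(1)] .
  then have "odd (count_list (walls v s) J)"
    using same_end_parity(1)[OF assms(1-4), of J] by simp
  then have "J \<in> set (walls v s)" using count_notin by fastforce
  then show "y \<in> set s" using J(2) walls_labels[of v s] by (metis image_eqI set_map)
qed

lemma path_snoc_commute:
  assumes "v \<in> V" "x \<in> L" "w \<in> lists {y. adj x y}"
  shows "path (step v x) w = step (path v w) x"
  using assms
proof (induction w arbitrary: v)
  case (Cons y w)
  then have "adj x y" by simp
  then have "y \<in> L" using adj_L adj_sym by blast
  then show ?case using Cons step_commute[of v x y] by (simp add: step_V)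
qed simp

section \<open>Shortest paths cross no wall twice\<close>

text \<open>A word that crosses the wall of \<open>x\<close> twice is \<open>x b x\<close> up to its ends, where \<open>b\<close> leads along the wall
  and hence, by \<open>distinct_support\<close>, uses only labels adjacent to \<open>x\<close>. Then \<open>x\<close> commutes past \<open>b\<close> and
  the two occurrences cancel.\<close>

lemma shorten:
  assumes "u \<in> V" "w \<in> lists L" "\<not> distinct (walls u w)"
  shows "\<exists>w'\<in>lists L. path u w' = path u w \<and> length w' < length w"
  using assms
proof (induction w arbitrary: u)
  case (Cons x b)
  have x: "x \<in> L" "b \<in> lists L" and ux: "step u x \<in> V" using Cons.prems step_V by auto
  show ?case
  proof (cases "distinct (walls (step u x) b)")
    case False
    then obtain b' where "b' \<in> lists L" "path (step u x) b' = path (step u x) b" "length b' < length b"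
      using Cons.IH[OF ux x(2)] by blast
    then show ?thesis using x by (intro bexI[of _ "x # b'"]) auto
  next
    case dist: True
    then have "wall u x \<in> set (walls (step u x) b)" using Cons.prems by simp
    then obtain i where i: "i < length (walls (step u x) b)" "walls (step u x) b ! i = wall u x"
      by (auto simp: in_set_conv_nth)
    have len: "length (walls (step u x) b) = length b" using walls_labels by (metis length_map)
    define b1 y b2 where "b1 = take i b" and "y = b ! i" and "b2 = drop (Suc i) b"
    have b: "b = b1 @ y # b2" using i len by (simp add: b1_def y_def b2_def id_take_nth_drop)
    have bL: "b1 \<in> lists L" "b2 \<in> lists L" using x(2) by (auto simp: b)
    have lb1: "length (walls (step u x) b1) = i" 
      using i len walls_labels[of "step u x" b1] by (metis b1_def length_map length_take min.absorb4)
    let ?p = "path (step u x) b1"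
    have wy: "wall ?p y = wall u x"
      using i(2) lb1 by (simp add: b walls_append nth_append)
    then have "y = x" using wall_label by blast
    \<comment> \<open>The two crossings belong to one wall, so \<open>b1\<close> can be replaced by a path along this wall.\<close>
    obtain s where s: "s \<in> lists (star x)" "?p = path u s"
      using wall_eqD wy[symmetric] by metis
    have sL: "s \<in> lists L" using s star_L[OF x(1)] by auto
    have "?p = path (step u x) (x # s)" using s Cons.prems(1) x(1) by (simp add: step_step)
    then have "set b1 \<subseteq> set (x # s)"
      using distinct_support[OF ux bL(1), of "x # s"] sL x dist by (simp add: b walls_append)
    then have b1: "set b1 \<subseteq> star x" using s by (auto simp: star_def)
    have "x \<notin> set b1"
    proof
      assume "x \<in> set b1"
      then obtain c d where cd: "b1 = c @ x # d" by (meson split_list)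
      have "wall (path (step u x) c) x = wall u x"
        using wall_path[OF ux x(1), of c] wall_step_same Cons.prems(1) x(1) b1 cd by auto
      then show False using dist wy \<open>y = x\<close> by (auto simp: b cd walls_append)
    qed
    then have lk: "b1 \<in> lists {y. adj x y}" using b1 by (auto simp: star_def)
    have "step ?p x = path u b1"
      using path_snoc_commute[OF Cons.prems(1) x(1) lk] path_V[OF Cons.prems(1) bL(1)]
      by (simp add: step_step x(1))
    then show ?thesis using bL \<open>y = x\<close> by (intro bexI[of _ "b1 @ b2"]) (auto simp: b)
  qed
qed simp

lemma geodesic:
  assumes "u \<in> V" "s \<in> lists L"
  obtains w where "w \<in> lists L" "path u w = path u s" "distinct (walls u w)" "set w \<subseteq> set s"
proof -
  let ?P = "\<lambda>w. w \<in> lists L \<and> path u w = path u s"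
  obtain w where w: "?P w" "\<forall>w'. ?P w' \<longrightarrow> length w \<le> length w'"
    using ex_has_least_nat[of ?P s length] assms by blast
  then have "distinct (walls u w)" using shorten[OF assms(1), of w] by fastforce
  then show thesis using that w distinct_support[OF assms(1) _ assms(2), of w] by blast
qed

section \<open>Halfspaces of vertices\<close>

text \<open>The side of the wall that the edge from \<open>v\<close> with label \<open>x\<close> enters.\<close>

definition far :: "'v \<Rightarrow> 'l \<Rightarrow> 'v set" where
  "far v x = {u \<in> V. sep (wall v x) v u}"

definition HS :: "'v set set" where
  "HS = {far v x | v x. v \<in> V \<and> x \<in> L}"

lemma far_in_HS: "v \<in> V \<Longrightarrow> x \<in> L \<Longrightarrow> far v x \<in> HS"
  by (auto simp: HS_def)

lemma HS_sub: "h \<in> HS \<Longrightarrow> h \<subseteq> V"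
  by (auto simp: HS_def far_def)

lemma not_in_far: "v \<in> V \<Longrightarrow> v \<notin> far v x"
  by (simp add: far_def sep_refl)

lemma step_in_far: "v \<in> V \<Longrightarrow> x \<in> L \<Longrightarrow> step v x \<in> far v x"
  by (simp add: far_def sep_step step_V)

lemma far_sep:
  assumes "v \<in> V" "a \<in> V" "b \<in> V" shows "sep (wall v x) a b \<longleftrightarrow> (a \<in> far v x) \<noteq> (b \<in> far v x)"
  using assms sep_trans[of v a b] by (auto simp: far_def)

lemma far_step: "v \<in> V \<Longrightarrow> x \<in> L \<Longrightarrow> far (step v x) x = V - far v x"
  using sep_trans[of v "step v x" _ "wall v x"] sep_step[of v x "wall v x"]
  by (auto simp: far_def wall_step_same step_V)

lemma HS_compl: "h \<in> HS \<Longrightarrow> V - h \<in> HS"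
  by (auto simp: HS_def far_step[symmetric]) (metis far_step step_V)

lemma crossing_wall:
  assumes "v \<in> V" "p \<in> V" "y \<in> L" "(p \<in> far v x) \<noteq> (step p y \<in> far v x)"
  shows "wall v x = wall p y" "x = y"
proof -
  show "wall v x = wall p y" using assms far_sep sep_step step_V by metis
  then show "x = y" by (rule wall_label)
qed

lemma far_eqI:
  assumes "h \<in> HS" "p \<in> V" "y \<in> L" "p \<notin> h" "step p y \<in> h"
  shows "h = far p y"
proof -
  obtain v x where h: "h = far v x" "v \<in> V" "x \<in> L" using assms(1) by (auto simp: HS_def)
  have w: "wall v x = wall p y" using crossing_wall(1)[of v p y x] assms h by blast
  have "u \<in> h \<longleftrightarrow> u \<in> far p y" if "u \<in> V" for u
    using far_sep[OF h(2) assms(2) that] far_sep[OF assms(2,2) that] assms(4) not_in_far[OF assms(2)] h(1) w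
    by metis
  then show ?thesis using HS_sub[OF assms(1)] by (auto simp: far_def)
qed

lemma far_same_wall:
  assumes "v \<in> V" "x \<in> L" "p \<in> V" "p \<notin> far v x" "wall p x = wall v x"
  shows "far p x = far v x"
proof -
  have "step p x \<in> far v x" 
    using far_sep[of v p "step p x" x] sep_step[of p x] assms step_V by metis
  then show ?thesis using far_eqI far_in_HS assms by metis
qed

lemma enter:
  assumes "a \<notin> h" "path a w \<in> h"
  obtains w1 y w2 where "w = w1 @ y # w2" "path a w1 \<notin> h" "step (path a w1) y \<in> h"
  using assms
proof (induction w arbitrary: thesis rule: rev_induct)
  case (snoc y w)
  show ?case
  proof (cases "path a w \<in> h")
    case True
    then show ?thesis using snoc.IH[of thesis] snoc.prems by (metis append_Cons append_assoc)
  next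
    case False
    then show ?thesis using snoc.prems(1)[of w y "[]"] snoc.prems by simp
  qed
qed simp

text \<open>A shortest path that leaves \<open>h\<close> and returns crosses the wall of \<open>h\<close> twice.\<close>

lemma convex:
  assumes "h \<in> HS" "a \<in> h" "b \<in> h"
  obtains w where "w \<in> lists L" "path a w = b" "\<And>w1 w2. w = w1 @ w2 \<Longrightarrow> path a w1 \<in> h"
proof -
  obtain v x where h: "h = far v x" "v \<in> V" "x \<in> L" using assms(1) by (auto simp: HS_def)
  have V: "a \<in> V" "b \<in> V" using assms HS_sub by auto
  obtain s where "s \<in> lists L" "b = path a s" using connect[OF V] by blast
  then obtain w where w: "w \<in> lists L" "path a w = b" "distinct (walls a w)"
    using geodesic[OF V(1)] by metis
  have "path a w1 \<in> h" if ww: "w = w1 @ w2" for w1 w2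
  proof (rule ccontr)
    assume n: "path a w1 \<notin> h"
    have L: "w1 \<in> lists L" "w2 \<in> lists L" using w(1) ww by auto
    have m: "path a w1 \<in> V" using path_V V L by blast
    have "sep (wall v x) a (path a w1)" "sep (wall v x) (path a w1) (path (path a w1) w2)"
      using far_sep[OF h(2)] m V n assms h(1) w(2) ww by auto
    then have "odd (count_list (walls a w1) (wall v x))" "odd (count_list (walls (path a w1) w2) (wall v x))"
      using sep_path[OF V(1) L(1)] sep_path[OF m L(2)] by auto
    then have "wall v x \<in> set (walls a w1)" "wall v x \<in> set (walls (path a w1) w2)"
      using count_notin by fastforce+
    then show False using w(3) ww by (auto simp: walls_append)
  qed
  then show thesis using that w by blast
qed

text \<open>All four quadrants cut out by the two halfspaces contain vertices.\<close>

definition transverse :: "'v set \<Rightarrow> 'v set \<Rightarrow> bool" where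
  "transverse h k \<longleftrightarrow> h \<inter> k \<noteq> {} \<and> h - k \<noteq> {} \<and> k - h \<noteq> {} \<and> V - h - k \<noteq> {}"

text \<open>By convexity there is an edge of the first wall on either side of the second wall. These two edges
  are joined by labels from the star of the first label; on the way the second wall is crossed, so its
  label belongs to this star.\<close>

lemma transverse_adj:
  assumes "transverse (far p x) (far q y)" "p \<in> V" "q \<in> V" "x \<in> L" "y \<in> L"
  shows "adj x y"
proof -
  let ?h = "far p x" and ?k = "far q y"
  have HS: "?h \<in> HS" "?k \<in> HS" "V - ?k \<in> HS" using far_in_HS HS_compl assms by blast+
  obtain a b c d where abcd: "a \<in> ?h \<inter> ?k" "b \<in> ?k - ?h" "c \<in> ?h - ?k" "d \<in> V - ?h - ?k"
    using assms(1) by (auto simp: transverse_def)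
  have edge: "\<exists>e\<in>k. e \<in> V \<and> wall p x = wall e x" if k: "k \<in> HS" and ab: "a \<in> ?h \<inter> k" "b \<in> k - ?h" for k a b
  proof -
    obtain w where w: "w \<in> lists L" "path b w = a" "\<And>w1 w2. w = w1 @ w2 \<Longrightarrow> path b w1 \<in> k"
      using convex[OF k, of b a] ab by blast
    then obtain w1 z w2 where z: "w = w1 @ z # w2" "path b w1 \<notin> ?h" "step (path b w1) z \<in> ?h"
      using enter[of b ?h w] ab by blast
    have e: "path b w1 \<in> k" "path b w1 \<in> V" using w z(1) HS_sub[OF k] by blast+
    have "z \<in> L" using w z by simp
    then have "wall p x = wall (path b w1) z" "x = z"
      using crossing_wall[OF assms(2) e(2), of z x] z by auto
    then show ?thesis using e by blast
  qed
  obtain e f where e: "e \<in> ?k" "e \<in> V" "wall p x = wall e x" and f: "f \<in> V - ?k" "wall p x = wall f x"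
    using edge[OF HS(2), of a b] edge[OF HS(3), of c d] abcd HS_sub[OF HS(1)] by blast
  obtain s where s: "s \<in> lists (star x)" "f = path e s"
    using wall_eqD e(3) f(2) by metis
  have sL: "s \<in> lists L" using s star_L assms by auto
  obtain s1 z s2 where z: "s = s1 @ z # s2" "path e s1 \<notin> V - ?k" "step (path e s1) z \<in> V - ?k"
    using enter[of e "V - ?k" s] e(1) f(1) s(2) by blast
  have s1: "path e s1 \<in> V" using path_V e sL z by auto
  have zL: "z \<in> L" using sL z by auto
  have wz: "wall q y = wall (path e s1) z" "y = z"
    using crossing_wall[OF assms(3) s1 zL, of y] z s1 by auto
  have "y \<noteq> x"
  proof
    assume "y = x"
    then have "wall q y = wall p x"
      using wz wall_path[OF e(2) assms(4), of s1] s(1) z(1) e(3) by auto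
    then show False
      using far_sep[OF assms(2), of a b x] far_sep[OF assms(3), of a b y] abcd HS_sub[OF HS(1)] HS_sub[OF HS(2)]
      by auto
  qed
  then show ?thesis using s(1) z(1) wz(2) by (auto simp: star_def)
qed

text \<open>Three of the four quadrants contain one of \<open>v\<close>, \<open>step v x\<close> and \<open>step (step v x) y\<close>. Labels that are
  not adjacent do not allow the fourth one to be inhabited.\<close>

lemma nested:
  assumes "v \<in> V" "x \<in> L" "y \<in> L" "x \<noteq> y" "\<not> adj x y"
  shows "far (step v x) y \<subset> far v x"
proof -
  let ?p = "step v x" and ?q = "step (step v x) y"
  have V: "?p \<in> V" "?q \<in> V" using assms step_V by auto
  have h: "v \<notin> far v x" "?p \<in> far v x" "?p \<notin> far ?p y" "?q \<in> far ?p y"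
    using not_in_far step_in_far assms V by auto
  have v: "v \<notin> far ?p y" using crossing_wall(2)[OF V(1) assms(1,2), of y] h assms by blast
  have q: "?q \<in> far v x" using crossing_wall(2)[OF assms(1) V(1) assms(3), of x] h assms by blast
  have "far ?p y \<subseteq> far v x"
  proof (rule ccontr)
    assume "\<not> far ?p y \<subseteq> far v x"
    then have "transverse (far v x) (far ?p y)" unfolding transverse_def using h v q assms(1) by blast
    then show False using transverse_adj assms V by blast
  qed
  then show ?thesis using h by blast
qed

text \<open>Each halfspace that contains the end but not the start of a path is entered by some edge of it.\<close>

lemma finite_sep:
  assumes "u \<in> V" "w \<in> lists L"
  shows "finite {h \<in> HS. u \<notin> h \<and> path u w \<in> h}" "card {h \<in> HS. u \<notin> h \<and> path u w \<in> h} \<le> length w"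
proof -
  let ?f = "\<lambda>i. far (path u (take i w)) (w ! i)"
  have "{h \<in> HS. u \<notin> h \<and> path u w \<in> h} \<subseteq> ?f ` {..<length w}"
  proof
    fix h assume h: "h \<in> {h \<in> HS. u \<notin> h \<and> path u w \<in> h}"
    then obtain w1 y w2 where w: "w = w1 @ y # w2" "path u w1 \<notin> h" "step (path u w1) y \<in> h"
      using enter[of u h w] by blast
    have "h = far (path u w1) y"
      using far_eqI[of h "path u w1" y] w h assms path_V by simp
    then have "h = ?f (length w1)" using w(1) by simp
    then show "h \<in> ?f ` {..<length w}" using w(1) by (intro image_eqI[of _ _ "length w1"]) auto
  qed
  then show "finite {h \<in> HS. u \<notin> h \<and> path u w \<in> h}"
    by (rule finite_subset) simp
  show "card {h \<in> HS. u \<notin> h \<and> path u w \<in> h} \<le> length w"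
    using surj_card_le[OF _ \<open>{h \<in> HS. u \<notin> h \<and> path u w \<in> h} \<subseteq> ?f ` {..<length w}\<close>] by simp
qed

end

section \<open>Ultrafilters of vertex sets\<close>

text \<open>Ultrafilters on the vertex sets of halfspaces. The complement of \<open>h\<close> is the opposite halfspace.\<close>

definition ultra :: "'v set \<Rightarrow> 'v set set \<Rightarrow> 'v set set \<Rightarrow> bool" where
  "ultra V HS \<omega> \<longleftrightarrow> \<omega> \<subseteq> HS \<and> (\<forall>h\<in>HS. (h \<in> \<omega>) \<noteq> (V - h \<in> \<omega>)) \<and> (\<forall>h\<in>\<omega>. \<forall>k\<in>HS. h \<subseteq> k \<longrightarrow> k \<in> \<omega>)"

text \<open>The descending chain condition fails.\<close>

definition unbounded :: "'v set set \<Rightarrow> bool" where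
  "unbounded \<omega> \<longleftrightarrow> (\<exists>h :: nat \<Rightarrow> 'v set. \<forall>n. h n \<in> \<omega> \<and> h (Suc n) \<subset> h n)"

text \<open>The condition that defines non-terminating ultrafilters, for families of vertex sets.\<close>

definition bottomless :: "'v set set \<Rightarrow> bool" where
  "bottomless \<omega> \<longleftrightarrow> (\<forall>h\<in>\<omega>. \<exists>k\<in>\<omega>. k \<subset> h)"

text \<open>The combinatorial form of \<open>B(X) = \<partial>X\<close>, with the closure described by the basic neighbourhoods
  given by finite subsets.\<close>

definition bottomless_dense :: "'v set \<Rightarrow> 'v set set \<Rightarrow> bool" where
  "bottomless_dense V HS \<longleftrightarrow> (\<forall>\<omega>. ultra V HS \<omega> \<longrightarrow> (unbounded \<omega> \<longleftrightarrow>
    (\<forall>H. finite H \<and> H \<subseteq> \<omega> \<longrightarrow> (\<exists>\<beta>. ultra V HS \<beta> \<and> unbounded \<beta> \<and> bottomless \<beta> \<and> H \<subseteq> \<beta>))))"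

definition joined :: "'l set \<Rightarrow> ('l \<Rightarrow> 'l \<Rightarrow> bool) \<Rightarrow> bool" where
  "joined L adj \<longleftrightarrow> (\<exists>A B. A \<noteq> {} \<and> B \<noteq> {} \<and> A \<inter> B = {} \<and> A \<union> B = L \<and> (\<forall>a\<in>A. \<forall>b\<in>B. adj a b))"

context right_angled
begin

lemma ultra_compl: "ultra V HS \<omega> \<Longrightarrow> h \<in> \<omega> \<Longrightarrow> V - h \<notin> \<omega>"
  unfolding ultra_def by blast

lemma ultra_HS: "ultra V HS \<omega> \<Longrightarrow> h \<in> \<omega> \<Longrightarrow> h \<in> HS"
  unfolding ultra_def by blast

lemma ultra_up: "ultra V HS \<omega> \<Longrightarrow> h \<in> \<omega> \<Longrightarrow> k \<in> HS \<Longrightarrow> h \<subseteq> k \<Longrightarrow> k \<in> \<omega>"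
  unfolding ultra_def by blast

lemma ultra_cases: "ultra V HS \<omega> \<Longrightarrow> h \<in> HS \<Longrightarrow> h \<in> \<omega> \<or> V - h \<in> \<omega>"
  unfolding ultra_def by blast

lemma ultra_meet: "ultra V HS \<omega> \<Longrightarrow> h \<in> \<omega> \<Longrightarrow> k \<in> \<omega> \<Longrightarrow> h \<inter> k \<noteq> {}"
proof
  assume u: "ultra V HS \<omega>" "h \<in> \<omega>" "k \<in> \<omega>" "h \<inter> k = {}"
  then have "h \<subseteq> V - k" "V - k \<in> HS" using ultra_HS HS_sub HS_compl by blast+
  then show False using u ultra_compl[OF u(1,3)] ultra_up[OF u(1,2)] by blast
qed

lemma HS_nonempty: "h \<in> HS \<Longrightarrow> h \<noteq> {}" "h \<in> HS \<Longrightarrow> V - h \<noteq> {}"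
  unfolding HS_def using step_in_far not_in_far by blast+

lemma leave:
  assumes "h \<in> HS" "u \<in> V" "x \<in> L" "u \<in> h" "step u x \<notin> h"
  shows "V - h = far u x"
  using far_eqI[OF HS_compl[OF assms(1)] assms(2,3)] assms step_V by auto

text \<open>Among the members of \<open>\<omega>\<close> that contain \<open>k0\<close> and avoid \<open>u\<close>, take one that is nearest to \<open>u\<close>, and a
  shortest path into it. If this path had more than one edge, its last two labels could not commute, since
  otherwise the last edge could be taken earlier; so its last two walls are nested, and the larger
  halfspace would be a nearer choice.\<close>

lemma toward:
  assumes uf: "ultra V HS \<omega>" and k0: "k0 \<in> \<omega>" and u: "u \<in> V" "u \<notin> k0"
  obtains x where "x \<in> L" "far u x \<in> \<omega>" "k0 \<subseteq> far u x"
proof -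
  define P where "P w \<longleftrightarrow> w \<in> lists L \<and> (\<exists>k\<in>\<omega>. k0 \<subseteq> k \<and> u \<notin> k \<and> path u w \<in> k)" for w
  obtain p where "p \<in> k0" "p \<in> V" using HS_nonempty(1) HS_sub ultra_HS[OF uf k0] by blast
  then obtain w0 where "w0 \<in> lists L" "path u w0 \<in> k0" using connect[OF u(1), of p] by auto
  then have "P w0" unfolding P_def using k0 u(2) by blast
  then obtain w where "P w" and least': "\<And>w'. P w' \<Longrightarrow> length w \<le> length w'"
    using ex_has_least_nat[of P w0 length] by blast
  then obtain k where k: "k \<in> \<omega>" "k0 \<subseteq> k" "u \<notin> k" "path u w \<in> k" and wL: "w \<in> lists L"
    unfolding P_def by blast
  have least: "length w \<le> length w'" if "w' \<in> lists L" "k \<in> \<omega>" "k0 \<subseteq> k" "u \<notin> k" "path u w' \<in> k" for w' k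
    using least'[of w'] that unfolding P_def by blast
  have kHS: "k \<in> HS" using ultra_HS[OF uf k(1)] .
  have "w \<noteq> []" using k by auto
  then obtain w' y where wy: "w = w' @ [y]" by (metis append_butlast_last_id)
  let ?p = "path u w'"
  have L: "w' \<in> lists L" "y \<in> L" and pV: "?p \<in> V" using wL wy path_V u by auto
  have pk: "?p \<notin> k" using least[of w' k] k L wy by auto
  have ky: "k = far ?p y" using far_eqI[OF kHS pV L(2) pk] k(4) wy by simp
  show thesis
  proof (cases w' rule: rev_cases)
    case Nil
    then show thesis using that[of y] ky k L by simp
  next
    case (snoc w'' x)
    let ?q = "path u w''"
    have L': "w'' \<in> lists L" "x \<in> L" and qV: "?q \<in> V" using L snoc path_V u by auto
    have p: "?p = step ?q x" using snoc by simp
    have qk: "?q \<notin> k" using least[of w'' k] k L' wy snoc by auto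
    have "x \<noteq> y" using k(4) wy p qk step_step[OF qV L'(2)] by auto
    moreover have "\<not> adj x y"
    proof
      assume a: "adj x y"
      have "wall ?q y = wall ?p y" using wall_step_adj[OF qV] a adj_sym p by metis
      then have "far ?q y = k" using far_same_wall[OF pV L(2) qV] qk ky by blast
      then have "path u (w'' @ [y]) \<in> k" using step_in_far[OF qV L(2)] by simp
      then show False using least[of "w'' @ [y]" k] k L L' wy snoc by auto
    qed
    ultimately have "k \<subset> far ?q x" using nested[OF qV L'(2) L(2)] ky p by simp
    then have "far ?q x \<in> \<omega>" "k0 \<subseteq> far ?q x"
      using ultra_up[OF uf k(1) far_in_HS[OF qV L'(2)]] k(2) by blast+
    moreover have "u \<notin> far ?q x"
    proof
      assume "u \<in> far ?q x"
      then have "sep (wall ?q x) u ?q" using far_sep[OF qV u(1) qV] not_in_far[OF qV] by blast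
      then have "odd (count_list (walls u w'') (wall ?q x))" using sep_path[OF u(1) L'(1)] by simp
      then have "wall ?q x \<in> set (walls u w'')" using count_notin by fastforce
      then have "\<not> distinct (walls u w)" using wy snoc by (auto simp: walls_append)
      then obtain s where "s \<in> lists L" "path u s = path u w" "length s < length w"
        using shorten[OF u(1) wL] by blast
      then show False using least[of s k] k by auto
    qed
    moreover have "path u w' \<in> far ?q x" using p step_in_far[OF qV L'(2)] by simp
    ultimately show thesis using least[of w' "far ?q x"] L wy by auto
  qed
qed

text \<open>Walk from \<open>u\<close> towards \<open>k\<close>, each time crossing a wall into a member of \<open>\<omega>\<close> that contains \<open>k\<close>. Such a
  step never leaves a halfspace of \<open>\<omega>\<close>, and it reduces the number of walls that separate the
  current vertex from a chosen vertex of \<open>k\<close>.\<close>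

lemma approach:
  assumes uf: "ultra V HS \<omega>" and H: "H \<subseteq> \<omega>" and k: "k \<in> \<omega>"
    and "u \<in> V" "u \<notin> k" "\<forall>h\<in>H. u \<in> h"
  shows "\<exists>v\<in>V. \<exists>x\<in>L. v \<notin> k \<and> step v x \<in> k \<and> (\<forall>h\<in>H. step v x \<in> h)"
proof -
  obtain p where p: "p \<in> k" "p \<in> V" using HS_nonempty(1) HS_sub ultra_HS[OF uf k] by blast
  have fin: "finite {h \<in> HS. u \<notin> h \<and> p \<in> h}" if "u \<in> V" for u
    using connect[OF that p(2)] finite_sep(1)[OF that] by metis
  show ?thesis using assms(4-6)
  proof (induction "card {h \<in> HS. u \<notin> h \<and> p \<in> h}" arbitrary: u rule: less_induct)
    case less
    obtain x where x: "x \<in> L" "far u x \<in> \<omega>" "k \<subseteq> far u x" using toward[OF uf k less(2,3)] .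
    let ?u = "step u x"
    have uV: "?u \<in> V" using step_V less x by blast
    have stay: "?u \<in> h" if "h \<in> \<omega>" "u \<in> h" for h
      using leave[OF ultra_HS[OF uf that(1)] less(2) x(1) that(2)] ultra_compl[OF uf that(1)] x(2) by metis
    show ?case
    proof (cases "?u \<in> k")
      case True
      then show ?thesis using less x stay H by blast
    next
      case False
      have "{h \<in> HS. ?u \<notin> h \<and> p \<in> h} \<subset> {h \<in> HS. u \<notin> h \<and> p \<in> h}"
      proof (rule psubsetI)
        show "{h \<in> HS. ?u \<notin> h \<and> p \<in> h} \<subseteq> {h \<in> HS. u \<notin> h \<and> p \<in> h}"
          using leave[OF _ less(2) x(1)] x(3) p by blast
        have "far u x \<in> {h \<in> HS. u \<notin> h \<and> p \<in> h}"
          using far_in_HS not_in_far less(2) x p by blast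
        then show "{h \<in> HS. ?u \<notin> h \<and> p \<in> h} \<noteq> {h \<in> HS. u \<notin> h \<and> p \<in> h}"
          using step_in_far[OF less(2) x(1)] by blast
      qed
      then have "card {h \<in> HS. ?u \<notin> h \<and> p \<in> h} < card {h \<in> HS. u \<notin> h \<and> p \<in> h}"
        using fin[OF less(2)] psubset_card_mono by blast
      moreover have "\<forall>h\<in>H. ?u \<in> h" using stay H less(4) by blast
      ultimately show ?thesis using less(1)[OF _ uV False] by blast
    qed
  qed
qed

text \<open>Enter the members of \<open>H\<close> one after the other; the walk of \<open>approach\<close> does not leave those already entered.\<close>

lemma helly:
  assumes uf: "ultra V HS \<omega>" and "finite H" "H \<subseteq> \<omega>"
  shows "\<exists>v\<in>V. \<forall>h\<in>H. v \<in> h"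
  using assms(2,3)
proof (induction H rule: finite_induct)
  case empty
  then show ?case using base by auto
next
  case (insert k H)
  then obtain v where v: "v \<in> V" "\<forall>h\<in>H. v \<in> h" by auto
  show ?case
  proof (cases "v \<in> k")
    case False
    then obtain u x where "u \<in> V" "x \<in> L" "step u x \<in> k" "\<forall>h\<in>H. step u x \<in> h"
      using approach[OF uf _ _ v(1) False v(2)] insert.prems by auto
    then show ?thesis using step_V by (intro bexI[of _ "step u x"]) auto
  qed (use v in auto)
qed

text \<open>Only finitely many walls separate two vertices.\<close>

lemma chain_escape:
  assumes h: "\<And>n. h n \<in> HS" "\<And>n. h (Suc n) \<subset> h n" and p: "p \<in> V"
  shows "\<forall>\<^sub>F n in sequentially. p \<notin> h n"
proof -
  have mono: "h n \<subseteq> h m" if "m \<le> n" for m n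
    by (rule lift_Suc_antimono_le[OF _ that]) (use h(2) in blast)
  have smono: "m < n \<Longrightarrow> h n \<subset> h m" for m n
    using h(2) mono[of "Suc m" n] by fastforce
  have "\<exists>n. p \<notin> h n"
  proof (rule ccontr)
    assume n: "\<not> ?thesis"
    obtain u where u: "u \<in> V" "u \<notin> h 0" using HS_nonempty(2)[OF h(1)[of 0]] by blast
    obtain w where "w \<in> lists L" "p = path u w" using connect u p by blast
    then have "finite {h \<in> HS. u \<notin> h \<and> p \<in> h}" using finite_sep(1) u by blast
    moreover have "range h \<subseteq> {h \<in> HS. u \<notin> h \<and> p \<in> h}" using h(1) n u mono[of 0] by blast
    moreover have "inj h" by (rule injI) (metis smono less_irrefl nat_neq_iff psubset_eq)
    ultimately show False using finite_imageD finite_subset infinite_UNIV_nat by metis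
  qed
  then show ?thesis using mono unfolding eventually_sequentially by blast
qed

section \<open>Rays\<close>

text \<open>Adjacency in the complement of the graph of labels.\<close>

definition apart :: "'l \<Rightarrow> 'l \<Rightarrow> bool" where
  "apart x y \<longleftrightarrow> x \<in> L \<and> y \<in> L \<and> x \<noteq> y \<and> \<not> adj x y"

primrec ray :: "'v \<Rightarrow> (nat \<Rightarrow> 'l) \<Rightarrow> nat \<Rightarrow> 'v" where
  "ray v z 0 = v"
| "ray v z (Suc n) = step (ray v z n) (z n)"

text \<open>The halfspace that the ray enters with its \<open>n\<close>-th step.\<close>

definition gate :: "'v \<Rightarrow> (nat \<Rightarrow> 'l) \<Rightarrow> nat \<Rightarrow> 'v set" where
  "gate v z n = far (ray v z n) (z n)"

definition limit :: "'v \<Rightarrow> (nat \<Rightarrow> 'l) \<Rightarrow> 'v set set" where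
  "limit v z = {k \<in> HS. \<forall>\<^sub>F n in sequentially. ray v z n \<in> k}"

lemma ray_V: "v \<in> V \<Longrightarrow> (\<And>n. z n \<in> L) \<Longrightarrow> ray v z n \<in> V"
  by (induction n) (auto simp: step_V)

context
  fixes v z assumes v: "v \<in> V" and z: "\<And>n. apart (z n) (z (Suc n))"
begin

lemma z_L: "z n \<in> L"
  using z apart_def by blast

lemma ray_in_V: "ray v z n \<in> V"
  using ray_V v z_L by blast

lemma gate_HS: "gate v z n \<in> HS"
  using far_in_HS ray_in_V z_L by (simp add: gate_def)

lemma gate_Suc: "gate v z (Suc n) \<subset> gate v z n"
  using nested[OF ray_in_V z_L z_L, of n "Suc n" n] z[of n] unfolding gate_def apart_def by simp

lemma gate_antimono: "m \<le> n \<Longrightarrow> gate v z n \<subseteq> gate v z m"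
  by (rule lift_Suc_antimono_le[of "gate v z"]) (use gate_Suc in blast)

lemma ray_gate: "ray v z n \<in> gate v z m \<longleftrightarrow> m < n"
proof
  have out: "ray v z n \<notin> gate v z n" for n using not_in_far ray_in_V by (simp add: gate_def)
  have inn: "ray v z (Suc n) \<in> gate v z n" for n using step_in_far ray_in_V z_L by (simp add: gate_def)
  show "ray v z n \<in> gate v z m" if "m < n"
    using inn[of "n - 1"] gate_antimono[of m "n - 1"] that
    by (metis Suc_pred' Suc_leI Suc_le_mono gr_implies_not0 in_mono not_gr_zero)
  show "m < n" if "ray v z n \<in> gate v z m"
    using out[of n] gate_antimono[of n m] that by (meson leI subsetD)
qed

lemma ray_crosses:
  assumes "k \<in> HS" "(ray v z n \<in> k) \<noteq> (ray v z (Suc n) \<in> k)"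
  shows "k = gate v z n \<or> k = V - gate v z n"
proof (cases "ray v z n \<in> k")
  case True
  then have "V - k = gate v z n" using leave[OF assms(1) ray_in_V z_L] assms(2) by (simp add: gate_def)
  then show ?thesis using HS_sub[OF assms(1)] by auto
next
  case False
  then show ?thesis using far_eqI[OF assms(1) ray_in_V z_L] assms(2) by (simp add: gate_def)
qed

text \<open>Gates are strictly nested, so a ray crosses each wall at most once.\<close>

lemma ray_converges:
  assumes "k \<in> HS"
  shows "(\<forall>\<^sub>F n in sequentially. ray v z n \<in> k) \<or> (\<forall>\<^sub>F n in sequentially. ray v z n \<notin> k)"
proof (cases "\<exists>n. (ray v z n \<in> k) \<noteq> (ray v z (Suc n) \<in> k)")
  case True
  then obtain n where "k = gate v z n \<or> k = V - gate v z n" using ray_crosses assms by blast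
  then have "(\<forall>m\<ge>Suc n. ray v z m \<in> k) \<or> (\<forall>m\<ge>Suc n. ray v z m \<notin> k)"
    using ray_gate ray_in_V by auto
  then show ?thesis unfolding eventually_sequentially by blast
next
  case False
  then have "ray v z n \<in> k \<longleftrightarrow> ray v z 0 \<in> k" for n by (induction n) auto
  then show ?thesis by (cases "ray v z 0 \<in> k") auto
qed

lemma gate_limit: "gate v z n \<in> limit v z"
  using gate_HS ray_gate unfolding limit_def eventually_sequentially by (auto intro: exI[of _ "Suc n"])

lemma ultra_limit: "ultra V HS (limit v z)"
  unfolding ultra_def
proof (intro conjI ballI impI)
  show "limit v z \<subseteq> HS" by (auto simp: limit_def)
  fix h assume h: "h \<in> HS"
  have "(\<forall>\<^sub>F n in sequentially. ray v z n \<in> V - h) = (\<forall>\<^sub>F n in sequentially. ray v z n \<notin> h)"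
    using ray_in_V by simp
  moreover have "\<not> ((\<forall>\<^sub>F n in sequentially. ray v z n \<in> h) \<and> (\<forall>\<^sub>F n in sequentially. ray v z n \<notin> h))"
    using eventually_conj[of "\<lambda>n. ray v z n \<in> h" sequentially "\<lambda>n. ray v z n \<notin> h"] by auto
  ultimately show "(h \<in> limit v z) \<noteq> (V - h \<in> limit v z)"
    using ray_converges[OF h] h HS_compl[OF h] unfolding limit_def by blast
next
  fix h k assume "h \<in> limit v z" "k \<in> HS" "h \<subseteq> k"
  then have "\<forall>\<^sub>F n in sequentially. ray v z n \<in> h" "\<forall>n. ray v z n \<in> h \<longrightarrow> ray v z n \<in> k"
    by (auto simp: limit_def)
  then have "\<forall>\<^sub>F n in sequentially. ray v z n \<in> k" by (simp add: eventually_mono)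
  then show "k \<in> limit v z" using \<open>k \<in> HS\<close> by (simp add: limit_def)
qed

lemma unbounded_limit: "unbounded (limit v z)"
  unfolding unbounded_def by (rule exI[of _ "gate v z"]) (simp add: gate_limit gate_Suc)

text \<open>A halfspace \<open>k\<close> of the limit with label \<open>x\<close> cannot cross the gates whose label is \<open>x\<close>. Late gates leave
  out a given vertex outside \<open>k\<close>, while the ray is already inside \<open>k\<close>; the only possibility left for a
  late gate with label \<open>x\<close> is to be contained in \<open>k\<close>.\<close>

lemma bottomless_limit:
  assumes often: "\<And>x n. x \<in> L \<Longrightarrow> \<exists>m\<ge>n. z m = x"
  shows "bottomless (limit v z)"
  unfolding bottomless_def
proof
  fix k assume k: "k \<in> limit v z"
  then obtain p x where px: "k = far p x" "p \<in> V" "x \<in> L" and ev: "\<forall>\<^sub>F n in sequentially. ray v z n \<in> k"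
    by (auto simp: limit_def HS_def)
  have "\<forall>\<^sub>F n in sequentially. p \<notin> gate v z n"
    using chain_escape[of "gate v z"] gate_HS gate_Suc px by blast
  with ev have "\<forall>\<^sub>F n in sequentially. ray v z n \<in> k \<and> p \<notin> gate v z n" by (rule eventually_conj)
  then obtain N where N: "\<And>n. n \<ge> N \<Longrightarrow> ray v z n \<in> k \<and> p \<notin> gate v z n"
    unfolding eventually_sequentially by blast
  obtain m where m: "m \<ge> N" "z m = x" using often px by blast
  have "gate v z m \<subseteq> k"
  proof (rule ccontr)
    assume "\<not> gate v z m \<subseteq> k"
    moreover have "ray v z (Suc m) \<in> k \<inter> gate v z m" "ray v z m \<in> k - gate v z m" 
      using N[of m] N[of "Suc m"] m(1) ray_gate[of "Suc m" m] ray_gate[of m m] by (auto simp del: ray.simps)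
    moreover have "p \<in> V - k - gate v z m" using N[of m] m px not_in_far by auto
    ultimately have "transverse k (gate v z m)" unfolding transverse_def by blast
    then have "adj x x" using transverse_adj[of p x "ray v z m" x] px m ray_in_V by (simp add: gate_def)
    then show False using adj_irrefl by blast
  qed
  then show "\<exists>k'\<in>limit v z. k' \<subset> k" using gate_limit gate_Suc[of m] by blast
qed

end

section \<open>Joins\<close>

lemma sort_path:
  assumes "A \<union> B = L" "\<forall>a\<in>A. \<forall>b\<in>B. adj a b" "w \<in> lists L" "v \<in> V"
  shows "path v w = path v (filter (\<lambda>x. x \<notin> A) w @ filter (\<lambda>x. x \<in> A) w)"
  using assms(3,4)
proof (induction w arbitrary: v rule: list.induct)
  case (Cons x w)
  have "step v x \<in> V" using Cons step_V by auto
  then have IH: "path (step v x) w = path (step v x) (filter (\<lambda>x. x \<notin> A) w @ filter (\<lambda>x. x \<in> A) w)"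
    using Cons by simp
  show ?case
  proof (cases "x \<in> A")
    case True
    then have "filter (\<lambda>x. x \<notin> A) w \<in> lists {y. adj x y}" using Cons assms(1,2) by auto
    then have "path (step v x) (filter (\<lambda>x. x \<notin> A) w) = step (path v (filter (\<lambda>x. x \<notin> A) w)) x"
      using path_snoc_commute[OF Cons.prems(2), of x] Cons.prems(1) by simp
    then show ?thesis using IH Cons.prems True by simp
  qed (use IH Cons.prems in simp)
qed simp

text \<open>Sorting a path from \<open>p\<close> to \<open>q\<close> into labels from \<open>B\<close> and then labels from \<open>A\<close> gives a vertex in the middle
  at which both walls have an edge, since labels in \<open>B\<close> do not change \<open>A\<close>-walls and vice versa.
  The square at this vertex meets all four quadrants.\<close>

lemma join_transverse:
  assumes L: "A \<union> B = L" and adj: "\<forall>a\<in>A. \<forall>b\<in>B. adj a b" and "a \<in> A" "b \<in> B" "p \<in> V" "q \<in> V"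
  shows "transverse (far p a) (far q b)"
proof -
  obtain w where w: "w \<in> lists L" "q = path p w" using connect assms by blast
  let ?B = "filter (\<lambda>x. x \<notin> A) w" and ?A = "filter (\<lambda>x. x \<in> A) w"
  define r where "r = path p ?B"
  have q: "q = path r ?A" using sort_path[OF L adj w(1) assms(5)] w(2) by (simp add: r_def)
  have ab: "a \<in> L" "b \<in> L" "adj a b" "a \<noteq> b" using assms adj_irrefl by blast+
  have "?B \<in> lists L" using w(1) by auto
  then have rV: "r \<in> V" using path_V assms(5) unfolding r_def by blast
  have "?B \<in> lists (star a)" "?A \<in> lists (star b)" 
    using w(1) L adj assms(3,4) adj_sym by (auto simp: star_def)
  then have wa: "wall p a = wall r a" and wb: "wall q b = wall r b"
    using wall_path[OF assms(5) ab(1)] wall_path[OF rV ab(2)] q by (auto simp: r_def)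
  have flip: "(s \<in> far t x) \<noteq> (step s y \<in> far t x) \<longleftrightarrow> wall t x = wall s y" 
    if "s \<in> V" "t \<in> V" "y \<in> L" for s t x y
    using far_sep[OF that(2,1) step_V[OF that(1,3)], of x] sep_step[OF that(1,3)] by blast
  let ?ra = "step r a" and ?rb = "step r b" and ?rab = "step (step r a) b"
  have V: "?ra \<in> V" "?rb \<in> V" "?rab \<in> V" using rV ab step_V by auto
  have wab: "wall ?ra b = wall r b" using wall_step_adj[OF rV] ab adj_sym by blast
  have ne: "wall p a \<noteq> wall s b" "wall q b \<noteq> wall s a" for s using wall_label ab by blast+
  have "(r \<in> far p a) \<noteq> (?ra \<in> far p a)" "(r \<in> far p a) = (?rb \<in> far p a)" "(?ra \<in> far p a) = (?rab \<in> far p a)"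
    using flip[OF rV assms(5) ab(1)] flip[OF rV assms(5) ab(2)] flip[OF V(1) assms(5) ab(2)] wa ne(1) by metis+
  moreover have "(r \<in> far q b) = (?ra \<in> far q b)" "(r \<in> far q b) \<noteq> (?rb \<in> far q b)" "(?ra \<in> far q b) \<noteq> (?rab \<in> far q b)"
    using flip[OF rV assms(6) ab(1)] flip[OF rV assms(6) ab(2)] flip[OF V(1) assms(6) ab(2)] wb wab ne(2) by metis+
  ultimately show ?thesis unfolding transverse_def using V rV by blast
qed

text \<open>The members of \<open>\<beta>\<close> with labels in \<open>B\<close> all contain \<open>v\<close>: otherwise \<open>toward\<close> gives a member that
  \<open>v\<close> sees across an edge, whose label is excluded from \<open>B\<close> by assumption and from \<open>A\<close> by
  \<open>join_transverse\<close>. A member strictly inside \<open>V - far v b\<close> again has its label in \<open>B\<close>, so it contains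
  \<open>v\<close> but not \<open>step v b\<close>, and these two vertices are separated by only one wall. The case \<open>A = {}\<close> says that
  vertices are isolated from the bottomless ultrafilters.\<close>

lemma no_bottomless_near:
  assumes L: "A \<union> B = L" and adj: "\<forall>a\<in>A. \<forall>b\<in>B. adj a b" and "B \<noteq> {}" and v: "v \<in> V"
    and uf: "ultra V HS \<beta>" and bl: "bottomless \<beta>" and near: "\<forall>b\<in>B. V - far v b \<in> \<beta>"
  shows False
proof -
  have inside: "v \<in> k" if k: "k \<in> \<beta>" "k = far p b" "p \<in> V" "b \<in> B" for k p b
  proof (rule ccontr)
    assume "v \<notin> k"
    then obtain x where x: "x \<in> L" "far v x \<in> \<beta>" "k \<subseteq> far v x" using toward[OF uf k(1) v] by blast
    then have "x \<in> A" using near L ultra_compl[OF uf] by blast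
    then have "transverse (far v x) k" using join_transverse[OF L adj] k v by blast
    then show False using x unfolding transverse_def by blast
  qed
  obtain b where b: "b \<in> B" "b \<in> L" using assms by blast
  have "V - far v b \<in> \<beta>" using near b by simp
  then obtain k where k: "k \<in> \<beta>" "k \<subset> V - far v b" using bspec[OF bl[unfolded bottomless_def]] by metis
  then obtain p y where p: "k = far p y" "p \<in> V" "y \<in> L" using ultra_HS[OF uf k(1)] unfolding HS_def by blast
  have "y \<notin> A"
  proof
    assume "y \<in> A"
    then have "transverse k (far v b)" using join_transverse[OF L adj] b v p by blast
    then show False using k(2) unfolding transverse_def by blast
  qed
  then have "v \<in> k" using inside k p L by blast
  moreover have "step v b \<notin> k" using k(2) step_in_far[OF v b(2)] by blast
  ultimately have "V - k = far v b" using leave[OF _ v b(2)] ultra_HS[OF uf k(1)] by blast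
  then show False using k(2) HS_sub[OF ultra_HS[OF uf k(1)]] by blast
qed

section \<open>Bounded ultrafilters are vertices\<close>

text \<open>Keep walking towards \<open>\<omega>\<close>. If this never ends, some label is used infinitely often; walls with
  equal labels do not cross, and so the halfspaces entered through them form a descending chain.\<close>

lemma vertex_or_unbounded:
  assumes uf: "ultra V HS \<omega>" and nv: "\<forall>v\<in>V. \<exists>h\<in>\<omega>. v \<notin> h"
  shows "unbounded \<omega>"
proof -
  have "\<exists>x. x \<in> L \<and> far u x \<in> \<omega>" if "u \<in> V" for u
    using nv that toward[OF uf] by metis
  then obtain f where f: "\<And>u. u \<in> V \<Longrightarrow> f u \<in> L \<and> far u (f u) \<in> \<omega>" by metis
  define u where "u = rec_nat base (\<lambda>_ p. step p (f p))"
  have u_Suc: "u (Suc n) = step (u n) (f (u n))" for n by (simp add: u_def)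
  have uV: "u n \<in> V" for n
  proof (induction n)
    case (Suc n) then show ?case using f step_V u_Suc by simp
  qed (simp add: u_def base)
  define k where "k n = far (u n) (f (u n))" for n
  have k: "k n \<in> \<omega>" "k n \<in> HS" for n using f[OF uV] ultra_HS[OF uf] by (auto simp: k_def)
  have stay: "u (Suc n) \<in> h" if "h \<in> \<omega>" "u n \<in> h" for h n
  proof (rule ccontr)
    assume "u (Suc n) \<notin> h"
    then have "V - h = k n" using leave[OF _ uV _ that(2)] ultra_HS[OF uf that(1)] f[OF uV] u_Suc
      by (simp add: k_def)
    then show False using ultra_compl[OF uf that(1)] k by simp
  qed
  have stay': "u (n + i) \<in> h" if "h \<in> \<omega>" "u n \<in> h" for h n i
    by (induction i) (use stay that in auto)
  have mem: "u m \<in> k n \<longleftrightarrow> n < m" for m n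
  proof
    show "u m \<in> k n" if "n < m"
      using stay'[of "k n" "Suc n" "m - Suc n"] k step_in_far[OF uV] f[OF uV] u_Suc that by (simp add: k_def)
    show "n < m" if "u m \<in> k n"
      using stay'[of "k n" m "n - m"] k that not_in_far[OF uV, of n "f (u n)"] 
      by (metis k_def le_add_diff_inverse linorder_not_le)
  qed
  have "finite ((\<lambda>n. f (u n)) ` UNIV)" by (rule finite_subset[OF _ finite_L]) (use f[OF uV] in auto)
  then obtain n0 where "infinite {n \<in> UNIV. f (u n) = f (u n0)}"
    using pigeonhole_infinite[of UNIV "\<lambda>n. f (u n)"] by auto
  then have inf: "infinite {n. f (u n) = f (u n0)}" (is "infinite ?S") by simp
  have sub: "k j \<subset> k i" if ij: "i \<in> ?S" "j \<in> ?S" "i < j" for i j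
  proof -
    have "\<not> transverse (k i) (k j)"
      using transverse_adj[of "u i" _ "u j"] uV f ij adj_irrefl unfolding k_def by (metis mem_Collect_eq)
    moreover have "u (Suc j) \<in> k i \<inter> k j" "u (Suc i) \<in> k i - k j" "u i \<in> V - k i - k j"
      using mem ij uV by auto
    ultimately show ?thesis unfolding transverse_def by blast
  qed
  have "k (enumerate ?S (Suc n)) \<subset> k (enumerate ?S n)" for n
    using sub enumerate_in_set[OF inf] enumerate_step[OF inf] by blast
  then show ?thesis unfolding unbounded_def using k by (intro exI[of _ "\<lambda>n. k (enumerate ?S n)"]) blast
qed

lemma dense_imp_unbounded:
  assumes "L \<noteq> {}" "ultra V HS \<omega>"
    and "\<forall>H. finite H \<and> H \<subseteq> \<omega> \<longrightarrow> (\<exists>\<beta>. ultra V HS \<beta> \<and> unbounded \<beta> \<and> bottomless \<beta> \<and> H \<subseteq> \<beta>)"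
  shows "unbounded \<omega>"
proof (rule vertex_or_unbounded[OF assms(2)], rule ccontr)
  assume "\<not> (\<forall>v\<in>V. \<exists>h\<in>\<omega>. v \<notin> h)"
  then obtain v where v: "v \<in> V" "\<forall>h\<in>\<omega>. v \<in> h" by blast
  let ?H = "(\<lambda>x. V - far v x) ` L"
  have "?H \<subseteq> \<omega>"
    using ultra_cases[OF assms(2) far_in_HS] v not_in_far by blast
  then obtain \<beta> where "ultra V HS \<beta>" "bottomless \<beta>" "?H \<subseteq> \<beta>"
    using assms(3) finite_L by (meson finite_imageI)
  then show False using no_bottomless_near[of "{}" L v \<beta>] assms(1) v by blast
qed

text \<open>Two non-adjacent labels lie in the same part \<open>A\<close> of the join. The ray that alternates between them
  crosses no wall with label in \<open>B\<close>, so its limit is unbounded but looks, with respect to \<open>B\<close>, like the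
  base vertex.\<close>

lemma joined_not_dense:
  assumes a: "apart a a'" and "joined L adj"
  shows "\<not> bottomless_dense V HS"
proof
  assume dense: "bottomless_dense V HS"
  obtain A0 B0 where AB0: "A0 \<noteq> {}" "B0 \<noteq> {}" "A0 \<union> B0 = L" "\<forall>a\<in>A0. \<forall>b\<in>B0. adj a b"
    using assms(2) unfolding joined_def by blast
  have aL: "a \<in> L" "a' \<in> L" "\<not> adj a a'" "\<not> adj a' a" using a adj_sym unfolding apart_def by blast+
  obtain A B where AB: "a \<in> A" "a' \<in> A" "B \<noteq> {}" "A \<union> B = L" "\<forall>a\<in>A. \<forall>b\<in>B. adj a b"
  proof (cases "a \<in> A0 \<and> a' \<in> A0")
    case True then show thesis using that AB0 by blast
  next
    case False
    then have "a \<in> B0 \<and> a' \<in> B0" using AB0 aL by blast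
    moreover have "\<forall>a\<in>B0. \<forall>b\<in>A0. adj a b" using AB0 adj_sym by blast
    ultimately show thesis using that[of B0 A0] AB0 by blast
  qed
  define z where "z n = (if even n then a else a')" for n :: nat
  have z: "apart (z n) (z (Suc n))" for n using a adj_sym unfolding z_def apart_def by auto
  let ?\<alpha> = "limit base z" and ?H = "(\<lambda>b. V - far base b) ` B"
  have "ray base z n \<in> V - far base b" if b: "b \<in> B" for b n
  proof (induction n)
    case 0
    then show ?case using base not_in_far by simp
  next
    case (Suc n)
    have "z n \<noteq> b" using AB b adj_irrefl unfolding z_def by auto
    then show ?case using crossing_wall(2)[OF base, of "ray base z n" "z n" b] Suc
        step_V z apart_def by (metis DiffD1 DiffD2 DiffI ray.simps(2))
  qed
  then have "?H \<subseteq> ?\<alpha>"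
    using HS_compl far_in_HS base AB(4) unfolding limit_def by auto
  moreover have "finite ?H" using AB(4) finite_L by (metis finite_Un finite_imageI)
  ultimately obtain \<beta> where "ultra V HS \<beta>" "bottomless \<beta>" "?H \<subseteq> \<beta>"
    using dense ultra_limit[of base z, OF base z] unbounded_limit[of base z, OF base z] unfolding bottomless_dense_def by meson
  then show False using no_bottomless_near[OF AB(4,5,3) base] by blast
qed

section \<open>Closed walks in the complement graph\<close>

primrec apart_walk :: "'l \<Rightarrow> 'l list \<Rightarrow> 'l \<Rightarrow> bool" where
  "apart_walk x [] y \<longleftrightarrow> x = y"
| "apart_walk x (w # ws) y \<longleftrightarrow> apart x w \<and> apart_walk w ws y"

lemma apart_walk_append: "apart_walk x (u @ w) y \<longleftrightarrow> (\<exists>t. apart_walk x u t \<and> apart_walk t w y)"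
  by (induction u arbitrary: x) auto

lemma apart_walk_L: "apart_walk x ws y \<Longrightarrow> set ws \<subseteq> L"
  by (induction ws arbitrary: x) (auto simp: apart_def)

lemma apart_walk_exists:
  assumes "\<not> joined L adj" "x \<in> L" "y \<in> L"
  shows "\<exists>ws. apart_walk x ws y"
proof (rule ccontr)
  assume n: "\<not> ?thesis"
  let ?A = "{y \<in> L. \<exists>ws. apart_walk x ws y}"
  have x: "x \<in> ?A" using assms by (auto intro: exI[of _ "[]"])
  have y: "y \<in> L - ?A" using n assms(3) by blast
  have a: "adj a b" if ab: "a \<in> ?A" "b \<in> L - ?A" for a b
  proof (rule ccontr)
    assume "\<not> adj a b"
    then have "apart a b" using ab unfolding apart_def by blast
    moreover obtain ws where "apart_walk x ws a" using ab by blast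
    ultimately have "apart_walk x (ws @ [b]) b" by (auto simp: apart_walk_append)
    then show False using ab by blast
  qed
  have "joined L adj" unfolding joined_def
  proof (intro exI conjI)
    show "?A \<noteq> {}" "L - ?A \<noteq> {}" using x y by blast+
    show "?A \<inter> (L - ?A) = {}" "?A \<union> (L - ?A) = L" by blast+
    show "\<forall>a\<in>?A. \<forall>b\<in>L - ?A. adj a b" using a by blast
  qed
  then show False using assms(1) by blast
qed

text \<open>From each label in turn there is a walk out to the next one and back to \<open>x\<close>.\<close>

lemma covering_walk:
  assumes "\<not> joined L adj" "x \<in> L" "finite T" "T \<subseteq> L"
  shows "\<exists>ws. apart_walk x ws x \<and> T \<subseteq> set ws \<union> {x}"
  using assms(3,4)
proof (induction T rule: finite_induct)
  case empty
  then show ?case by (auto intro: exI[of _ "[]"])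
next
  case (insert t T)
  then obtain ws us vs where w: "apart_walk x ws x" "T \<subseteq> set ws \<union> {x}" "apart_walk x us t" "apart_walk t vs x"
    using apart_walk_exists[OF assms(1)] assms(2) by (metis insert_subset)
  then have "apart_walk x (ws @ us @ vs) x" by (auto simp: apart_walk_append)
  moreover have "t \<in> set us \<union> {x}"
    using w(3) by (induction us arbitrary: x) (auto)
  ultimately show ?case using w(2) by (intro exI[of _ "ws @ us @ vs"]) auto
qed

lemma closed_covering_walk:
  assumes "\<not> joined L adj" "apart a a'" "x \<in> L"
  obtains ws where "apart_walk x ws x" "set ws = L" "ws \<noteq> []"
proof -
  obtain ws where ws: "apart_walk x ws x" "L \<subseteq> set ws \<union> {x}"
    using covering_walk[OF assms(1,3) finite_L subset_refl] by blast
  have "\<not> L \<subseteq> {x}" using assms(2) unfolding apart_def by blast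
  then have "ws \<noteq> []" using ws(2) by auto
  then have "x \<in> set ws" using ws(1)
    by (metis apart_walk.simps append_butlast_last_id apart_walk_append last_in_set)
  then show thesis using that[OF ws(1)] ws apart_walk_L \<open>ws \<noteq> []\<close> by blast
qed

lemma apart_walk_nth:
  "apart_walk x ws y \<Longrightarrow> i < length ws \<Longrightarrow> apart ((x # ws) ! i) (ws ! i)"
  by (induction ws arbitrary: x i) (auto simp: nth_Cons split: nat.splits)

lemma apart_walk_last: "apart_walk x ws y \<Longrightarrow> (x # ws) ! length ws = y"
  by (induction ws arbitrary: x) auto

text \<open>The periodic sequence that repeats a list.\<close>

definition cycle :: "'l list \<Rightarrow> nat \<Rightarrow> 'l" where
  "cycle ws n = ws ! (n mod length ws)"

lemma cycle_apart:
  assumes "apart_walk x ws x" "ws \<noteq> []"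
  shows "apart x (cycle ws 0)" "apart (cycle ws n) (cycle ws (Suc n))"
proof -
  show 0: "apart x (cycle ws 0)" using apart_walk_nth[OF assms(1), of 0] assms(2) by (simp add: cycle_def)
  let ?m = "n mod length ws"
  have m: "?m < length ws" using assms(2) by simp
  show "apart (cycle ws n) (cycle ws (Suc n))"
  proof (cases "Suc ?m = length ws")
    case True
    then have "Suc n mod length ws = 0" by (metis mod_Suc)
    moreover have "ws ! ?m = x" using apart_walk_last[OF assms(1)] True by (metis nth_Cons_Suc)
    ultimately show ?thesis using 0 by (simp add: cycle_def)
  next
    case False
    then have "Suc n mod length ws = Suc ?m" by (metis mod_Suc)
    then show ?thesis using apart_walk_nth[OF assms(1), of "Suc ?m"] m False by (simp add: cycle_def)
  qed
qed

lemma cycle_often: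
  assumes "x \<in> set ws" shows "\<exists>m\<ge>n. cycle ws m = x"
proof -
  obtain i where i: "i < length ws" "ws ! i = x" using assms by (auto simp: in_set_conv_nth)
  have "cycle ws (i + n * length ws) = x" using i by (simp add: cycle_def)
  moreover have "i + n * length ws \<ge> n" using i by (cases "length ws") auto
  ultimately show ?thesis by blast
qed

section \<open>Density of the limits of rays\<close>

text \<open>Far down the given chain there is a halfspace that every member of \<open>H\<close> contains or crosses. This relation
  to \<open>H\<close> persists along a ray that starts inside all members of \<open>H\<close>: a member that crosses the current gate has a
  label adjacent to the label of this gate, hence different from the next label, so the next step
  stays inside it. Once the ray uses the label of a member, the gate cannot cross it and lies inside it.\<close>

lemma not_joined_dense:
  assumes nj: "\<not> joined L adj" and a: "apart a a'"
    and uf: "ultra V HS \<omega>" and ub: "unbounded \<omega>" and H: "finite H" "H \<subseteq> \<omega>"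
  shows "\<exists>\<beta>. ultra V HS \<beta> \<and> unbounded \<beta> \<and> bottomless \<beta> \<and> H \<subseteq> \<beta>"
proof -
  obtain c where "\<forall>n. c n \<in> \<omega> \<and> c (Suc n) \<subset> c n" using ub unfolding unbounded_def by (elim exE)
  then have c: "\<And>n. c n \<in> \<omega>" "\<And>n. c (Suc n) \<subset> c n" by simp_all
  have cHS: "c n \<in> HS" for n using ultra_HS[OF uf c(1)] .
  note escape = chain_escape[of c, OF cHS c(2)]
  have HHS: "h \<in> HS" if "h \<in> H" for h using ultra_HS[OF uf] H that by blast
  have "\<forall>\<^sub>F n in sequentially. c n \<subseteq> h \<or> transverse h (c n)" if h: "h \<in> H" for h
  proof -
    obtain p p' where p: "p \<in> h" "p' \<in> V - h" "p \<in> V" using HS_nonempty[OF HHS[OF h]] HS_sub[OF HHS[OF h]] by blast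
    have "\<forall>\<^sub>F n in sequentially. p \<notin> c n \<and> p' \<notin> c n" using escape[of p] escape[of p'] p
      by (intro eventually_conj) auto
    then show ?thesis
    proof (rule eventually_mono)
      fix n assume n: "p \<notin> c n \<and> p' \<notin> c n"
      have "h \<inter> c n \<noteq> {}" using ultra_meet[OF uf _ c(1)] h H by blast
      then show "c n \<subseteq> h \<or> transverse h (c n)" unfolding transverse_def using n p by blast
    qed
  qed
  then have ev: "\<forall>\<^sub>F n in sequentially. \<forall>h\<in>H. c n \<subseteq> h \<or> transverse h (c n)"
    by (intro eventually_ball_finite[OF H(1)]) simp
  obtain u where u: "u \<in> V" "\<forall>h\<in>H. u \<in> h" using helly[OF uf H] by blast
  obtain n where "(\<forall>h\<in>H. c n \<subseteq> h \<or> transverse h (c n)) \<and> u \<notin> c n"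
    using eventually_happens'[OF sequentially_bot eventually_conj[OF ev escape[OF u(1)]]] by (elim exE)
  then have n: "\<forall>h\<in>H. c n \<subseteq> h \<or> transverse h (c n)" "u \<notin> c n" by simp_all
  obtain v x where vx: "v \<in> V" "x \<in> L" "v \<notin> c n" "step v x \<in> c n" "\<forall>h\<in>H. step v x \<in> h"
    using approach[OF uf H(2) c(1) u(1) n(2) u(2)] by blast
  have cn: "c n = far v x" using far_eqI[OF cHS] vx by blast
  obtain ws where ws: "apart_walk x ws x" "set ws = L" "ws \<noteq> []"
    using closed_covering_walk[OF nj a vx(2)] .
  \<comment> \<open>The first step enters \<open>c n\<close>; after that the ray repeats the closed walk.\<close>
  define z where "z = case_nat x (cycle ws)"
  have z: "apart (z n) (z (Suc n))" for n
    using cycle_apart[OF ws(1,3)] by (cases n) (auto simp: z_def)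
  have often: "\<exists>m\<ge>n. z m = y" if "y \<in> L" for y n
    using cycle_often[of y ws n] that ws(2) by (metis le_SucI nat.case(2) z_def)
  have inv: "(\<forall>h\<in>H. gate v z i \<subseteq> h \<or> transverse h (gate v z i)) \<and> (\<forall>h\<in>H. ray v z (Suc i) \<in> h)" for i
  proof (induction i)
    case 0
    then show ?case using n vx cn by (simp add: gate_def z_def)
  next
    case (Suc i)
    let ?k = "gate v z i" and ?k' = "gate v z (Suc i)"
    have sub: "?k' \<subset> ?k" using gate_Suc[of v z, OF vx(1) z] .
    have r: "ray v z (Suc (Suc i)) \<in> ?k'" using ray_gate[of v z, OF vx(1) z] by blast
    have "(?k' \<subseteq> h \<or> transverse h ?k') \<and> ray v z (Suc (Suc i)) \<in> h" if h: "h \<in> H" for h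
    proof (cases "?k \<subseteq> h")
      case True
      then show ?thesis using sub r by blast
    next
      case False
      then have t: "transverse h ?k" using Suc h by blast
      obtain q b where q: "h = far q b" "q \<in> V" "b \<in> L" using HHS[OF h] by (auto simp: HS_def)
      have "adj b (z i)"
        using transverse_adj t q ray_in_V[of v z, OF vx(1) z] z unfolding gate_def apart_def by blast
      then have "b \<noteq> z (Suc i)" using z[of i] adj_sym unfolding apart_def by blast
      then have "ray v z (Suc (Suc i)) \<in> h"
        using crossing_wall(2)[OF q(2) ray_in_V[of v z, OF vx(1) z], of "z (Suc i)" "Suc i" b] z Suc h q
        unfolding apart_def by auto
      moreover have "?k' \<subseteq> h \<or> transverse h ?k'"
        using t sub r calculation unfolding transverse_def by blast
      ultimately show ?thesis by blast
    qed
    then show ?case by blast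
  qed
  have "H \<subseteq> limit v z"
  proof
    fix h assume h: "h \<in> H"
    then obtain q b where q: "h = far q b" "q \<in> V" "b \<in> L" using HHS[OF h] by (auto simp: HS_def)
    obtain m where m: "z m = b" using often q by blast
    have "\<not> transverse h (gate v z m)"
      using transverse_adj[of q b "ray v z m" b] q ray_in_V[of v z, OF vx(1) z] m adj_irrefl by (auto simp: gate_def)
    then have "gate v z m \<subseteq> h" using inv h by blast
    then show "h \<in> limit v z"
      using ultra_up[OF ultra_limit[of v z, OF vx(1) z] gate_limit[of v z, OF vx(1) z] HHS[OF h]] by blast
  qed
  then show ?thesis
    using ultra_limit[of v z, OF vx(1) z] unbounded_limit[of v z, OF vx(1) z] bottomless_limit[of v z, OF vx(1) z often] by blast
qed

text \<open>The hypothesis only excludes that all labels commute, in which case there are finitely many vertices.\<close>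

theorem bottomless_dense_iff:
  assumes "apart a a'"
  shows "bottomless_dense V HS \<longleftrightarrow> \<not> joined L adj"
proof
  show "\<not> joined L adj" if "bottomless_dense V HS"
    using that joined_not_dense[OF assms] by blast
  show "bottomless_dense V HS" if "\<not> joined L adj"
    unfolding bottomless_dense_def
  proof (intro allI impI iffI)
    fix \<omega> H assume "ultra V HS \<omega>" "unbounded \<omega>" "finite H \<and> H \<subseteq> \<omega>"
    then show "\<exists>\<beta>. ultra V HS \<beta> \<and> unbounded \<beta> \<and> bottomless \<beta> \<and> H \<subseteq> \<beta>"
      using not_joined_dense[OF that assms] by simp
  next
    fix \<omega> assume "ultra V HS \<omega>"
      and "\<forall>H. finite H \<and> H \<subseteq> \<omega> \<longrightarrow> (\<exists>\<beta>. ultra V HS \<beta> \<and> unbounded \<beta> \<and> bottomless \<beta> \<and> H \<subseteq> \<beta>)"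
    moreover have "L \<noteq> {}" using assms unfolding apart_def by blast
    ultimately show "unbounded \<omega>" by (intro dense_imp_unbounded)
  qed
qed

end

section \<open>Barycentric coordinates of cubes\<close>

text \<open>The multilinear barycentric coordinate, at the vertex \<open>A\<close> of the unit cube, of the point \<open>t\<close>.\<close>

definition weight :: "nat \<Rightarrow> (nat \<Rightarrow> real) \<Rightarrow> nat set \<Rightarrow> real" where
  "weight n t A = (\<Prod>i<n. if i \<in> A then t i else 1 - t i)"

lemma sum_prod_choice:
  fixes f g :: "nat \<Rightarrow> real"
  shows "(\<Sum>A\<in>Pow {..<n}. \<Prod>i<n. if i \<in> A then f i else g i) = (\<Prod>i<n. f i + g i)"
proof -
  have "(\<Prod>i<n. if i \<in> A then f i else g i) = prod f A * prod g ({..<n} - A)" if "A \<in> Pow {..<n}" for A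
  proof -
    have "{..<n} \<inter> {i. i \<in> A} = A" "{..<n} \<inter> - {i. i \<in> A} = {..<n} - A" using that by auto
    then show ?thesis by (simp add: prod.If_cases)
  qed
  then have "(\<Sum>A\<in>Pow {..<n}. \<Prod>i<n. if i \<in> A then f i else g i)
    = (\<Sum>A\<in>Pow {..<n}. prod f A * prod g ({..<n} - A))" by (rule sum.cong[OF HOL.refl])
  then show ?thesis by (simp add: prod_add)
qed

lemma sum_weight: "(\<Sum>A\<in>Pow {..<n}. weight n t A) = 1"
  unfolding weight_def sum_prod_choice by simp

text \<open>The weights with \<open>1 - t j\<close> replaced by \<open>0\<close> add up to the same product as all weights, but with the
  factor \<open>t j\<close> in place of \<open>t j + (1 - t j)\<close>.\<close>

lemma sum_weight_dir:
  assumes "j < n" shows "(\<Sum>A | A \<subseteq> {..<n} \<and> j \<in> A. weight n t A) = t j"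
proof -
  have w: "(\<Prod>i<n. if i \<in> A then t i else if i = j then 0 else 1 - t i) = (if j \<in> A then weight n t A else 0)" for A
  proof (cases "j \<in> A")
    case True
    then show ?thesis unfolding weight_def by (auto intro!: prod.cong)
  next
    case False
    then show ?thesis using assms by (auto intro!: prod_zero bexI[of _ j])
  qed
  have "(\<Sum>A | A \<subseteq> {..<n} \<and> j \<in> A. weight n t A) = (\<Sum>A\<in>Pow {..<n}. if j \<in> A then weight n t A else 0)"
    by (simp add: sum.If_cases Int_def Pow_def)
  also have "\<dots> = (\<Prod>i<n. t i + (if i = j then 0 else 1 - t i))"
    by (simp only: w[symmetric] sum_prod_choice)
  also have "\<dots> = (\<Prod>i<n. if i = j then t j else 1)"
    by (intro prod.cong) auto
  also have "\<dots> = t j" using assms by (simp add: prod.delta)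
  finally show ?thesis .
qed

text \<open>Barycentric weight of the part \<open>h\<close> of the vertices. Points of the realization have finite support, so
  the sum is over a finite set.\<close>

definition coord :: "'v set \<Rightarrow> ('v \<Rightarrow> real) \<Rightarrow> real" where
  "coord h x = (\<Sum>v | v \<in> h \<and> x v \<noteq> 0. x v)"

definition vertex_point :: "'v \<Rightarrow> 'v \<Rightarrow> real" where
  "vertex_point v = (\<lambda>u. if u = v then 1 else 0)"

definition edge_midpoint :: "'v \<Rightarrow> 'v \<Rightarrow> 'v \<Rightarrow> real" where
  "edge_midpoint a b = (\<lambda>u. if u = a \<or> u = b then 1 / 2 else 0)"

text \<open>The vertex \<open>A\<close> of the unit cube in coordinates.\<close>

definition corner :: "nat set \<Rightarrow> nat \<Rightarrow> real" where
  "corner A i = (if i \<in> A then 1 else 0)"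

text \<open>Halfspaces as sets of vertices, with the properties that connect them to cubes: the edges are the
  pairs of vertices on different sides of exactly one wall, halfspaces are connected, and the
  edges across a wall are linked by squares. Larger cubes need no
  further conditions, because the walls that they meet are found along their edges.\<close>

locale cube_halfspaces =
  fixes K :: "'v set set" and HS :: "'v set set"
  assumes finite_cube: "Q \<in> K \<Longrightarrow> finite Q"
    and loc_fin: "v \<in> \<Union>K \<Longrightarrow> finite {Q \<in> K. v \<in> Q}"
    and vertex: "v \<in> \<Union>K \<Longrightarrow> {v} \<in> K"
    and HS_subset: "h \<in> HS \<Longrightarrow> h \<subseteq> \<Union>K"
    and HS_Compl: "h \<in> HS \<Longrightarrow> \<Union>K - h \<in> HS"
    and edge_iff: "a \<in> \<Union>K \<Longrightarrow> b \<in> \<Union>K \<Longrightarrow> {a, b} \<in> edges K \<longleftrightarrow> (\<exists>!h. h \<in> HS \<and> a \<in> h \<and> b \<notin> h)"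
    and separated: "a \<in> \<Union>K \<Longrightarrow> b \<in> \<Union>K \<Longrightarrow> a \<noteq> b \<Longrightarrow> \<exists>h\<in>HS. a \<in> h \<and> b \<notin> h"
    and connected_HS: "h \<in> HS \<Longrightarrow> a \<in> h \<Longrightarrow> b \<in> h \<Longrightarrow>
      (a, b) \<in> {(p, q). p \<in> h \<and> q \<in> h \<and> {p, q} \<in> edges K}\<^sup>*"
    and dual_edge: "h \<in> HS \<Longrightarrow> \<exists>a\<in>h. \<exists>b\<in>\<Union>K - h. {a, b} \<in> edges K"
    and parallel: "h \<in> HS \<Longrightarrow> a \<in> h \<Longrightarrow> b \<in> \<Union>K - h \<Longrightarrow> {a, b} \<in> edges K \<Longrightarrow>
      a' \<in> h \<Longrightarrow> b' \<in> \<Union>K - h \<Longrightarrow> {a', b'} \<in> edges K \<Longrightarrow>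
      ((a, b), (a', b')) \<in> {((a, b), (a', b')). {a, a'} \<subseteq> h \<and> {b, b'} \<subseteq> \<Union>K - h \<and>
        (\<exists>c. cube_chart K 2 c \<and> c {} = a \<and> c {0} = b \<and> c {1} = a' \<and> c {0, 1} = b')}\<^sup>*"
begin

abbreviation V :: "'v set" where "V \<equiv> \<Union>K"

lemma edge_V: "{a, b} \<in> edges K \<Longrightarrow> a \<in> V \<and> b \<in> V"
  by (auto simp: edges_def)

lemma edge_commute: "{a, b} \<in> edges K \<longleftrightarrow> {b, a} \<in> edges K"
  by (simp add: insert_commute)

lemma edge_sep: "{a, b} \<in> edges K \<Longrightarrow> \<exists>h\<in>HS. a \<in> h \<and> b \<notin> h"
  using edge_V[of a b] edge_iff[of a b] by auto

lemma edge_unique: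
  "{a, b} \<in> edges K \<Longrightarrow> h \<in> HS \<Longrightarrow> a \<in> h \<Longrightarrow> b \<notin> h \<Longrightarrow> k \<in> HS \<Longrightarrow> a \<in> k \<Longrightarrow> b \<notin> k \<Longrightarrow> k = h"
  using edge_V edge_iff by blast

lemma Compl_Compl: "h \<in> HS \<Longrightarrow> V - (V - h) = h"
  using HS_subset by blast

lemma edge_unique':
  assumes e: "{a, b} \<in> edges K" and h: "h \<in> HS" "a \<in> h" "b \<notin> h" and k: "k \<in> HS" "a \<notin> k" "b \<in> k"
  shows "k = V - h"
proof -
  have "V - k = h" using edge_unique[OF e h HS_Compl[OF k(1)]] k edge_V[OF e] by blast
  then show ?thesis using Compl_Compl[OF k(1)] by simp
qed

text \<open>If both edges at \<open>q\<close> crossed the same wall, then no wall could separate \<open>p\<close> from \<open>r\<close>.\<close>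

lemma square_side:
  assumes e: "{p, q} \<in> edges K" "{q, r} \<in> edges K" and "p \<noteq> r" and h: "h \<in> HS" "q \<in> h" "p \<notin> h"
  shows "r \<in> h"
proof (rule ccontr)
  assume r: "r \<notin> h"
  have "p \<in> V" "r \<in> V" using edge_V[OF e(1)] edge_V[OF e(2)] by auto
  then obtain k where k: "k \<in> HS" "p \<in> k" "r \<notin> k" using separated[of p r] assms(3) by blast
  have e': "{q, p} \<in> edges K" using e(1) edge_commute by simp
  show False
  proof (cases "q \<in> k")
    case True
    then have "k = h" using edge_unique[OF e(2) h(1,2) r k(1)] k by blast
    then show False using k h by blast
  next
    case False
    then have "k = V - h" using edge_unique'[OF e' h k(1)] k by blast
    then show False using r k edge_V[OF e(2)] by blast
  qed
qed

lemma square_side':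
  assumes e: "{p, q} \<in> edges K" "{p, s} \<in> edges K" and "q \<noteq> s" and h: "h \<in> HS" "q \<in> h" "p \<notin> h"
  shows "s \<notin> h"
proof -
  have "{q, p} \<in> edges K" using e(1) edge_commute by simp
  then have "s \<in> V - h"
    using square_side[of q p s "V - h"] e(2) assms(3) HS_Compl[OF h(1)] h edge_V[OF e(1)] by simp
  then show ?thesis by blast
qed

lemma chart_V: "cube_chart K n c \<Longrightarrow> A \<subseteq> {..<n} \<Longrightarrow> c A \<in> V"
  unfolding cube_chart_def by blast

lemma chart_inj: "cube_chart K n c \<Longrightarrow> A \<subseteq> {..<n} \<Longrightarrow> B \<subseteq> {..<n} \<Longrightarrow> c A = c B \<longleftrightarrow> A = B"
  unfolding cube_chart_def inj_on_def by blast

lemma chart_edge: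
  assumes "cube_chart K n c" "A \<subseteq> {..<n}" "i < n" "i \<notin> A"
  shows "{c A, c (insert i A)} \<in> edges K"
proof -
  have "(A - insert i A) \<union> (insert i A - A) = {i}" using assms by blast
  then show ?thesis using assms unfolding cube_chart_def by auto
qed

text \<open>The wall crossed by the edge from \<open>c {}\<close> to \<open>c {i}\<close> is carried over from an edge in direction \<open>i\<close> to the next
  parallel one by the square that contains both.\<close>

lemma chart_dir:
  assumes c: "cube_chart K n c" and i: "i < n"
  shows "\<exists>h\<in>HS. \<forall>A. A \<subseteq> {..<n} \<longrightarrow> (c A \<in> h \<longleftrightarrow> i \<in> A)"
proof -
  have "{c {i}, c {}} \<in> edges K" using chart_edge[OF c, of "{}" i] i edge_commute by auto
  then obtain h where h: "h \<in> HS" "c {i} \<in> h" "c {} \<notin> h" using edge_sep by blast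
  have *: "A \<subseteq> {..<n} \<longrightarrow> i \<notin> A \<longrightarrow> c A \<notin> h \<and> c (insert i A) \<in> h" if "finite A" for A
    using that
  proof (induction A rule: finite_induct)
    case empty
    then show ?case using h by simp
  next
    case (insert j A)
    show ?case
    proof (intro impI)
      assume A: "insert j A \<subseteq> {..<n}" "i \<notin> insert j A"
      then have IH: "c A \<notin> h" "c (insert i A) \<in> h" using insert by auto
      have ji: "j \<notin> insert i A" "j < n" "insert i A \<subseteq> {..<n}" "A \<subseteq> {..<n}" using A insert i by auto
      have e: "{c A, c (insert i A)} \<in> edges K" "{c (insert i A), c (insert j (insert i A))} \<in> edges K"
         "{c A, c (insert j A)} \<in> edges K"
        using chart_edge[OF c] ji A i insert by auto
      have "c A \<noteq> c (insert j (insert i A))" "c (insert i A) \<noteq> c (insert j A)"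
        using chart_inj[OF c] ji A i by (auto simp: set_eq_iff)
      then show "c (insert j A) \<notin> h \<and> c (insert i (insert j A)) \<in> h"
        using square_side[OF e(1,2) _ h(1) IH(2,1)] square_side'[OF e(1,3) _ h(1) IH(2,1)]
        by (simp add: insert_commute)
    qed
  qed
  have "c A \<in> h \<longleftrightarrow> i \<in> A" if A: "A \<subseteq> {..<n}" for A
  proof -
    have "finite A" using A finite_subset by blast
    then show ?thesis using *[of A] *[of "A - {i}"] A by (cases "i \<in> A") (auto simp: insert_absorb)
  qed
  then show ?thesis using h by blast
qed

lemma chart_dir_unique:
  assumes c: "cube_chart K n c" and i: "i < n" and h: "h \<in> HS" "\<forall>A. A \<subseteq> {..<n} \<longrightarrow> (c A \<in> h \<longleftrightarrow> i \<in> A)"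
    and k: "k \<in> HS" "(c B \<in> k) \<noteq> (c (insert i B) \<in> k)" "B \<subseteq> {..<n}" "i \<notin> B"
  shows "k = h \<or> k = V - h"
proof -
  have e: "{c (insert i B), c B} \<in> edges K" using chart_edge[OF c k(3) i k(4)] edge_commute by simp
  have "c (insert i B) \<in> h" "c B \<notin> h" using h(2) k i by auto
  then show ?thesis using edge_unique[OF e h(1) _ _ k(1)] edge_unique'[OF e h(1) _ _ k(1)] k(2) by blast
qed

text \<open>A halfspace that does not contain all or none of the vertices of a cube separates two adjacent ones, and an
  edge is crossed by one wall only. So it cuts the cube in the middle of one of its directions.\<close>

lemma chart_cases:
  assumes c: "cube_chart K n c" and k: "k \<in> HS"
  shows "(\<forall>A. A \<subseteq> {..<n} \<longrightarrow> c A \<in> k) \<or> (\<forall>A. A \<subseteq> {..<n} \<longrightarrow> c A \<notin> k)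
    \<or> (\<exists>i<n. \<forall>A. A \<subseteq> {..<n} \<longrightarrow> (c A \<in> k \<longleftrightarrow> i \<in> A)) \<or> (\<exists>i<n. \<forall>A. A \<subseteq> {..<n} \<longrightarrow> (c A \<in> k \<longleftrightarrow> i \<notin> A))"
proof (cases "\<exists>i B. i < n \<and> B \<subseteq> {..<n} \<and> i \<notin> B \<and> (c B \<in> k) \<noteq> (c (insert i B) \<in> k)")
  case True
  then obtain i B where iB: "i < n" "B \<subseteq> {..<n}" "i \<notin> B" "(c B \<in> k) \<noteq> (c (insert i B) \<in> k)" by blast
  obtain h where h: "h \<in> HS" "\<forall>A. A \<subseteq> {..<n} \<longrightarrow> (c A \<in> h \<longleftrightarrow> i \<in> A)" using chart_dir[OF c iB(1)] by blast
  have "k = h \<or> k = V - h" using chart_dir_unique[OF c iB(1) h k iB(4,2,3)] .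
  then show ?thesis
  proof
    assume "k = V - h"
    then have "\<forall>A. A \<subseteq> {..<n} \<longrightarrow> (c A \<in> k \<longleftrightarrow> i \<notin> A)" using h(2) chart_V[OF c] by simp
    then show ?thesis using iB by blast
  qed (use h iB in blast)
next
  case False
  have "A \<subseteq> {..<n} \<longrightarrow> (c A \<in> k \<longleftrightarrow> c {} \<in> k)" if "finite A" for A
    using that by (induction A rule: finite_induct) (use False in auto)
  then have "A \<subseteq> {..<n} \<Longrightarrow> c A \<in> k \<longleftrightarrow> c {} \<in> k" for A using finite_subset by blast
  then show ?thesis by (cases "c {} \<in> k") simp_all
qed

lemma point_at:
  assumes "cube_chart K n c" "A \<subseteq> {..<n}" shows "cube_point n c t (c A) = weight n t A"
proof -
  have "{B. B \<subseteq> {..<n} \<and> c B = c A} = {A}" using chart_inj[OF assms(1)] assms(2) by blast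
  then show ?thesis by (simp add: cube_point_def weight_def)
qed

lemma point_off: "u \<notin> c ` Pow {..<n} \<Longrightarrow> cube_point n c t u = 0"
proof -
  assume "u \<notin> c ` Pow {..<n}"
  then have "{B. B \<subseteq> {..<n} \<and> c B = u} = {}" by blast
  then show ?thesis by (simp only: cube_point_def sum.empty)
qed

lemma coord_point:
  assumes c: "cube_chart K n c"
  shows "coord h (cube_point n c t) = (\<Sum>A | A \<subseteq> {..<n} \<and> c A \<in> h. weight n t A)"
proof -
  let ?S = "{A. A \<subseteq> {..<n} \<and> c A \<in> h}"
  have inj: "inj_on c ?S" using chart_inj[OF c] by (auto simp: inj_on_def)
  have fin: "finite ?S" by (rule finite_subset[of _ "Pow {..<n}"]) auto
  have sub: "{v. v \<in> h \<and> cube_point n c t v \<noteq> 0} \<subseteq> c ` ?S"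
  proof
    fix v assume v: "v \<in> {v. v \<in> h \<and> cube_point n c t v \<noteq> 0}"
    then have "v \<in> c ` Pow {..<n}" using point_off[of v c n t] by blast
    then show "v \<in> c ` ?S" using v by blast
  qed
  have "coord h (cube_point n c t) = sum (cube_point n c t) (c ` ?S)"
    unfolding coord_def by (rule sum.mono_neutral_left[OF finite_imageI[OF fin] sub]) auto
  also have "\<dots> = (\<Sum>A\<in>?S. cube_point n c t (c A))" using inj by (simp add: sum.reindex)
  also have "\<dots> = (\<Sum>A\<in>?S. weight n t A)" by (intro sum.cong) (auto simp: point_at[OF c])
  finally show ?thesis .
qed

lemma sum_weight': "(\<Sum>A | A \<subseteq> {..<n}. weight n t A) = 1"
  using sum_weight[of n t] by (simp add: Pow_def)

lemma coord_compl_point: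
  assumes c: "cube_chart K n c"
  shows "coord h (cube_point n c t) + coord (V - h) (cube_point n c t) = 1"
proof -
  have "(\<Sum>A | A \<subseteq> {..<n} \<and> c A \<in> h. weight n t A) + (\<Sum>A | A \<subseteq> {..<n} \<and> c A \<in> V - h. weight n t A)
    = (\<Sum>A | A \<subseteq> {..<n}. weight n t A)"
    by (subst sum.union_disjoint[symmetric])
       (auto intro!: sum.cong finite_subset[of _ "Pow {..<n}"] dest: chart_V[OF c])
  then show ?thesis using sum_weight' by (simp add: coord_point[OF c])
qed

lemma coord_dir:
  assumes c: "cube_chart K n c" and i: "i < n" and h: "\<forall>A. A \<subseteq> {..<n} \<longrightarrow> (c A \<in> h \<longleftrightarrow> i \<in> A)"
  shows "coord h (cube_point n c t) = t i"
proof -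
  have "{A. A \<subseteq> {..<n} \<and> c A \<in> h} = {A. A \<subseteq> {..<n} \<and> i \<in> A}" using h by blast
  then show ?thesis using sum_weight_dir[OF i] by (simp add: coord_point[OF c])
qed

lemma coord_codir:
  assumes c: "cube_chart K n c" and i: "i < n" and h: "\<forall>A. A \<subseteq> {..<n} \<longrightarrow> (c A \<in> h \<longleftrightarrow> i \<notin> A)"
  shows "coord h (cube_point n c t) = 1 - t i"
proof -
  have "\<forall>A. A \<subseteq> {..<n} \<longrightarrow> (c A \<in> V - h \<longleftrightarrow> i \<in> A)" using h chart_V[OF c] by auto
  then show ?thesis using coord_dir[OF c i, of "V - h" t] coord_compl_point[OF c, of h t] by simp
qed

text \<open>On a cube, \<open>coord k\<close> is constant or one of the cube's coordinates, up to the orientation.\<close>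

lemma coord_chart_cases:
  assumes c: "cube_chart K n c" and k: "k \<in> HS"
  obtains (inside) "\<forall>A. A \<subseteq> {..<n} \<longrightarrow> c A \<in> k" "\<And>t. coord k (cube_point n c t) = 1"
  | (outside) "\<forall>A. A \<subseteq> {..<n} \<longrightarrow> c A \<notin> k" "\<And>t. coord k (cube_point n c t) = 0"
  | (dir) i where "i < n" "\<forall>A. A \<subseteq> {..<n} \<longrightarrow> (c A \<in> k \<longleftrightarrow> i \<in> A)" "\<And>t. coord k (cube_point n c t) = t i"
  | (codir) i where "i < n" "\<forall>A. A \<subseteq> {..<n} \<longrightarrow> (c A \<in> k \<longleftrightarrow> i \<notin> A)" "\<And>t. coord k (cube_point n c t) = 1 - t i"
proof -
  have in1: "coord k (cube_point n c t) = 1" if "\<forall>A. A \<subseteq> {..<n} \<longrightarrow> c A \<in> k" for t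
  proof -
    have "{A. A \<subseteq> {..<n} \<and> c A \<in> k} = {A. A \<subseteq> {..<n}}" using that by blast
    then show ?thesis using sum_weight' by (simp add: coord_point[OF c])
  qed
  have out0: "coord k (cube_point n c t) = 0" if "\<forall>A. A \<subseteq> {..<n} \<longrightarrow> c A \<notin> k" for t
  proof -
    have "{A. A \<subseteq> {..<n} \<and> c A \<in> k} = {}" using that by blast
    then show ?thesis by (simp only: coord_point[OF c] sum.empty)
  qed
  show thesis
    using chart_cases[OF c k]
  proof (elim disjE exE conjE)
    assume "\<forall>A. A \<subseteq> {..<n} \<longrightarrow> c A \<in> k" then show thesis using inside in1 by blast
  next
    assume "\<forall>A. A \<subseteq> {..<n} \<longrightarrow> c A \<notin> k" then show thesis using outside out0 by blast
  next
    fix i assume "i < n" "\<forall>A. A \<subseteq> {..<n} \<longrightarrow> (c A \<in> k \<longleftrightarrow> i \<in> A)"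
    then show thesis using dir coord_dir[OF c] by blast
  next
    fix i assume "i < n" "\<forall>A. A \<subseteq> {..<n} \<longrightarrow> (c A \<in> k \<longleftrightarrow> i \<notin> A)"
    then show thesis using codir coord_codir[OF c] by blast
  qed
qed

section \<open>The realization and its halfspaces\<close>

lemma coord_affine:
  assumes c: "cube_chart K n c" and k: "k \<in> HS"
  shows "coord k (cube_point n c (\<lambda>i. (1 - l) * t i + l * t' i))
    = (1 - l) * coord k (cube_point n c t) + l * coord k (cube_point n c t')"
proof (rule coord_chart_cases[OF c k])
  fix i assume i: "\<And>t. coord k (cube_point n c t) = t i"
  show ?thesis unfolding i by simp
next
  fix i assume i: "\<And>t. coord k (cube_point n c t) = 1 - t i"
  show ?thesis unfolding i by (simp add: algebra_simps)
qed (simp_all add: algebra_simps)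

abbreviation R :: "('v \<Rightarrow> real) set" where "R \<equiv> realization K"

lemma R_E:
  assumes "x \<in> R" obtains n c t where "cube_chart K n c" "t \<in> unit_cube n" "x = cube_point n c t"
  using assms by (auto simp: realization_def)

lemma R_I: "cube_chart K n c \<Longrightarrow> t \<in> unit_cube n \<Longrightarrow> cube_point n c t \<in> R"
  by (auto simp: realization_def)

lemma coord_compl: "x \<in> R \<Longrightarrow> coord h x + coord (V - h) x = 1"
  using coord_compl_point by (auto simp: realization_def)

lemma R_nonneg: "x \<in> R \<Longrightarrow> 0 \<le> x v"
  unfolding realization_def cube_point_def unit_cube_def
  by (auto intro!: sum_nonneg prod_nonneg)

lemma R_support:
  assumes "x \<in> R" obtains Q where "Q \<in> K" "{v. x v \<noteq> 0} \<subseteq> Q"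
proof -
  obtain n c t where c: "cube_chart K n c" "x = cube_point n c t" using R_E[OF assms] by metis
  have "v \<in> c ` Pow {..<n}" if "x v \<noteq> 0" for v
    using point_off[of v c n t] that c(2) by blast
  then show thesis using that[of "c ` Pow {..<n}"] c(1) unfolding cube_chart_def by blast
qed

lemma R_finite_support: "x \<in> R \<Longrightarrow> finite {v. x v \<noteq> 0}"
  using R_support finite_cube finite_subset by metis

lemma coord_mono: "x \<in> R \<Longrightarrow> h \<subseteq> k \<Longrightarrow> coord h x \<le> coord k x"
  unfolding coord_def
  by (rule sum_mono2) (auto intro: R_nonneg rev_finite_subset[OF R_finite_support])

text \<open>Near a point that gives positive weight to \<open>v\<close>, every point is supported on the finitely many vertices that share a
  cube with \<open>v\<close>. There \<open>coord h\<close> is a finite sum of coordinates.\<close>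

lemma open_coord:
  assumes "h \<in> HS" shows "openin (top_of_set R) {x \<in> R. coord h x > r}"
proof -
  define F where "F v = \<Union>{Q \<in> K. v \<in> Q} \<inter> h" for v
  define U where "U v = {x :: 'v \<Rightarrow> real. x v \<noteq> 0} \<inter> {x. r < (\<Sum>u\<in>F v. x u)}" for v
  have "open (U v)" for v
    unfolding U_def
    by (intro open_Int open_Collect_neq open_Collect_less continuous_on_sum continuous_on_const) auto
  then have op: "open (\<Union>v\<in>V. U v)" by blast
  have eq: "coord h x = (\<Sum>u\<in>F v. x u)" if x: "x \<in> R" "x v \<noteq> 0" and v: "v \<in> V" for x v
  proof -
    obtain Q where "Q \<in> K" "{v. x v \<noteq> 0} \<subseteq> Q" using R_support[OF x(1)] .
    moreover from this have "v \<in> Q" using x by blast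
    ultimately have "{u \<in> h. x u \<noteq> 0} \<subseteq> F v" unfolding F_def by blast
    moreover have "finite (F v)" unfolding F_def using loc_fin[OF v] finite_cube by auto
    ultimately show ?thesis unfolding coord_def by (intro sum.mono_neutral_left) (auto simp: F_def)
  qed
  have ex: "\<exists>v\<in>V. x v \<noteq> 0" if x: "x \<in> R" for x
  proof (rule ccontr)
    assume "\<not> ?thesis"
    then have "{v \<in> h. x v \<noteq> 0} = {}" "{v \<in> V - h. x v \<noteq> 0} = {}" using HS_subset[OF assms] by auto
    then have "coord h x = 0" "coord (V - h) x = 0" unfolding coord_def by (metis sum.empty)+
    then show False using coord_compl[OF x, of h] by simp
  qed
  have "x \<in> R \<Longrightarrow> coord h x > r \<longleftrightarrow> x \<in> (\<Union>v\<in>V. U v)" for x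
  proof
    assume x: "x \<in> R" "coord h x > r"
    then obtain v where v: "v \<in> V" "x v \<noteq> 0" using ex[OF x(1)] by (elim bexE)
    then have "x \<in> U v" using eq[OF x(1) v(2,1)] x(2) by (simp add: U_def)
    then show "x \<in> (\<Union>v\<in>V. U v)" using v by blast
  next
    assume x: "x \<in> R" "x \<in> (\<Union>v\<in>V. U v)"
    then obtain v where v: "v \<in> V" "x \<in> U v" by blast
    then have "x v \<noteq> 0" "r < (\<Sum>u\<in>F v. x u)" by (auto simp: U_def)
    then show "coord h x > r" using eq[OF x(1) _ v(1)] by simp
  qed
  then have "{x \<in> R. coord h x > r} = R \<inter> (\<Union>v\<in>V. U v)" by (simp add: Int_def cong: conj_cong)
  then show ?thesis using op by (simp add: openin_open_Int)
qed

definition side :: "'v set \<Rightarrow> ('v \<Rightarrow> real) set" where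
  "side h = {x \<in> R. coord h x > 1 / 2}"

definition hyp :: "'v set \<Rightarrow> ('v \<Rightarrow> real) set" where
  "hyp h = {x \<in> R. coord h x = 1 / 2}"

definition halfspace :: "'v set \<Rightarrow> ('v \<Rightarrow> real) set" where
  "halfspace h = top_of_set R closure_of side h"

lemma side_compl: "side (V - h) = {x \<in> R. coord h x < 1 / 2}"
  unfolding side_def using coord_compl[of _ h] by force

lemma halfspace_sub: "h \<in> HS \<Longrightarrow> halfspace h \<subseteq> {x \<in> R. coord h x \<ge> 1 / 2}"
  unfolding halfspace_def
proof (rule closure_of_minimal)
  assume h: "h \<in> HS"
  have "R - {x \<in> R. coord h x \<ge> 1 / 2} = {x \<in> R. coord (V - h) x > 1 / 2}"
    using coord_compl[of _ h] by force
  then have "openin (top_of_set R) (R - {x \<in> R. coord h x \<ge> 1 / 2})"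
    using open_coord[OF HS_Compl[OF h], of "1 / 2"] by presburger
  then show "closedin (top_of_set R) {x \<in> R. coord h x \<ge> 1 / 2}"
    unfolding closedin_def topspace_euclidean_subtopology by blast
qed (auto simp: side_def)

lemma side_sub_halfspace: "side h \<subseteq> halfspace h"
  unfolding halfspace_def by (rule closure_of_subset) (auto simp: side_def)

lemma vertex_chart: "v \<in> V \<Longrightarrow> cube_chart K 0 (\<lambda>_. v)"
  using vertex unfolding cube_chart_def edges_def by auto

lemma edge_chart:
  assumes "{a, b} \<in> edges K" shows "cube_chart K 1 (\<lambda>A. if 0 \<in> A then b else a)"
proof -
  have "a \<noteq> b" "{a, b} \<in> K" using assms by (auto simp: edges_def)
  have P: "Pow {..<1::nat} = {{}, {0}}" by auto
  have "{a} \<notin> edges K" "{b} \<notin> edges K" by (auto simp: edges_def)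
  then show ?thesis unfolding cube_chart_def P using assms \<open>{a, b} \<in> K\<close> \<open>a \<noteq> b\<close>
    by (auto simp: insert_commute)
qed

lemma corner_cube: "corner A \<in> unit_cube n"
  by (auto simp: corner_def unit_cube_def)

lemma weight_corner:
  assumes "A \<subseteq> {..<n}" "B \<subseteq> {..<n}" shows "weight n (corner A) B = (if A = B then 1 else 0)"
proof (cases "A = B")
  case True
  then show ?thesis by (auto simp: weight_def corner_def intro!: prod.neutral)
next
  case False
  then obtain i where "i < n" "(i \<in> A) \<noteq> (i \<in> B)" using assms by blast
  then show ?thesis using False unfolding weight_def corner_def
    by (auto intro!: prod_zero bexI[of _ i])
qed

lemma point_corner:
  assumes c: "cube_chart K n c" and A: "A \<subseteq> {..<n}"
  shows "cube_point n c (corner A) = vertex_point (c A)"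
proof
  fix u
  show "cube_point n c (corner A) u = vertex_point (c A) u"
  proof (cases "u \<in> c ` Pow {..<n}")
    case True
    then obtain B where B: "B \<subseteq> {..<n}" "u = c B" by blast
    then show ?thesis using weight_corner[OF A B(1)] chart_inj[OF c A B(1)]
      by (cases "A = B") (simp_all add: point_at[OF c] vertex_point_def)
  next
    case False
    then have "u \<noteq> c A" using A by blast
    then show ?thesis using point_off[OF False] by (simp add: vertex_point_def)
  qed
qed

lemma vertex_point_R: "v \<in> V \<Longrightarrow> vertex_point v \<in> R"
  using R_I[OF vertex_chart corner_cube, of v "{}"] point_corner[OF vertex_chart, of v "{}"] by simp

lemma coord_vertex: "coord h (vertex_point v) = (if v \<in> h then 1 else 0)"
proof -
  have "{u. u \<in> h \<and> vertex_point v u \<noteq> 0} = (if v \<in> h then {v} else {})"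
    by (auto simp: vertex_point_def)
  then show ?thesis by (auto simp: coord_def vertex_point_def)
qed

lemma vertex_in_side: "v \<in> V \<Longrightarrow> vertex_point v \<in> side h \<longleftrightarrow> v \<in> h"
  using vertex_point_R by (auto simp: side_def coord_vertex)

lemma segment_continuous:
  "continuous_on UNIV (\<lambda>l::real. cube_point n c (\<lambda>i. (1 - l) * t i + l * t' i))"
proof (rule continuous_on_coordinatewise_then_product)
  fix u
  have "continuous_on UNIV (\<lambda>l::real. if i \<in> A then (1 - l) * t i + l * t' i else 1 - ((1 - l) * t i + l * t' i))" for i A
    by (cases "i \<in> A") (auto intro!: continuous_intros)
  then show "continuous_on UNIV (\<lambda>l. cube_point n c (\<lambda>i. (1 - l) * t i + l * t' i) u)"
    unfolding cube_point_def by (intro continuous_on_sum continuous_on_prod) auto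
qed

lemma segment_in_side:
  assumes c: "cube_chart K n c" and h: "h \<in> HS" and t: "t \<in> unit_cube n" "t' \<in> unit_cube n"
    and x: "coord h (cube_point n c t) > 1 / 2" "coord h (cube_point n c t') > 1 / 2"
  shows "connected_component (side h) (cube_point n c t) (cube_point n c t')"
proof -
  let ?f = "\<lambda>l::real. cube_point n c (\<lambda>i. (1 - l) * t i + l * t' i)"
  have "connected (?f ` {0..1})"
    by (rule connected_continuous_image[OF continuous_on_subset[OF segment_continuous]]) auto
  moreover have "?f ` {0..1} \<subseteq> side h"
  proof
    fix y assume "y \<in> ?f ` {0..1}"
    then obtain l where l: "0 \<le> l" "l \<le> 1" "y = ?f l" by auto
    have "(\<lambda>i. (1 - l) * t i + l * t' i) \<in> unit_cube n"
      using t l unfolding unit_cube_def by (auto intro!: convex_bound_le add_nonneg_nonneg)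
    then have "y \<in> R" using R_I[OF c] l by blast
    moreover have "(1 - l) * coord h (cube_point n c t) + l * coord h (cube_point n c t') > 1 / 2"
    proof -
      let ?a = "coord h (cube_point n c t)" and ?b = "coord h (cube_point n c t')"
      have "(1 - l) * ?a + l * ?b \<ge> (1 - l) * min ?a ?b + l * min ?a ?b"
        using l by (intro add_mono mult_left_mono) auto
      also have "(1 - l) * min ?a ?b + l * min ?a ?b = min ?a ?b" by (simp add: algebra_simps)
      finally show ?thesis using x by linarith
    qed
    ultimately show "y \<in> side h" using coord_affine[OF c h] l by (simp add: side_def)
  qed
  moreover have "?f 0 \<in> ?f ` {0..1}" "?f 1 \<in> ?f ` {0..1}" by (rule imageI, simp)+
  then have "cube_point n c t \<in> ?f ` {0..1}" "cube_point n c t' \<in> ?f ` {0..1}"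
    by (simp_all only: diff_zero diff_self mult_1 mult_zero_left add_0_right add_0)
  ultimately show ?thesis unfolding connected_component_def by blast
qed

text \<open>Move within a cube that contains \<open>x\<close> to one of its vertices in \<open>h\<close>. Since \<open>coord h\<close> is affine along
  segments of a cube, it stays above \<open>1 / 2\<close>.\<close>

lemma side_to_vertex:
  assumes h: "h \<in> HS" and x: "x \<in> side h"
  shows "\<exists>v\<in>h. connected_component (side h) x (vertex_point v)"
proof -
  obtain n c t where c: "cube_chart K n c" "t \<in> unit_cube n" "x = cube_point n c t"
    using x R_E unfolding side_def by blast
  have xc: "coord h (cube_point n c t) > 1 / 2" using x c by (simp add: side_def)
  then obtain A where A: "A \<subseteq> {..<n}" "c A \<in> h"
    using coord_chart_cases[OF c(1) h] by (metis empty_subsetI not_one_less_zero divide_pos_pos less_asym zero_less_one zero_less_numeral insert_subset lessThan_iff singletonI empty_iff)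
  have "coord h (cube_point n c (corner A)) > 1 / 2"
    using A by (simp add: point_corner[OF c(1) A(1)] coord_vertex)
  then have "connected_component (side h) (cube_point n c t) (cube_point n c (corner A))"
    by (rule segment_in_side[OF c(1) h c(2) corner_cube xc])
  then have "connected_component (side h) x (vertex_point (c A))"
    by (simp only: point_corner[OF c(1) A(1)] c(3))
  then show ?thesis using A by blast
qed

lemma vertices_connected:
  assumes h: "h \<in> HS" and ab: "a \<in> h" "b \<in> h"
  shows "connected_component (side h) (vertex_point a) (vertex_point b)"
  using connected_HS[OF assms]
proof (induction rule: rtrancl_induct)
  case base
  have "vertex_point a \<in> side h" using vertex_in_side ab HS_subset[OF h] by blast
  then show ?case by simp
next
  case (step p q)
  then have e: "{p, q} \<in> edges K" "p \<in> h" "q \<in> h" by auto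
  let ?c = "\<lambda>A. if (0::nat) \<in> A then q else p"
  have c: "cube_chart K 1 ?c" using edge_chart[OF e(1)] .
  have p: "cube_point 1 ?c (corner {}) = vertex_point p" "cube_point 1 ?c (corner {0}) = vertex_point q"
    using point_corner[OF c, of "{}"] point_corner[OF c, of "{0}"] by auto
  have "connected_component (side h) (cube_point 1 ?c (corner {})) (cube_point 1 ?c (corner {0}))"
    by (rule segment_in_side[OF c h corner_cube corner_cube]) (simp_all only: p coord_vertex e if_True)
  then show ?case using step.IH connected_component_trans unfolding p by blast
qed

lemma connected_side: "h \<in> HS \<Longrightarrow> connected (side h)"
proof -
  assume h: "h \<in> HS"
  have "connected_component (side h) x y" if xy: "x \<in> side h" "y \<in> side h" for x y
  proof -
    obtain a b where "a \<in> h" "b \<in> h" "connected_component (side h) x (vertex_point a)"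
      "connected_component (side h) y (vertex_point b)" using side_to_vertex[OF h] xy by blast
    then show ?thesis using vertices_connected[OF h, of a b]
      by (meson connected_component_sym connected_component_trans)
  qed
  then show ?thesis unfolding connected_iff_connected_component by blast
qed

lemma side_nonempty: "h \<in> HS \<Longrightarrow> side h \<noteq> {}"
proof -
  assume h: "h \<in> HS"
  obtain a where a: "a \<in> h" using dual_edge[OF h] by blast
  then have "vertex_point a \<in> side h" using vertex_in_side[of a h] HS_subset[OF h] by blast
  then show "side h \<noteq> {}" by blast
qed

text \<open>The two sides are open, disjoint and connected.\<close>

lemma components_hyp:
  assumes h: "h \<in> HS" shows "components (R - hyp h) = {side h, side (V - h)}"
proof -
  let ?A = "side h" and ?B = "side (V - h)"
  have h': "V - h \<in> HS" using HS_Compl[OF h] .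
  have un: "R - hyp h = ?A \<union> ?B" unfolding side_compl unfolding side_def hyp_def by force
  have dis: "?A \<inter> ?B = {}" unfolding side_compl unfolding side_def by force
  have op: "openin (top_of_set (?A \<union> ?B)) ?A" "openin (top_of_set (?A \<union> ?B)) ?B"
  proof -
    have "?A \<union> ?B \<subseteq> R" by (auto simp: side_def)
    then show "openin (top_of_set (?A \<union> ?B)) ?A" "openin (top_of_set (?A \<union> ?B)) ?B"
      by (rule openin_subset_trans[OF open_coord[OF h, of "1/2", folded side_def] Un_upper1],
          rule openin_subset_trans[OF open_coord[OF h', of "1/2", folded side_def] Un_upper2])
  qed
  have sub: "C \<subseteq> ?A \<or> C \<subseteq> ?B" if C: "connected C" "C \<subseteq> ?A \<union> ?B" for C
  proof (rule ccontr)
    assume n: "\<not> ?thesis"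
    obtain S T where S: "open S" "?A = (?A \<union> ?B) \<inter> S" and T: "open T" "?B = (?A \<union> ?B) \<inter> T"
      using op unfolding openin_open by blast
    have "S \<inter> T \<inter> C = {}" "C \<subseteq> S \<union> T" "S \<inter> C \<noteq> {}" "T \<inter> C \<noteq> {}" using S T C(2) n dis by blast+
    then show False using connectedD[OF C(1) S(1) T(1)] by blast
  qed
  have maxA: "D = ?A" if "connected D" "?A \<subseteq> D" "D \<subseteq> ?A \<union> ?B" for D
    using sub[OF that(1,3)] that(2) side_nonempty[OF h] dis by blast
  have maxB: "D = ?B" if "connected D" "?B \<subseteq> D" "D \<subseteq> ?A \<union> ?B" for D
    using sub[OF that(1,3)] that(2) side_nonempty[OF h'] dis by blast
  have comp: "?A \<in> components (?A \<union> ?B)" "?B \<in> components (?A \<union> ?B)"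
    unfolding in_components_maximal
    using maxA maxB connected_side[OF h] connected_side[OF h'] side_nonempty[OF h] side_nonempty[OF h']
    by simp_all
  have "C \<in> {?A, ?B}" if C: "C \<in> components (?A \<union> ?B)" for C
  proof -
    have "C \<subseteq> ?A \<or> C \<subseteq> ?B" using sub[OF in_components_connected[OF C] in_components_subset[OF C]] .
    then show ?thesis
      using C comp connected_side[OF h] connected_side[OF h'] side_nonempty[OF h] side_nonempty[OF h']
      unfolding in_components_maximal by (metis insertCI Un_upper1 Un_upper2)
  qed
  then show ?thesis unfolding un using comp by blast
qed

lemma halfspaces_of_hyp: "h \<in> HS \<Longrightarrow> halfspaces_of K (hyp h) = {halfspace h, halfspace (V - h)}"
  unfolding halfspaces_of_def by (simp add: components_hyp halfspace_def)

text \<open>Larger vertex sets have larger barycentric weight. Conversely the vertices in a closed halfspace are the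
  vertices in \<open>h\<close>, as \<open>coord h\<close> is \<open>0\<close> or \<open>1\<close> at a vertex.\<close>

lemma halfspace_mono_iff:
  assumes "h \<in> HS" "k \<in> HS" shows "halfspace h \<subseteq> halfspace k \<longleftrightarrow> h \<subseteq> k"
proof
  assume "h \<subseteq> k"
  then have "side h \<subseteq> side k" unfolding side_def using coord_mono[of _ h k] by force
  then show "halfspace h \<subseteq> halfspace k" unfolding halfspace_def by (rule closure_of_mono)
next
  assume sub: "halfspace h \<subseteq> halfspace k"
  show "h \<subseteq> k"
  proof
    fix v assume v: "v \<in> h"
    then have "v \<in> V" using HS_subset[OF assms(1)] by blast
    then have "vertex_point v \<in> side h" using vertex_in_side v by simp
    then have "vertex_point v \<in> halfspace k" using side_sub_halfspace sub by blast
    then have "coord k (vertex_point v) \<ge> 1 / 2" using halfspace_sub[OF assms(2)] by blast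
    then show "v \<in> k" by (simp add: coord_vertex split: if_splits)
  qed
qed

end

section \<open>Hyperplanes\<close>

context cube_halfspaces
begin

definition midcube :: "nat \<Rightarrow> (nat set \<Rightarrow> 'v) \<Rightarrow> nat \<Rightarrow> ('v \<Rightarrow> real) set" where
  "midcube n c j = cube_point n c ` {t \<in> unit_cube n. t j = 1 / 2}"

text \<open>The midcubes across the wall of \<open>h\<close>. As \<open>h\<close> and its complement are the two sides of one wall, they have the same
  dual midcubes.\<close>

definition dual_midcubes :: "'v set \<Rightarrow> ('v \<Rightarrow> real) set set" where
  "dual_midcubes h = {midcube n c j | n c j. cube_chart K n c \<and> j < n \<and> (c {} \<in> h) \<noteq> (c {j} \<in> h)}"

lemma midcubes_iff: "M \<in> midcubes K \<longleftrightarrow> (\<exists>n c j. M = midcube n c j \<and> cube_chart K n c \<and> j < n)"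
  unfolding midcubes_def midcube_def by blast

lemma dual_is_midcube: "M \<in> dual_midcubes h \<Longrightarrow> M \<in> midcubes K"
  unfolding midcubes_iff dual_midcubes_def by blast

lemma dual_coord:
  assumes c: "cube_chart K n c" and h: "h \<in> HS" and j: "j < n" and d: "(c {} \<in> h) \<noteq> (c {j} \<in> h)"
  shows "(\<forall>t. coord h (cube_point n c t) = t j) \<or> (\<forall>t. coord h (cube_point n c t) = 1 - t j)"
proof (rule coord_chart_cases[OF c h])
  fix i assume i: "i < n" "\<forall>A. A \<subseteq> {..<n} \<longrightarrow> (c A \<in> h \<longleftrightarrow> i \<in> A)" "\<And>t. coord h (cube_point n c t) = t i"
  then have "i = j" using d j by auto
  then show ?thesis using i by blast
next
  fix i assume i: "i < n" "\<forall>A. A \<subseteq> {..<n} \<longrightarrow> (c A \<in> h \<longleftrightarrow> i \<notin> A)" "\<And>t. coord h (cube_point n c t) = 1 - t i"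
  then have "i = j" using d j by auto
  then show ?thesis using i by blast
qed (use d j in auto)

lemma dual_sub_hyp: "h \<in> HS \<Longrightarrow> M \<in> dual_midcubes h \<Longrightarrow> M \<subseteq> hyp h"
proof
  fix x assume h: "h \<in> HS" and "M \<in> dual_midcubes h" "x \<in> M"
  then obtain n c j t where c: "cube_chart K n c" "j < n" "(c {} \<in> h) \<noteq> (c {j} \<in> h)" 
    and t: "t \<in> unit_cube n" "t j = 1 / 2" "x = cube_point n c t"
    unfolding dual_midcubes_def midcube_def by blast
  have "x \<in> R" using R_I[OF c(1) t(1)] t(3) by simp
  moreover have "coord h x = 1 / 2" using dual_coord[OF c(1) h c(2,3)] t by auto
  ultimately show "x \<in> hyp h" by (simp add: hyp_def)
qed

text \<open>At a point of the level set, the coordinate of the cube that \<open>coord h\<close> picks out is \<open>1 / 2\<close>.\<close>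

lemma hyp_union: assumes h: "h \<in> HS" shows "\<Union> (dual_midcubes h) = hyp h"
proof
  show "\<Union> (dual_midcubes h) \<subseteq> hyp h" using dual_sub_hyp[OF h] by blast
  show "hyp h \<subseteq> \<Union> (dual_midcubes h)"
  proof
    fix x assume "x \<in> hyp h"
    then obtain n c t where c: "cube_chart K n c" and t: "t \<in> unit_cube n" "x = cube_point n c t"
      and x: "coord h (cube_point n c t) = 1 / 2" unfolding hyp_def by (auto elim: R_E)
    obtain j where "j < n" "t j = 1 / 2" "(c {} \<in> h) \<noteq> (c {j} \<in> h)"
    proof (rule coord_chart_cases[OF c h])
      fix i assume "i < n" "\<forall>A. A \<subseteq> {..<n} \<longrightarrow> (c A \<in> h \<longleftrightarrow> i \<in> A)" "\<And>t. coord h (cube_point n c t) = t i"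
      then show thesis using that[of i] x by auto
    next
      fix i assume "i < n" "\<forall>A. A \<subseteq> {..<n} \<longrightarrow> (c A \<in> h \<longleftrightarrow> i \<notin> A)" "\<And>t. coord h (cube_point n c t) = 1 - t i"
      then show thesis using that[of i] x by auto
    qed (use x in auto)
    then show "x \<in> \<Union> (dual_midcubes h)" using c t unfolding dual_midcubes_def midcube_def by blast
  qed
qed

lemma weight_mid:
  assumes "A \<subseteq> {..<n}" "j < n" "j \<notin> A" "B \<subseteq> {..<n}"
  shows "weight n ((corner A)(j := 1 / 2)) B = (if B = A \<or> B = insert j A then 1 / 2 else 0)"
proof (cases "B = A \<or> B = insert j A")
  case True
  have "(\<Prod>i<n. if i \<in> B then ((corner A)(j := 1 / 2)) i else 1 - ((corner A)(j := 1 / 2)) i)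
    = (\<Prod>i<n. if i = j then 1 / 2 else 1)"
    using True assms by (intro prod.cong) (auto simp: corner_def)
  also have "\<dots> = 1 / 2" using assms by (simp add: prod.delta)
  finally show ?thesis using True by (simp add: weight_def)
next
  case False
  then obtain i where "i < n" "i \<noteq> j" "(i \<in> A) \<noteq> (i \<in> B)" using assms by blast
  then show ?thesis using False unfolding weight_def corner_def
    by (auto intro!: prod_zero bexI[of _ i])
qed

lemma point_mid:
  assumes c: "cube_chart K n c" and A: "A \<subseteq> {..<n}" "j < n" "j \<notin> A"
  shows "cube_point n c ((corner A)(j := 1 / 2)) = edge_midpoint (c A) (c (insert j A))"
proof
  fix u
  have A': "insert j A \<subseteq> {..<n}" using A by auto
  show "cube_point n c ((corner A)(j := 1 / 2)) u = edge_midpoint (c A) (c (insert j A)) u"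
  proof (cases "u \<in> c ` Pow {..<n}")
    case True
    then obtain B where B: "B \<subseteq> {..<n}" "u = c B" by blast
    then show ?thesis using weight_mid[OF A B(1)] chart_inj[OF c A(1) B(1)] chart_inj[OF c A' B(1)]
      by (cases "B = A \<or> B = insert j A") (auto simp: point_at[OF c B(1)] edge_midpoint_def)
  next
    case False
    then have "u \<noteq> c A" "u \<noteq> c (insert j A)" using A A' by blast+
    then show ?thesis using point_off[OF False] by (simp add: edge_midpoint_def)
  qed
qed

lemma midpoint_in_midcube:
  assumes c: "cube_chart K n c" and A: "A \<subseteq> {..<n}" "j < n" "j \<notin> A"
  shows "edge_midpoint (c A) (c (insert j A)) \<in> midcube n c j"
proof -
  have "(corner A)(j := 1 / 2) \<in> unit_cube n" by (auto simp: unit_cube_def corner_def)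
  then show ?thesis unfolding midcube_def point_mid[OF assms, symmetric] by auto
qed

lemma edge_midcube:
  assumes "{a, b} \<in> edges K"
  shows "midcube 1 (\<lambda>A. if 0 \<in> A then b else a) 0 = {edge_midpoint a b}"
proof -
  let ?c = "\<lambda>A. if (0::nat) \<in> A then b else a"
  have P: "(\<Prod>i<1. if i \<in> A then s i else 1 - s i) = (if 0 \<in> A then s 0 else 1 - s 0)"
    for s :: "nat \<Rightarrow> real" and A
    by (simp add: lessThan_Suc)
  have pt: "cube_point 1 ?c t = edge_midpoint a b" if "t 0 = 1 / 2" for t
  proof -
    have "cube_point 1 ?c t = cube_point 1 ?c ((corner {})(0 := 1 / 2))"
      unfolding cube_point_def P fun_upd_same that by (rule HOL.refl)
    then show ?thesis using point_mid[OF edge_chart[OF assms], of "{}" 0] by simp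
  qed
  have "(\<lambda>_. 1 / 2) \<in> {t \<in> unit_cube 1. t 0 = 1 / 2}" by (auto simp: unit_cube_def)
  then have ne: "{t \<in> unit_cube 1. t 0 = 1 / 2} \<noteq> {}" by blast
  have "midcube 1 ?c 0 = (\<lambda>_. edge_midpoint a b) ` {t \<in> unit_cube 1. t 0 = 1 / 2}"
    unfolding midcube_def by (rule image_cong[OF HOL.refl]) (simp only: mem_Collect_eq pt)
  then show ?thesis using ne by (simp only: image_constant_conv if_False)
qed

lemma midpoint_is_midcube: "{a, b} \<in> edges K \<Longrightarrow> {edge_midpoint a b} \<in> midcubes K"
  using edge_midcube edge_chart unfolding midcubes_iff by (metis zero_less_one)

lemma midpoint_dual:
  assumes "{a, b} \<in> edges K" "(a \<in> h) \<noteq> (b \<in> h)" shows "{edge_midpoint a b} \<in> dual_midcubes h"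
proof -
  let ?c = "\<lambda>A. if (0::nat) \<in> A then b else a"
  have "(?c {} \<in> h) \<noteq> (?c {0} \<in> h)" using assms by simp
  then show ?thesis unfolding dual_midcubes_def edge_midcube[OF assms(1), symmetric]
    using edge_chart[OF assms(1)]
    by (intro CollectI exI[of _ 1] exI[of _ ?c] exI[of _ 0] conjI) (rule HOL.refl | assumption | simp)+
qed

lemma midpoint_commute: "edge_midpoint a b = edge_midpoint b a"
  by (auto simp: edge_midpoint_def)

text \<open>A midcube contains the midpoint of an edge. All coordinates of the surrounding cube but one are \<open>0\<close> or \<open>1\<close>
  there, so only the wall across this edge has its level set through it.\<close>

lemma hyp_unique:
  assumes h: "h \<in> HS" and k: "k \<in> HS" and M: "M \<in> dual_midcubes h" "M \<subseteq> hyp k"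
  shows "k = h \<or> k = V - h"
proof -
  obtain n c j where c: "cube_chart K n c" "j < n" "(c {} \<in> h) \<noteq> (c {j} \<in> h)" and Mj: "M = midcube n c j"
    using M(1) unfolding dual_midcubes_def by blast
  have "cube_point n c ((corner {})(j := 1 / 2)) \<in> M"
    using midpoint_in_midcube[OF c(1) _ c(2), of "{}"] point_mid[OF c(1) _ c(2), of "{}"] Mj by simp
  then have x: "coord k (cube_point n c ((corner {})(j := 1 / 2))) = 1 / 2" using M(2) by (auto simp: hyp_def)
  have d: "(c {} \<in> k) \<noteq> (c {j} \<in> k)"
  proof (rule coord_chart_cases[OF c(1) k])
    fix i assume i: "i < n" "\<forall>A. A \<subseteq> {..<n} \<longrightarrow> (c A \<in> k \<longleftrightarrow> i \<in> A)" "\<And>t. coord k (cube_point n c t) = t i"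
    then have "i = j" using x by (auto simp: corner_def split: if_splits)
    then show ?thesis using i by auto
  next
    fix i assume i: "i < n" "\<forall>A. A \<subseteq> {..<n} \<longrightarrow> (c A \<in> k \<longleftrightarrow> i \<notin> A)" "\<And>t. coord k (cube_point n c t) = 1 - t i"
    then have "i = j" using x by (auto simp: corner_def split: if_splits)
    then show ?thesis using i by auto
  qed (use x in auto)
  have e: "{c {}, c {j}} \<in> edges K" using chart_edge[OF c(1) _ c(2), of "{}"] by simp
  then have e': "{c {j}, c {}} \<in> edges K" using edge_commute by simp
  show ?thesis
  proof (cases "c {} \<in> h")
    case True
    then show ?thesis using d c(3) edge_unique[OF e h _ _ k] edge_unique'[OF e h _ _ k] by metis
  next
    case False
    then show ?thesis using d c(3) edge_unique[OF e' h _ _ k] edge_unique'[OF e' h _ _ k] by metis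
  qed
qed

lemma dual_compl: "h \<in> HS \<Longrightarrow> dual_midcubes (V - h) = dual_midcubes h"
proof -
  have "(c {} \<in> V - h) \<noteq> (c {j} \<in> V - h) \<longleftrightarrow> (c {} \<in> h) \<noteq> (c {j} \<in> h)"
    if "cube_chart K n c" "j < n" for n c j
    using chart_V[OF that(1), of "{}"] chart_V[OF that(1), of "{j}"] that(2) by auto
  then show ?thesis unfolding dual_midcubes_def
    by (intro Collect_cong iff_exI conj_cong HOL.refl) simp
qed

lemma midcube_dual_ex: assumes "M \<in> midcubes K" shows "\<exists>h\<in>HS. M \<in> dual_midcubes h"
proof -
  obtain n c j where M: "M = midcube n c j" "cube_chart K n c" "j < n" using assms unfolding midcubes_iff by blast
  obtain h where h: "h \<in> HS" "\<forall>A. A \<subseteq> {..<n} \<longrightarrow> (c A \<in> h \<longleftrightarrow> j \<in> A)" using chart_dir[OF M(2,3)] by blast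
  then have "(c {} \<in> h) \<noteq> (c {j} \<in> h)" using M(3) by simp
  then show ?thesis using M h unfolding dual_midcubes_def by blast
qed

lemma face_dual:
  assumes h: "h \<in> HS" and MN: "(M, N) \<in> midcube_face K"
  shows "M \<in> dual_midcubes h \<longleftrightarrow> N \<in> dual_midcubes h"
proof -
  have mid: "M \<in> midcubes K" "N \<in> midcubes K" "M \<subseteq> N" using MN unfolding midcube_face_def by auto
  obtain k l where k: "k \<in> HS" "M \<in> dual_midcubes k" and l: "l \<in> HS" "N \<in> dual_midcubes l"
    using midcube_dual_ex mid by meson
  show ?thesis
  proof
    assume "M \<in> dual_midcubes h"
    then have "l = h \<or> l = V - h" using hyp_unique[OF h l(1)] dual_sub_hyp[OF l] mid(3) by blast
    then show "N \<in> dual_midcubes h" using l dual_compl[OF h] by blast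
  next
    assume "N \<in> dual_midcubes h"
    then have "h = k \<or> h = V - k" using hyp_unique[OF k(1) h k(2)] dual_sub_hyp[OF h] mid(3) by blast
    then show "M \<in> dual_midcubes h" using k dual_compl[OF k(1)] by blast
  qed
qed

abbreviation face_eq where "face_eq \<equiv> midcube_face K \<union> (midcube_face K)\<inverse>"

lemma face_eq_sym: "(M, N) \<in> face_eq\<^sup>* \<Longrightarrow> (N, M) \<in> face_eq\<^sup>*"
  by (meson sym_Un_converse sym_rtrancl symD)

lemma dual_edge_of:
  assumes h: "h \<in> HS" and M: "M \<in> dual_midcubes h"
  shows "\<exists>a\<in>h. \<exists>b\<in>V - h. {a, b} \<in> edges K \<and> (M, {edge_midpoint a b}) \<in> face_eq\<^sup>*"
proof -
  obtain n c j where c: "cube_chart K n c" "j < n" "(c {} \<in> h) \<noteq> (c {j} \<in> h)" and Mj: "M = midcube n c j"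
    using M(1) unfolding dual_midcubes_def by blast
  have e: "{c {}, c {j}} \<in> edges K" using chart_edge[OF c(1) _ c(2), of "{}"] by simp
  have "edge_midpoint (c {}) (c {j}) \<in> M" using midpoint_in_midcube[OF c(1) _ c(2), of "{}"] Mj by simp
  then have "({edge_midpoint (c {}) (c {j})}, M) \<in> midcube_face K"
    using midpoint_is_midcube[OF e] dual_is_midcube[OF M] unfolding midcube_face_def by blast
  then have f: "(M, {edge_midpoint (c {}) (c {j})}) \<in> face_eq\<^sup>*" by blast
  show ?thesis
  proof (cases "c {} \<in> h")
    case True
    then have "c {j} \<in> V - h" using c(3) edge_V[OF e] by simp
    then show ?thesis using f e True by (intro bexI[of _ "c {}"] bexI[of _ "c {j}"] conjI)
  next
    case False
    then have "c {j} \<in> h" "c {} \<in> V - h" using c(3) edge_V[OF e] by simp_all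
    moreover have "{c {j}, c {}} \<in> edges K" using e edge_commute by simp
    moreover have "(M, {edge_midpoint (c {j}) (c {})}) \<in> face_eq\<^sup>*" using f midpoint_commute by metis
    ultimately show ?thesis by (intro bexI[of _ "c {j}"] bexI[of _ "c {}"] conjI)
  qed
qed

lemma square_face_eq:
  assumes c: "cube_chart K 2 c"
  shows "({edge_midpoint (c {}) (c {0})}, {edge_midpoint (c {1}) (c {0, 1})}) \<in> face_eq\<^sup>*"
proof -
  let ?N = "midcube 2 c 0"
  have N: "?N \<in> midcubes K" using c unfolding midcubes_iff by (metis zero_less_numeral)
  have "edge_midpoint (c {}) (c {0}) \<in> ?N" "edge_midpoint (c {1}) (c {0, 1}) \<in> ?N"
    using midpoint_in_midcube[OF c, of "{}" 0] midpoint_in_midcube[OF c, of "{1}" 0] by auto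
  moreover have "{c {}, c {0}} \<in> edges K" "{c {1}, c {0, 1}} \<in> edges K"
    using chart_edge[OF c, of "{}" 0] chart_edge[OF c, of "{1}" 0] by auto
  ultimately have "({edge_midpoint (c {}) (c {0})}, ?N) \<in> midcube_face K"
     "({edge_midpoint (c {1}) (c {0, 1})}, ?N) \<in> midcube_face K"
    using N midpoint_is_midcube unfolding midcube_face_def by auto
  then show ?thesis by (meson UnCI converseI converse_rtrancl_into_rtrancl r_into_rtrancl)
qed

text \<open>Each midcube has the midpoint of an edge as a face, and the midpoints of opposite edges of a square are faces of one
  midcube of the square. So the chain of squares between two edges across the wall gives a chain of faces.\<close>

lemma dual_midcubes_connected:
  assumes h: "h \<in> HS" and M: "M \<in> dual_midcubes h" and N: "N \<in> dual_midcubes h"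
  shows "(M, N) \<in> face_eq\<^sup>*"
proof -
  obtain a b where a: "a \<in> h" "b \<in> V - h" "{a, b} \<in> edges K" "(M, {edge_midpoint a b}) \<in> face_eq\<^sup>*"
    using dual_edge_of[OF h M] by blast
  obtain a' b' where a': "a' \<in> h" "b' \<in> V - h" "{a', b'} \<in> edges K" "(N, {edge_midpoint a' b'}) \<in> face_eq\<^sup>*"
    using dual_edge_of[OF h N] by blast
  have "({edge_midpoint (fst (a, b)) (snd (a, b))}, {edge_midpoint (fst (a', b')) (snd (a', b'))}) \<in> face_eq\<^sup>*"
    using parallel[OF h a(1-3) a'(1-3)]
  proof (induction rule: rtrancl_induct)
    case (step p q)
    then obtain c where "cube_chart K 2 c" "c {} = fst p" "c {0} = snd p" "c {1} = fst q" "c {0, 1} = snd q"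
      by auto
    then have "({edge_midpoint (fst p) (snd p)}, {edge_midpoint (fst q) (snd q)}) \<in> face_eq\<^sup>*"
      using square_face_eq by metis
    then show ?case using step.IH rtrancl_trans by meson
  qed simp
  then show ?thesis using a(4) face_eq_sym[OF a'(4)] rtrancl_trans by (metis fst_conv snd_conv)
qed

lemma midcube_class:
  assumes h: "h \<in> HS" and M: "M \<in> dual_midcubes h" shows "face_eq\<^sup>* `` {M} = dual_midcubes h"
proof
  show "dual_midcubes h \<subseteq> face_eq\<^sup>* `` {M}" using dual_midcubes_connected[OF h M] by blast
  have "N \<in> dual_midcubes h" if "(M, N) \<in> face_eq\<^sup>*" for N
    using that by (induction rule: rtrancl_induct) (use M face_dual[OF h] in auto)
  then show "face_eq\<^sup>* `` {M} \<subseteq> dual_midcubes h" by blast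
qed

text \<open>A class of midcubes under the face relation consists of all midcubes across one wall.\<close>

theorem hyperplanes_eq: "hyperplanes K = hyp ` HS"
proof
  show "hyperplanes K \<subseteq> hyp ` HS"
  proof
    fix J assume "J \<in> hyperplanes K"
    then obtain M where M: "M \<in> midcubes K" "J = \<Union> (face_eq\<^sup>* `` {M})" unfolding hyperplanes_def by blast
    obtain h where h: "h \<in> HS" "M \<in> dual_midcubes h" using midcube_dual_ex[OF M(1)] by blast
    have "J = hyp h" unfolding M(2) midcube_class[OF h] by (rule hyp_union[OF h(1)])
    then show "J \<in> hyp ` HS" using h(1) by (rule image_eqI)
  qed
  show "hyp ` HS \<subseteq> hyperplanes K"
  proof
    fix J assume "J \<in> hyp ` HS"
    then obtain h where h: "h \<in> HS" "J = hyp h" by blast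
    obtain a b where "a \<in> h" "b \<in> V - h" "{a, b} \<in> edges K" using dual_edge[OF h(1)] by blast
    then have m: "{edge_midpoint a b} \<in> dual_midcubes h" using midpoint_dual[of a b h] by blast
    have "J = \<Union> (face_eq\<^sup>* `` {{edge_midpoint a b}})"
      unfolding midcube_class[OF h(1) m] using hyp_union[OF h(1)] h(2) by simp
    then show "J \<in> hyperplanes K" unfolding hyperplanes_def using dual_is_midcube[OF m] by blast
  qed
qed

end

section \<open>The ultrafilter topology\<close>

text \<open>The generating family is closed under intersections, so it contains arbitrarily small neighbourhoods.\<close>

lemma ultrafilter_nbhd:
  assumes "generate_topology_on (insert (ultrafilters K)
      {{\<alpha> \<in> ultrafilters K. H \<subseteq> \<alpha>} | H. finite H \<and> H \<subseteq> halfspaces K}) T" "\<alpha> \<in> T"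
  shows "\<exists>H. finite H \<and> H \<subseteq> \<alpha> \<and> {\<beta> \<in> ultrafilters K. H \<subseteq> \<beta>} \<subseteq> T"
  using assms
proof (induction rule: generate_topology_on.induct)
  case (Int S T)
  then obtain H H' where "finite H" "H \<subseteq> \<alpha>" "{\<beta> \<in> ultrafilters K. H \<subseteq> \<beta>} \<subseteq> S"
    "finite H'" "H' \<subseteq> \<alpha>" "{\<beta> \<in> ultrafilters K. H' \<subseteq> \<beta>} \<subseteq> T" by auto
  then show ?case by (intro exI[of _ "H \<union> H'"]) auto
next
  case (UN TS)
  then obtain T where "T \<in> TS" "\<alpha> \<in> T" by auto
  then obtain H where "finite H" "H \<subseteq> \<alpha>" "{\<beta> \<in> ultrafilters K. H \<subseteq> \<beta>} \<subseteq> T" using UN.IH by meson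
  then show ?case using \<open>T \<in> TS\<close> by (intro exI[of _ H]) auto
next
  case (Basis T)
  then consider "T = ultrafilters K" | H where "T = {\<alpha> \<in> ultrafilters K. H \<subseteq> \<alpha>}" "finite H" by auto
  then show ?case
  proof cases
    case 1
    then show ?thesis by (intro exI[of _ "{}"]) auto
  next
    case 2
    then show ?thesis using Basis(2) by (intro exI[of _ H]) auto
  qed
qed simp

lemma B_boundary_iff:
  "\<alpha> \<in> B_boundary K \<longleftrightarrow> \<alpha> \<in> ultrafilters K \<and>
    (\<forall>H. finite H \<and> H \<subseteq> \<alpha> \<longrightarrow> (\<exists>\<beta>\<in>roller_boundary K. non_terminating \<beta> \<and> H \<subseteq> \<beta>))"
proof -
  let ?T = "ultrafilter_topology K" and ?S = "{\<beta> \<in> roller_boundary K. non_terminating \<beta>}"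
  have top: "topspace ?T = ultrafilters K"
    unfolding ultrafilter_topology_def topology_generated_by_topspace by auto
  have nbhd: "openin ?T {\<beta> \<in> ultrafilters K. H \<subseteq> \<beta>}" if "finite H" "H \<subseteq> \<alpha>" "\<alpha> \<in> ultrafilters K" for H
  proof -
    have "H \<subseteq> halfspaces K" using that by (auto simp: ultrafilters_def)
    then show ?thesis using that(1)
      unfolding ultrafilter_topology_def openin_topology_generated_by_iff
      by (intro generate_topology_on.Basis) auto
  qed
  show ?thesis unfolding B_boundary_def in_closure_of top
  proof (intro iffI conjI allI impI)
    fix H assume a: "\<alpha> \<in> ultrafilters K \<and> (\<forall>T. \<alpha> \<in> T \<and> openin ?T T \<longrightarrow> (\<exists>y. y \<in> ?S \<and> y \<in> T))"
      and H: "finite H \<and> H \<subseteq> \<alpha>"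
    then have n: "openin ?T {\<beta> \<in> ultrafilters K. H \<subseteq> \<beta>}" "\<alpha> \<in> {\<beta> \<in> ultrafilters K. H \<subseteq> \<beta>}"
      using nbhd by auto
    obtain y where "y \<in> ?S \<and> y \<in> {\<beta> \<in> ultrafilters K. H \<subseteq> \<beta>}"
      using mp[OF spec[OF conjunct2[OF a]] conjI[OF n(2,1)]] by (elim exE)
    then show "\<exists>\<beta>\<in>roller_boundary K. non_terminating \<beta> \<and> H \<subseteq> \<beta>" by auto
  next
    fix T assume a: "\<alpha> \<in> ultrafilters K \<and>
        (\<forall>H. finite H \<and> H \<subseteq> \<alpha> \<longrightarrow> (\<exists>\<beta>\<in>roller_boundary K. non_terminating \<beta> \<and> H \<subseteq> \<beta>))"
      and T: "\<alpha> \<in> T \<and> openin ?T T"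
    then obtain H where H: "finite H \<and> H \<subseteq> \<alpha>" "{\<beta> \<in> ultrafilters K. H \<subseteq> \<beta>} \<subseteq> T"
      using ultrafilter_nbhd[of K T \<alpha>]
      unfolding ultrafilter_topology_def openin_topology_generated_by_iff by auto
    obtain \<beta> where "\<beta> \<in> roller_boundary K" "non_terminating \<beta>" "H \<subseteq> \<beta>"
      using mp[OF spec[OF conjunct2[OF a]] H(1)] by (elim bexE conjE)
    then show "\<exists>y. y \<in> ?S \<and> y \<in> T" using H(2) by (intro exI[of _ \<beta>]) (auto simp: roller_boundary_def)
  qed auto
qed

context cube_halfspaces
begin

lemma halfspace_eq_iff: "h \<in> HS \<Longrightarrow> k \<in> HS \<Longrightarrow> halfspace h = halfspace k \<longleftrightarrow> h = k"
  using halfspace_mono_iff[of h k] halfspace_mono_iff[of k h] by auto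

lemma halfspace_strict_iff: "h \<in> HS \<Longrightarrow> k \<in> HS \<Longrightarrow> halfspace h \<subset> halfspace k \<longleftrightarrow> h \<subset> k"
  unfolding psubset_eq by (simp add: halfspace_mono_iff halfspace_eq_iff)

lemma halfspaces_eq: "halfspaces K = halfspace ` HS"
proof -
  have "halfspaces K = (\<Union>h\<in>HS. {halfspace h, halfspace (V - h)})"
    unfolding halfspaces_def hyperplanes_eq by (simp add: halfspaces_of_hyp)
  then show ?thesis using HS_Compl by auto
qed

lemma halfspace_mem: "\<omega> \<subseteq> HS \<Longrightarrow> h \<in> HS \<Longrightarrow> halfspace h \<in> halfspace ` \<omega> \<longleftrightarrow> h \<in> \<omega>"
  using halfspace_eq_iff[of h] by (auto simp: subset_eq)

lemma HS_proper: assumes "h \<in> HS" shows "V - h \<noteq> h"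
proof -
  obtain a where "a \<in> h" using dual_edge[OF assms] by blast
  then show ?thesis by blast
qed

lemma ultra_orient:
  assumes "\<alpha> \<subseteq> halfspaces K" "h \<in> HS"
  shows "(\<exists>!x. x \<in> halfspaces_of K (hyp h) \<and> x \<in> \<alpha>) \<longleftrightarrow> (halfspace h \<in> \<alpha>) \<noteq> (halfspace (V - h) \<in> \<alpha>)"
proof -
  have "halfspace h \<noteq> halfspace (V - h)"
    using halfspace_eq_iff[OF assms(2) HS_Compl[OF assms(2)]] HS_proper[OF assms(2)] by simp
  then show ?thesis unfolding halfspaces_of_hyp[OF assms(2)] by auto
qed

lemma ultrafilters_image:
  assumes "\<omega> \<subseteq> HS" shows "halfspace ` \<omega> \<in> ultrafilters K \<longleftrightarrow> ultra V HS \<omega>"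
proof -
  let ?\<alpha> = "halfspace ` \<omega>"
  have sub: "?\<alpha> \<subseteq> halfspaces K" using assms halfspaces_eq by auto
  have "(\<forall>J\<in>hyperplanes K. \<exists>!x. x \<in> halfspaces_of K J \<and> x \<in> ?\<alpha>) \<longleftrightarrow> (\<forall>h\<in>HS. (h \<in> \<omega>) \<noteq> (V - h \<in> \<omega>))"
    unfolding hyperplanes_eq ball_simps(9)
    using ultra_orient[OF sub] halfspace_mem[OF assms] HS_Compl by (intro ball_cong[OF HOL.refl]) simp
  moreover have "(\<forall>h\<in>?\<alpha>. \<forall>k\<in>halfspaces K. h \<subseteq> k \<longrightarrow> k \<in> ?\<alpha>) \<longleftrightarrow> (\<forall>h\<in>\<omega>. \<forall>k\<in>HS. h \<subseteq> k \<longrightarrow> k \<in> \<omega>)"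
    unfolding halfspaces_eq ball_simps(9)
    using halfspace_mem[OF assms] halfspace_mono_iff assms
    by (intro ball_cong[OF HOL.refl]) (simp add: subset_eq[of \<omega>])
  ultimately show ?thesis using sub assms unfolding ultrafilters_def ultra_def by simp
qed

text \<open>Mapping each vertex set to its halfspace of the realization preserves and reflects inclusion and respects
  complements, which is all that ultrafilters depend on.\<close>

lemma ultrafilters_eq: "ultrafilters K = (`) halfspace ` {\<omega>. ultra V HS \<omega>}"
proof
  show "ultrafilters K \<subseteq> (`) halfspace ` {\<omega>. ultra V HS \<omega>}"
  proof
    fix \<alpha> assume a: "\<alpha> \<in> ultrafilters K"
    then have "\<alpha> \<subseteq> halfspaces K" by (simp add: ultrafilters_def)
    then obtain \<omega> where w: "\<omega> \<subseteq> HS" "\<alpha> = halfspace ` \<omega>" unfolding halfspaces_eq by (auto simp: subset_image_iff)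
    then have "ultra V HS \<omega>" using a ultrafilters_image[OF w(1)] by simp
    then show "\<alpha> \<in> (`) halfspace ` {\<omega>. ultra V HS \<omega>}" using w(2) by simp
  qed
  show "(`) halfspace ` {\<omega>. ultra V HS \<omega>} \<subseteq> ultrafilters K"
  proof
    fix \<alpha> assume "\<alpha> \<in> (`) halfspace ` {\<omega>. ultra V HS \<omega>}"
    then obtain \<omega> where w: "ultra V HS \<omega>" "\<alpha> = halfspace ` \<omega>" by blast
    then have "\<omega> \<subseteq> HS" by (simp add: ultra_def)
    then show "\<alpha> \<in> ultrafilters K" using ultrafilters_image w by simp
  qed
qed

lemma roller_image:
  assumes "ultra V HS \<omega>" shows "halfspace ` \<omega> \<in> roller_boundary K \<longleftrightarrow> unbounded \<omega>"
proof -
  have sub: "\<omega> \<subseteq> HS" using assms by (simp add: ultra_def)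
  have "halfspace ` \<omega> \<in> ultrafilters K" using ultrafilters_image[OF sub] assms by simp
  then have "halfspace ` \<omega> \<in> roller_boundary K \<longleftrightarrow>
    (\<exists>h::nat \<Rightarrow> _. (\<forall>n. h n \<in> halfspace ` \<omega>) \<and> (\<forall>n. h (Suc n) \<subset> h n))"
    by (simp add: roller_boundary_def)
  also have "\<dots> \<longleftrightarrow> unbounded \<omega>"
  proof
    assume "\<exists>h::nat \<Rightarrow> _. (\<forall>n. h n \<in> halfspace ` \<omega>) \<and> (\<forall>n. h (Suc n) \<subset> h n)"
    then obtain x :: "nat \<Rightarrow> _" where x: "\<And>n. x n \<in> halfspace ` \<omega>" "\<And>n. x (Suc n) \<subset> x n" by auto
    then have "\<forall>n. \<exists>h. h \<in> \<omega> \<and> x n = halfspace h" by blast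
    then obtain h where h: "\<And>n. h n \<in> \<omega>" "\<And>n. x n = halfspace (h n)" by metis
    have "h (Suc n) \<subset> h n" for n
      using x(2)[of n] halfspace_strict_iff h sub by (metis subsetD)
    then show "unbounded \<omega>" unfolding unbounded_def using h(1) by (intro exI[of _ h]) simp
  next
    assume "unbounded \<omega>"
    then obtain h where "\<forall>n. h n \<in> \<omega> \<and> h (Suc n) \<subset> h n" unfolding unbounded_def by (elim exE)
    then have "(\<forall>n. halfspace (h n) \<in> halfspace ` \<omega>) \<and> (\<forall>n. halfspace (h (Suc n)) \<subset> halfspace (h n))"
      using halfspace_strict_iff sub by (simp add: subset_eq)
    then show "\<exists>h::nat \<Rightarrow> _. (\<forall>n. h n \<in> halfspace ` \<omega>) \<and> (\<forall>n. h (Suc n) \<subset> h n)"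
      by (rule exI[of _ "\<lambda>n. halfspace (h n)"])
  qed
  finally show ?thesis .
qed

lemma non_terminating_image:
  assumes "\<omega> \<subseteq> HS" shows "non_terminating (halfspace ` \<omega>) \<longleftrightarrow> bottomless \<omega>"
  unfolding non_terminating_def bottomless_def
  using halfspace_strict_iff assms by (simp add: subset_eq)

theorem B_boundary_eq_iff: "B_boundary K = roller_boundary K \<longleftrightarrow> bottomless_dense V HS"
proof -
  have sub: "\<omega> \<subseteq> HS" if "ultra V HS \<omega>" for \<omega> using that by (simp add: ultra_def)
  have B: "halfspace ` \<omega> \<in> B_boundary K \<longleftrightarrow>
    (\<forall>H. finite H \<and> H \<subseteq> \<omega> \<longrightarrow> (\<exists>\<beta>. ultra V HS \<beta> \<and> unbounded \<beta> \<and> bottomless \<beta> \<and> H \<subseteq> \<beta>))"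
    if w: "ultra V HS \<omega>" for \<omega>
  proof -
    have uf: "halfspace ` \<omega> \<in> ultrafilters K" using ultrafilters_image[OF sub[OF w]] w by simp
    have ex: "(\<exists>\<beta>'\<in>roller_boundary K. non_terminating \<beta>' \<and> halfspace ` H \<subseteq> \<beta>') \<longleftrightarrow>
      (\<exists>\<beta>. ultra V HS \<beta> \<and> unbounded \<beta> \<and> bottomless \<beta> \<and> H \<subseteq> \<beta>)" if "H \<subseteq> \<omega>" for H
    proof
      have HHS: "H \<subseteq> HS" using that sub[OF w] by simp
      have Hsub: "halfspace ` H \<subseteq> halfspace ` \<beta> \<longleftrightarrow> H \<subseteq> \<beta>" if "\<beta> \<subseteq> HS" for \<beta>
        using halfspace_mem[OF that] HHS by (auto simp: subset_eq image_subset_iff)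
      show "\<exists>\<beta>. ultra V HS \<beta> \<and> unbounded \<beta> \<and> bottomless \<beta> \<and> H \<subseteq> \<beta>"
        if ex: "\<exists>\<beta>'\<in>roller_boundary K. non_terminating \<beta>' \<and> halfspace ` H \<subseteq> \<beta>'"
      proof -
        obtain \<beta>' where b: "\<beta>' \<in> roller_boundary K" "non_terminating \<beta>'" "halfspace ` H \<subseteq> \<beta>'" using ex by (elim bexE conjE)
        then have "\<beta>' \<in> ultrafilters K" by (simp add: roller_boundary_def)
        then obtain \<beta> where "ultra V HS \<beta>" "\<beta>' = halfspace ` \<beta>" unfolding ultrafilters_eq by (elim imageE CollectE)
        then show ?thesis using b roller_image non_terminating_image[OF sub] Hsub[OF sub] by (intro exI[of _ \<beta>]) simp
      qed
      show "\<exists>\<beta>'\<in>roller_boundary K. non_terminating \<beta>' \<and> halfspace ` H \<subseteq> \<beta>'"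
        if ex: "\<exists>\<beta>. ultra V HS \<beta> \<and> unbounded \<beta> \<and> bottomless \<beta> \<and> H \<subseteq> \<beta>"
      proof -
        obtain \<beta> where "ultra V HS \<beta>" "unbounded \<beta>" "bottomless \<beta>" "H \<subseteq> \<beta>" using ex by (elim exE conjE)
        then show ?thesis using roller_image non_terminating_image[OF sub] Hsub[OF sub]
          by (intro bexI[of _ "halfspace ` \<beta>"]) simp_all
      qed
    qed
    have "(\<forall>H'. finite H' \<and> H' \<subseteq> halfspace ` \<omega> \<longrightarrow> (\<exists>\<beta>\<in>roller_boundary K. non_terminating \<beta> \<and> H' \<subseteq> \<beta>)) \<longleftrightarrow>
      (\<forall>H. finite H \<and> H \<subseteq> \<omega> \<longrightarrow> (\<exists>\<beta>\<in>roller_boundary K. non_terminating \<beta> \<and> halfspace ` H \<subseteq> \<beta>))"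
    proof (intro iffI allI impI)
      fix H assume "\<forall>H'. finite H' \<and> H' \<subseteq> halfspace ` \<omega> \<longrightarrow> (\<exists>\<beta>\<in>roller_boundary K. non_terminating \<beta> \<and> H' \<subseteq> \<beta>)"
        and "finite H \<and> H \<subseteq> \<omega>"
      then show "\<exists>\<beta>\<in>roller_boundary K. non_terminating \<beta> \<and> halfspace ` H \<subseteq> \<beta>"
        by (elim allE[of _ "halfspace ` H"]) (simp add: image_mono)
    next
      fix H' assume a: "\<forall>H. finite H \<and> H \<subseteq> \<omega> \<longrightarrow> (\<exists>\<beta>\<in>roller_boundary K. non_terminating \<beta> \<and> halfspace ` H \<subseteq> \<beta>)"
        and "finite H' \<and> H' \<subseteq> halfspace ` \<omega>"
      then obtain H where "H \<subseteq> \<omega>" "finite H" "H' = halfspace ` H" using finite_subset_image by metis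
      then show "\<exists>\<beta>\<in>roller_boundary K. non_terminating \<beta> \<and> H' \<subseteq> \<beta>" using a by simp
    qed
    then show ?thesis unfolding B_boundary_iff using uf ex by simp
  qed
  have sub2: "B_boundary K \<subseteq> ultrafilters K" "roller_boundary K \<subseteq> ultrafilters K"
    by (auto simp: B_boundary_iff roller_boundary_def)
  have "B_boundary K = roller_boundary K \<longleftrightarrow> (\<forall>\<alpha>\<in>ultrafilters K. \<alpha> \<in> B_boundary K \<longleftrightarrow> \<alpha> \<in> roller_boundary K)"
    using sub2 by blast
  also have "\<dots> \<longleftrightarrow> (\<forall>\<omega>. ultra V HS \<omega> \<longrightarrow> (halfspace ` \<omega> \<in> B_boundary K \<longleftrightarrow> halfspace ` \<omega> \<in> roller_boundary K))"
    unfolding ultrafilters_eq by simp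
  also have "\<dots> \<longleftrightarrow> bottomless_dense V HS"
    unfolding bottomless_dense_def using B roller_image by (simp add: eq_commute)
  finally show ?thesis .
qed

end

section \<open>The cube complex of a labelled vertex set\<close>

lemma no_halfspaces_dense: "bottomless_dense V {}"
proof -
  have "\<omega> = {}" if "ultra V {} \<omega>" for \<omega> using that by (simp add: ultra_def)
  moreover have "\<not> unbounded {}" by (simp add: unbounded_def)
  ultimately show ?thesis unfolding bottomless_dense_def by (metis finite.emptyI subset_refl)
qed

context right_angled
begin

text \<open>All products of subsets of \<open>T\<close> applied to \<open>v\<close>; the order of the factors is irrelevant if \<open>T\<close> is a clique.\<close>

definition cube :: "'v \<Rightarrow> 'l set \<Rightarrow> 'v set" where
  "cube v T = {path v ts | ts. distinct ts \<and> set ts \<subseteq> T}"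

definition cubes :: "'v set set" where
  "cubes = {cube v T | v T. v \<in> V \<and> T \<subseteq> L \<and> pairwise adj T}"

lemma cube_in_cubes: "v \<in> V \<Longrightarrow> T \<subseteq> L \<Longrightarrow> pairwise adj T \<Longrightarrow> cube v T \<in> cubes"
  by (auto simp: cubes_def)

lemma cubesE:
  assumes "Q \<in> cubes" obtains v T where "Q = cube v T" "v \<in> V" "T \<subseteq> L" "pairwise adj T"
  using assms unfolding cubes_def by blast

lemma finite_distinct_lists: "T \<subseteq> L \<Longrightarrow> finite {ts. distinct ts \<and> set ts \<subseteq> T}"
proof -
  assume "T \<subseteq> L"
  then have "finite T" using finite_L finite_subset by blast
  then have "finite {ts. set ts \<subseteq> T \<and> distinct ts}" by (rule finite_subset_distinct)
  then show ?thesis by (simp add: conj_commute)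
qed

lemma finite_cube: "T \<subseteq> L \<Longrightarrow> finite (cube v T)"
  using finite_imageI[OF finite_distinct_lists, of T "path v"] unfolding cube_def
  by (simp add: setcompr_eq_image)

lemma cube_V: "v \<in> V \<Longrightarrow> T \<subseteq> L \<Longrightarrow> cube v T \<subseteq> V"
  unfolding cube_def using path_V by (auto simp: in_lists_conv_set subset_iff)

lemma cube_empty: "cube v {} = {v}"
  unfolding cube_def by auto

lemma cube_single: "cube v {x} = {v, step v x}"
proof -
  have "ts = [] \<or> ts = [x]" if "distinct ts" "set ts \<subseteq> {x}" for ts
    using that by (cases ts; cases "tl ts") auto
  then show ?thesis unfolding cube_def by (force intro: exI[of _ "[]"] exI[of _ "[x]"])
qed

lemma Union_cubes: "\<Union> cubes = V"
proof
  show "\<Union> cubes \<subseteq> V" using cube_V unfolding cubes_def by auto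
  show "V \<subseteq> \<Union> cubes"
  proof
    fix v assume "v \<in> V"
    then have "{v} \<in> cubes" using cube_in_cubes[of v "{}"] by (simp add: cube_empty)
    then show "v \<in> \<Union> cubes" by blast
  qed
qed

lemma step_inject: "v \<in> V \<Longrightarrow> x \<in> L \<Longrightarrow> y \<in> L \<Longrightarrow> step v x = step v y \<Longrightarrow> x = y"
  using sep_step[of v x "wall v x"] sep_step[of v y "wall v x"] wall_label by metis

lemma edges_cubes: "{a, b} \<in> edges cubes \<longleftrightarrow> a \<in> V \<and> (\<exists>x\<in>L. b = step a x)"
proof
  assume e: "{a, b} \<in> edges cubes"
  then obtain v T where T: "{a, b} = cube v T" "v \<in> V" "T \<subseteq> L" "pairwise adj T"
    unfolding edges_def by (auto elim: cubesE)
  have card: "card (cube v T) = 2" using e T(1) by (simp add: edges_def)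
  have "x = y" if xy: "x \<in> T" "y \<in> T" for x y
  proof (rule ccontr)
    assume "x \<noteq> y"
    have L: "x \<in> L" "y \<in> L" using xy T(3) by blast+
    have "path v ts \<in> cube v T" if "distinct ts" "set ts \<subseteq> T" for ts
      unfolding cube_def using that by blast
    from this[of "[]"] this[of "[x]"] this[of "[y]"] xy have sub: "{v, step v x, step v y} \<subseteq> cube v T" by simp
    have "step v x \<noteq> v" "step v y \<noteq> v" "step v x \<noteq> step v y"
      using step_neq[OF T(2)] step_inject[OF T(2)] L \<open>x \<noteq> y\<close> by blast+
    then have "card {v, step v x, step v y} = 3" by simp
    then show False using card_mono[OF finite_cube[OF T(3)] sub] card by simp
  qed
  moreover have "T \<noteq> {}" using card by (auto simp: cube_empty)
  ultimately obtain x where x: "T = {x}" by blast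
  then have "{a, b} = {v, step v x}" "x \<in> L" using T cube_single by auto
  then show "a \<in> V \<and> (\<exists>x\<in>L. b = step a x)"
    using T(2) step_V[OF T(2)] step_step[OF T(2), of x] by (auto simp: doubleton_eq_iff intro!: bexI[of _ x])
next
  assume "a \<in> V \<and> (\<exists>x\<in>L. b = step a x)"
  then obtain x where x: "a \<in> V" "x \<in> L" "b = step a x" by blast
  then have "{a, b} \<in> cubes" using cube_in_cubes[of a "{x}"] by (simp add: cube_single)
  moreover have "a \<noteq> b" using step_neq[OF x(1,2)] x(3) by simp
  ultimately show "{a, b} \<in> edges cubes" by (simp add: edges_def)
qed

text \<open>The relations preserve the parity of the length of a word, so there are no edges between vertices at even distance.\<close>

lemma edge_parity:
  assumes "a \<in> V" "w \<in> lists L" "even (length w)" shows "{a, path a w} \<notin> edges cubes"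
proof
  assume "{a, path a w} \<in> edges cubes"
  then obtain x where "x \<in> L" "path a w = path a [x]" unfolding edges_cubes by auto
  then have "even (length w) = even (length [x])"
    using same_end_parity(2)[OF assms(1,2), of "[x]"] by simp
  then show False using assms(3) by simp
qed

definition square :: "'v \<Rightarrow> 'l \<Rightarrow> 'l \<Rightarrow> nat set \<Rightarrow> 'v" where
  "square v x y A = path v ((if 0 \<in> A then [x] else []) @ (if 1 \<in> A then [y] else []))"

lemma square_chart:
  assumes v: "v \<in> V" and xy: "adj x y" shows "cube_chart cubes 2 (square v x y)"
proof -
  have L: "x \<in> L" "y \<in> L" "x \<noteq> y" using xy adj_L adj_sym adj_irrefl by blast+
  have P: "Pow {..<2::nat} = {{}, {0}, {1}, {0, 1}}" 
    by (auto simp: lessThan_nat_numeral lessThan_Suc numeral_2_eq_2 Pow_insert)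
  let ?x = "step v x" and ?y = "step v y" and ?xy = "step (step v x) y"
  have vals: "square v x y {} = v" "square v x y {0} = ?x" "square v x y {1} = ?y" "square v x y {0, 1} = ?xy"
    by (simp_all add: square_def)
  have V: "?x \<in> V" "?y \<in> V" "?xy \<in> V" using step_V v L by auto
  have comm: "step ?y x = ?xy" using step_commute[OF v xy] by simp
  have wne: "wall v x \<noteq> wall q y" for q using wall_label L by blast
  have sep: "sep (wall v x) v ?x" "sep (wall v x) ?x v" "\<not> sep (wall v x) v ?y" "\<not> sep (wall v x) ?x ?xy" "sep (wall v x) v ?xy"
    using sep_step[OF v L(1)] sep_step[OF v L(2)] sep_step[OF V(1) L(2)] sep_sym[OF v V(1)] wne 
      sep_trans[OF v V(1,3)] by auto
  have ne: "v \<noteq> ?x" "v \<noteq> ?y" "v \<noteq> ?xy" "?x \<noteq> ?y" "?x \<noteq> ?xy" "?y \<noteq> ?xy"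
    using step_neq[OF v L(1)] step_neq[OF v L(2)] step_neq[OF V(1) L(2)] step_neq[OF V(2) L(1)]
      sep sep_refl[OF v] comm by metis+
  have "cube v {x, y} = {v, ?x, ?y, ?xy}"
  proof -
    have "ts \<in> {[], [x], [y], [x, y], [y, x]}" if ts: "distinct ts" "set ts \<subseteq> {x, y}" for ts
    proof -
      have "length ts = card (set ts)" using ts(1) by (simp add: distinct_card)
      also have "\<dots> \<le> card {x, y}" using ts(2) by (intro card_mono) auto
      finally have len: "length ts \<le> 2" using L(3) by simp
      show ?thesis
      proof (cases ts)
        case (Cons s ts')
        then show ?thesis using ts len by (cases ts') auto
      qed simp
    qed
    then have "{ts. distinct ts \<and> set ts \<subseteq> {x, y}} = {[], [x], [y], [x, y], [y, x]}" using L(3) by auto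
    then have "cube v {x, y} = path v ` {[], [x], [y], [x, y], [y, x]}"
      unfolding cube_def by (simp add: setcompr_eq_image)
    then show ?thesis using comm by auto
  qed
  moreover have "cube v {x, y} \<in> cubes"
    using v L xy adj_sym by (intro cube_in_cubes) (auto simp: pairwise_def)
  ultimately have K: "square v x y ` Pow {..<2} \<in> cubes" unfolding P
    by (simp only: image_insert image_empty vals)
  have inj: "inj_on (square v x y) (Pow {..<2})" unfolding P inj_on_def using ne vals by auto
  have e: "{v, ?x} \<in> edges cubes" "{v, ?y} \<in> edges cubes" "{?x, ?xy} \<in> edges cubes" "{?y, ?xy} \<in> edges cubes"
    unfolding edges_cubes using v V L comm[symmetric] by blast+
  have ve: "?y = path ?x [x, y]" using step_step[OF v L(1)] by simp
  have n: "{v, ?xy} \<notin> edges cubes" "{?x, ?y} \<notin> edges cubes" "{q} \<notin> edges cubes" for q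
    using edge_parity[OF v, of "[x, y]"] edge_parity[OF V(1), of "[x, y]"] ve L by (auto simp: edges_def)
  have "\<forall>A\<in>Pow {..<2}. \<forall>B\<in>Pow {..<2}.
    {square v x y A, square v x y B} \<in> edges cubes \<longleftrightarrow> card ((A - B) \<union> (B - A)) = 1"
    unfolding P using e n by (auto simp: vals vals[unfolded One_nat_def] insert_commute insert_Diff_if)
  then show ?thesis unfolding cube_chart_def using K inj by simp
qed

lemma convex_edges:
  assumes "w \<in> lists L" "a \<in> V" "\<And>w1 w2. w = w1 @ w2 \<Longrightarrow> path a w1 \<in> h"
  shows "(a, path a w) \<in> {(p, q). p \<in> h \<and> q \<in> h \<and> {p, q} \<in> edges cubes}\<^sup>*"
  using assms(1,3)
proof (induction w rule: rev_induct)
  case (snoc y w)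
  have "path a w \<in> h" "path a (w @ [y]) \<in> h" using snoc.prems(2) by (metis append_assoc, metis append_Nil2)
  moreover have "{path a w, path a (w @ [y])} \<in> edges cubes"
    unfolding edges_cubes using path_V[OF assms(2), of w] snoc.prems(1) by auto
  moreover have "(a, path a w) \<in> {(p, q). p \<in> h \<and> q \<in> h \<and> {p, q} \<in> edges cubes}\<^sup>*"
    using snoc.IH snoc.prems by (metis append_assoc append_in_lists_conv)
  ultimately show ?case by (simp add: rtrancl.rtrancl_into_rtrancl)
qed simp

lemma first_edge:
  assumes "b \<in> V" "x # w \<in> lists L" "distinct (walls b (x # w))"
  shows "path b (x # w) \<in> far b x"
proof -
  have "count_list (walls b (x # w)) (wall b x) = 1" by (rule count_list_distinct[OF assms(3)]) simp
  then have "sep (wall b x) b (path b (x # w))" using sep_path[OF assms(1,2)] by simp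
  then show ?thesis using path_V[OF assms(1,2)] by (simp add: far_def)
qed

text \<open>A shortest path with at least two edges crosses at least two walls, and both separate its ends.\<close>

lemma edge_iff_one_halfspace:
  assumes "a \<in> V" "b \<in> V"
  shows "{a, b} \<in> edges cubes \<longleftrightarrow> (\<exists>!h. h \<in> HS \<and> a \<in> h \<and> b \<notin> h)"
proof
  assume "{a, b} \<in> edges cubes"
  then obtain x where x: "x \<in> L" "b = step a x" unfolding edges_cubes by blast
  show "\<exists>!h. h \<in> HS \<and> a \<in> h \<and> b \<notin> h"
  proof (rule ex1I[of _ "V - far a x"])
    show "V - far a x \<in> HS \<and> a \<in> V - far a x \<and> b \<notin> V - far a x"
      using HS_compl far_in_HS not_in_far step_in_far assms x by blast
    fix h assume h: "h \<in> HS \<and> a \<in> h \<and> b \<notin> h"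
    then have "V - h = far a x" using leave[of h a x] assms x by simp
    moreover have "h \<subseteq> V" using h HS_sub by blast
    ultimately show "h = V - far a x" by blast
  qed
next
  assume ex: "\<exists>!h. h \<in> HS \<and> a \<in> h \<and> b \<notin> h"
  obtain s where "s \<in> lists L" "a = path b s" using connect[OF assms(2,1)] by blast
  then obtain w where w: "w \<in> lists L" "a = path b w" "distinct (walls b w)" 
    using geodesic[OF assms(2)] by metis
  show "{a, b} \<in> edges cubes"
  proof (cases w)
    case Nil
    then show ?thesis using w ex by auto
  next
    case (Cons x w')
    have x: "x \<in> L" "step b x \<in> V" using w Cons step_V assms by auto
    have 1: "far b x \<in> HS" "a \<in> far b x" "b \<notin> far b x"
      using far_in_HS not_in_far first_edge[of b x w'] assms w Cons x by auto
    show ?thesis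
    proof (cases w')
      case Nil
      then have "{b, a} \<in> edges cubes" unfolding edges_cubes using w Cons x assms by auto
      then show ?thesis by (simp add: insert_commute)
    next
      case (Cons y w'')
      have y: "y \<in> L" using w(1) \<open>w = x # w'\<close> Cons by simp
      have d: "distinct (walls (step b x) w')" "wall b x \<noteq> wall (step b x) y"
        using w(3) \<open>w = x # w'\<close> Cons by auto
      have "path (step b x) w' \<in> far (step b x) y"
        using first_edge[of "step b x" y w''] x d(1) w(1) \<open>w = x # w'\<close> Cons by auto
      then have "a \<in> far (step b x) y" using w \<open>w = x # w'\<close> by simp
      moreover have "b \<notin> far (step b x) y"
        using crossing_wall(1)[OF x(2) assms(2) x(1), of y] not_in_far[OF x(2), of y] d(2) by metis
      ultimately have "far b x = far (step b x) y" using ex 1 far_in_HS[OF x(2) y] by blast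
      then show ?thesis using step_in_far[OF assms(2) x(1)] not_in_far[OF x(2)] by blast
    qed
  qed
qed

lemma separated_halfspace:
  assumes "a \<in> V" "b \<in> V" "a \<noteq> b" shows "\<exists>h\<in>HS. a \<in> h \<and> b \<notin> h"
proof -
  obtain s where "s \<in> lists L" "a = path b s" using connect[OF assms(2,1)] by blast
  then obtain w where w: "w \<in> lists L" "a = path b w" "distinct (walls b w)" 
    using geodesic[OF assms(2)] by metis
  then obtain x w' where "w = x # w'" using assms(3) by (cases w) auto
  then show ?thesis using w first_edge[of b x w'] not_in_far far_in_HS assms by auto
qed

text \<open>Labels adjacent to \<open>x\<close> commute with it, so all occurrences of \<open>x\<close> can be collected at the end, where they
  cancel in pairs.\<close>

lemma star_word:
  assumes "b \<in> V" "x \<in> L" "s \<in> lists (star x)"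
  shows "\<exists>s'\<in>lists {y. adj x y}. path b s = path b s' \<or> path b s = step (path b s') x"
  using assms(3)
proof (induction s rule: rev_induct)
  case Nil
  show ?case by (rule bexI[of _ "[]"]) simp_all
next
  case (snoc y s)
  then obtain s' where s': "s' \<in> lists {y. adj x y}" "path b s = path b s' \<or> path b s = step (path b s') x" by auto
  have p: "path b s' \<in> V"
  proof (rule path_V[OF assms(1)])
    show "s' \<in> lists L" using s'(1) star_L[OF assms(2)] by (auto simp: star_def)
  qed
  have y: "y = x \<or> adj x y" using snoc.prems by (auto simp: star_def)
  show ?case
  proof (cases "y = x")
    case True
    then show ?thesis using s' step_step[OF p assms(2)] by (intro bexI[of _ s']) auto
  next
    case False
    then have a: "adj x y" using y by blast
    then show ?thesis using s' step_commute[OF p a] by (intro bexI[of _ "s' @ [y]"]) auto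
  qed
qed

text \<open>Two edges of one wall are joined by labels adjacent to the label of the wall, and each of these labels spans a
  square with it.\<close>

lemma parallel_edges:
  assumes h: "h \<in> HS" and a: "a \<in> h" "b \<in> V - h" "{a, b} \<in> edges cubes"
    and a': "a' \<in> h" "b' \<in> V - h" "{a', b'} \<in> edges cubes"
  shows "((a, b), (a', b')) \<in> {((a, b), (a', b')). {a, a'} \<subseteq> h \<and> {b, b'} \<subseteq> V - h \<and>
        (\<exists>c. cube_chart cubes 2 c \<and> c {} = a \<and> c {0} = b \<and> c {1} = a' \<and> c {0, 1} = b')}\<^sup>*"
    (is "_ \<in> ?R\<^sup>*")
proof -
  obtain x where x: "x \<in> L" "a = step b x" using a(3) edges_cubes[of b a] by (auto simp: insert_commute)
  obtain x' where x': "x' \<in> L" "a' = step b' x'" using a'(3) edges_cubes[of b' a'] by (auto simp: insert_commute)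
  have bV: "b \<in> V" "b' \<in> V" "b \<notin> h" "b' \<notin> h" using a(2) a'(2) by auto
  have hx: "h = far b x" using far_eqI[OF h bV(1) x(1) bV(3)] a(1) x(2) by simp
  have w: "wall b x = wall b' x'" "x = x'"
    using crossing_wall[OF bV(1,2) x'(1), of x] hx bV(4) a'(1) x'(2) by auto
  obtain s where s: "s \<in> lists (star x)" "b' = path b s" using wall_eqD[OF w(1)] .
  obtain s' where s': "s' \<in> lists {y. adj x y}" "b' = path b s' \<or> b' = step (path b s') x"
    using star_word[OF bV(1) x(1) s(1)] s(2) by auto
  have run: "path b t \<in> V - h \<and> step (path b t) x \<in> h \<and> ((a, b), (step (path b t) x, path b t)) \<in> ?R\<^sup>*"
    if "t \<in> lists {y. adj x y}" for t
    using that
  proof (induction t rule: rev_induct)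
    case Nil
    then show ?case using a x by simp
  next
    case (snoc y t)
    let ?p = "path b t"
    have IH: "?p \<in> V - h" "step ?p x \<in> h" "((a, b), (step ?p x, ?p)) \<in> ?R\<^sup>*" using snoc by auto
    have xy: "adj x y" and yL: "y \<in> L" using snoc.prems adj_L adj_sym by auto
    have pV: "?p \<in> V" "step ?p x \<in> V" "step ?p y \<in> V" using IH(1) step_V x yL by auto
    have "x \<noteq> y" using xy adj_irrefl by blast
    then have q: "step ?p y \<notin> h" using crossing_wall(2)[OF bV(1) pV(1) yL, of x] hx IH(1) by auto
    have c: "step (step ?p y) x = step (step ?p x) y" using step_commute[OF pV(1) xy] by simp
    have r: "step (step ?p y) x \<in> h" unfolding c
      using crossing_wall(2)[OF bV(1) pV(2) yL, of x] hx IH(2) \<open>x \<noteq> y\<close> by auto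
    have "((step ?p x, ?p), (step (step ?p y) x, step ?p y)) \<in> ?R"
    proof -
      let ?c = "square (step ?p x) x y"
      have "cube_chart cubes 2 ?c" using square_chart[OF pV(2) xy] .
      moreover have "?c {} = step ?p x" "?c {0} = ?p" "?c {1} = step (step ?p y) x" "?c {0, 1} = step ?p y"
        using step_step[OF pV(1) x(1)] c by (simp_all add: square_def)
      ultimately have "\<exists>c. cube_chart cubes 2 c \<and> c {} = step ?p x \<and> c {0} = ?p \<and> c {1} = step (step ?p y) x
        \<and> c {0, 1} = step ?p y" by blast
      then show ?thesis using IH(1,2) q r pV by simp
    qed
    then show ?case using IH(3) q r pV by (simp add: rtrancl.rtrancl_into_rtrancl)
  qed
  have "b' = path b s'" using s' run[OF s'(1)] bV(4) by auto
  then show ?thesis using run[OF s'(1)] x'(2) w(2) by simp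
qed

lemma cube_halfspaces: "cube_halfspaces cubes HS"
proof
  show "finite Q" if "Q \<in> cubes" for Q using that finite_cube by (auto elim: cubesE)
  show "finite {Q \<in> cubes. v \<in> Q}" for v
  proof (rule finite_subset)
    show "{Q \<in> cubes. v \<in> Q} \<subseteq> (\<lambda>(ts, T). cube (path v (rev ts)) T) ` ({ts. distinct ts \<and> set ts \<subseteq> L} \<times> Pow L)"
    proof
      fix Q assume "Q \<in> {Q \<in> cubes. v \<in> Q}"
      then obtain u T where Q: "Q = cube u T" "u \<in> V" "T \<subseteq> L" "v \<in> cube u T" by (auto elim: cubesE)
      then obtain ts where ts: "v = path u ts" "distinct ts" "set ts \<subseteq> T" unfolding cube_def by blast
      then have "ts \<in> lists L" using Q(3) by auto
      then have "u = path v (rev ts)" using path_rev[OF Q(2)] ts(1) by simp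
      then show "Q \<in> (\<lambda>(ts, T). cube (path v (rev ts)) T) ` ({ts. distinct ts \<and> set ts \<subseteq> L} \<times> Pow L)"
        using Q ts by (intro image_eqI[of _ _ "(ts, T)"]) auto
    qed
    show "finite ((\<lambda>(ts, T). cube (path v (rev ts)) T) ` ({ts. distinct ts \<and> set ts \<subseteq> L} \<times> Pow L))"
      using finite_distinct_lists[OF subset_refl] finite_L by auto
  qed
  show "{v} \<in> cubes" if "v \<in> \<Union> cubes" for v
    using that cube_in_cubes[of v "{}"] by (simp add: cube_empty Union_cubes)
  show "h \<subseteq> \<Union> cubes" "\<Union> cubes - h \<in> HS" if "h \<in> HS" for h
    using that HS_sub HS_compl by (simp_all add: Union_cubes)
  show "{a, b} \<in> edges cubes \<longleftrightarrow> (\<exists>!h. h \<in> HS \<and> a \<in> h \<and> b \<notin> h)" if "a \<in> \<Union> cubes" "b \<in> \<Union> cubes" for a b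
    using edge_iff_one_halfspace that by (simp add: Union_cubes)
  show "\<exists>h\<in>HS. a \<in> h \<and> b \<notin> h" if "a \<in> \<Union> cubes" "b \<in> \<Union> cubes" "a \<noteq> b" for a b
    using separated_halfspace that by (simp add: Union_cubes)
  show "(a, b) \<in> {(p, q). p \<in> h \<and> q \<in> h \<and> {p, q} \<in> edges cubes}\<^sup>*" if h: "h \<in> HS" "a \<in> h" "b \<in> h" for h a b
  proof -
    obtain w where "w \<in> lists L" "path a w = b" "\<And>w1 w2. w = w1 @ w2 \<Longrightarrow> path a w1 \<in> h" using convex[OF h] by metis
    moreover have "a \<in> V" using h HS_sub by blast
    ultimately show ?thesis using convex_edges[of w a h] by simp
  qed
  show "\<exists>a\<in>h. \<exists>b\<in>\<Union> cubes - h. {a, b} \<in> edges cubes" if h: "h \<in> HS" for h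
  proof -
    obtain v x where v: "h = far v x" "v \<in> V" "x \<in> L" using h unfolding HS_def by blast
    then have "{v, step v x} \<in> edges cubes" unfolding edges_cubes by blast
    then have "{step v x, v} \<in> edges cubes" by (simp add: insert_commute)
    then show ?thesis unfolding Union_cubes using v step_in_far not_in_far by blast
  qed
  show "((a, b), a', b') \<in> {((a, b), a', b'). {a, a'} \<subseteq> h \<and> {b, b'} \<subseteq> \<Union> cubes - h \<and>
        (\<exists>c. cube_chart cubes 2 c \<and> c {} = a \<and> c {0} = b \<and> c {1} = a' \<and> c {0, 1} = b')}\<^sup>*"
    if "h \<in> HS" "a \<in> h" "b \<in> \<Union> cubes - h" "{a, b} \<in> edges cubes"
      "a' \<in> h" "b' \<in> \<Union> cubes - h" "{a', b'} \<in> edges cubes" for h a b a' b'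
    using parallel_edges[of h a b a' b'] that unfolding Union_cubes by simp
qed

theorem B_boundary_cubes_iff:
  assumes "apart a a'"
  shows "B_boundary cubes = roller_boundary cubes \<longleftrightarrow> \<not> joined L adj"
  using cube_halfspaces.B_boundary_eq_iff[OF cube_halfspaces] bottomless_dense_iff[OF assms]
  by (simp add: Union_cubes)

lemma B_boundary_no_labels: "L = {} \<Longrightarrow> B_boundary cubes = roller_boundary cubes"
proof -
  assume "L = {}"
  then have "HS = {}" unfolding HS_def by blast
  then show ?thesis
    using cube_halfspaces.B_boundary_eq_iff[OF cube_halfspaces] no_halfspaces_dense[of "\<Union> cubes"] by simp
qed

end

section \<open>Centralizers and direct products\<close>

text \<open>The vertices are the elements of a group, acting on itself from the left. Left multiplication respects the
  structure up to a permutation \<open>relabel u\<close> of the labels: it is trivial for Coxeter groups, but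
  multiplication by a generator of an Artin group exchanges the two labels of this generator. A walk done twice restores
  the parities, whence \<open>relabel_square\<close>.\<close>

locale right_angled_group = group G + right_angled L adj "carrier G" step "\<one>"
  for G :: "'g monoid" (structure) and L :: "'l set" and adj and step :: "'g \<Rightarrow> 'l \<Rightarrow> 'g" +
  fixes relabel :: "'g \<Rightarrow> 'l \<Rightarrow> 'l"
  assumes relabel_L: "u \<in> carrier G \<Longrightarrow> x \<in> L \<Longrightarrow> relabel u x \<in> L"
    and relabel_adj: "u \<in> carrier G \<Longrightarrow> adj x y \<Longrightarrow> adj (relabel u x) (relabel u y)"
    and mult_step: "u \<in> carrier G \<Longrightarrow> v \<in> carrier G \<Longrightarrow> x \<in> L \<Longrightarrow>
      u \<otimes> step v x = step (u \<otimes> v) (relabel u x)"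
    and relabel_square: "w \<in> lists L \<Longrightarrow> x \<in> L \<Longrightarrow> relabel (foldl step \<one> (w @ w)) x = x"
begin

lemma mult_path:
  "u \<in> carrier G \<Longrightarrow> v \<in> carrier G \<Longrightarrow> w \<in> lists L \<Longrightarrow> u \<otimes> path v w = path (u \<otimes> v) (map (relabel u) w)"
  by (induction w arbitrary: v) (auto simp: mult_step step_V)

lemma relabel_list: "u \<in> carrier G \<Longrightarrow> w \<in> lists L \<Longrightarrow> map (relabel u) w \<in> lists L"
  using relabel_L by auto

lemma inv_mult_mult: "u \<in> carrier G \<Longrightarrow> v \<in> carrier G \<Longrightarrow> inv u \<otimes> (u \<otimes> v) = v"
  by (simp add: m_assoc[symmetric])

lemma relabel_inv:
  assumes "u \<in> carrier G" "x \<in> L" shows "relabel (inv u) (relabel u x) = x"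
proof -
  have "step \<one> x = inv u \<otimes> (u \<otimes> step \<one> x)" using assms by (simp add: inv_mult_mult step_V)
  also have "\<dots> = step (inv u \<otimes> (u \<otimes> \<one>)) (relabel (inv u) (relabel u x))"
    using assms relabel_L by (simp add: mult_step)
  finally have "step \<one> x = step \<one> (relabel (inv u) (relabel u x))" using assms by simp
  then show ?thesis using step_inject[OF one_closed _ assms(2)] relabel_L assms by (metis inv_closed)
qed

text \<open>Left multiplication maps squares to squares, so it maps opposite edges to opposite edges.\<close>

lemma mult_wall:
  assumes "u \<in> carrier G" "v \<in> carrier G" "x \<in> L" "wall v x = wall v' y"
  shows "wall (u \<otimes> v) (relabel u x) = wall (u \<otimes> v') (relabel u y)"
proof -
  have xy: "x = y" using wall_label assms(4) by blast
  obtain w where w: "w \<in> lists (star x)" "v' = path v w" using wall_eqD[OF assms(4)] .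
  have wL: "w \<in> lists L" using w star_L[OF assms(3)] by auto
  have "map (relabel u) w \<in> lists (star (relabel u x))"
    using w(1) relabel_adj[OF assms(1)] by (fastforce simp: star_def)
  then have "wall (path (u \<otimes> v) (map (relabel u) w)) (relabel u x) = wall (u \<otimes> v) (relabel u x)"
    using wall_path relabel_L assms by simp
  then show ?thesis using mult_path[OF assms(1,2) wL] w(2) xy by simp
qed

lemma mult_wall_iff:
  assumes "u \<in> carrier G" "v \<in> carrier G" "v' \<in> carrier G" "x \<in> L" "y \<in> L"
  shows "wall (u \<otimes> v) (relabel u x) = wall (u \<otimes> v') (relabel u y) \<longleftrightarrow> wall v x = wall v' y"
proof
  assume "wall (u \<otimes> v) (relabel u x) = wall (u \<otimes> v') (relabel u y)"
  then have "wall (inv u \<otimes> (u \<otimes> v)) (relabel (inv u) (relabel u x))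
    = wall (inv u \<otimes> (u \<otimes> v')) (relabel (inv u) (relabel u y))"
    by (rule mult_wall[OF inv_closed[OF assms(1)] m_closed[OF assms(1,2)] relabel_L[OF assms(1,4)]])
  then show "wall v x = wall v' y" using assms by (simp add: inv_mult_mult relabel_inv)
qed (use mult_wall assms in blast)

lemma mult_count:
  assumes "u \<in> carrier G" "v \<in> carrier G" "p \<in> carrier G" "x \<in> L" "w \<in> lists L"
  shows "count_list (walls (u \<otimes> v) (map (relabel u) w)) (wall (u \<otimes> p) (relabel u x))
    = count_list (walls v w) (wall p x)"
  using assms(5,2)
proof (induction w arbitrary: v rule: list.induct)
  case (Cons y w)
  then have y: "y \<in> L" "w \<in> lists L" "step v y \<in> carrier G" using step_V by auto
  have "step (u \<otimes> v) (relabel u y) = u \<otimes> step v y" using mult_step assms(1) Cons.prems(2) y by simp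
  then show ?case
    using Cons.IH[OF y(2,3)] mult_wall_iff[OF assms(1) Cons.prems(2) assms(3) y(1) assms(4)] by simp
qed simp

abbreviation translate :: "'g \<Rightarrow> 'g set \<Rightarrow> 'g set" where
  "translate u A \<equiv> (\<otimes>) u ` A"

lemma mult_inj: "u \<in> carrier G \<Longrightarrow> inj_on ((\<otimes>) u) (carrier G)"
  by (auto simp: inj_on_def)

lemma translate_mono:
  assumes "u \<in> carrier G" "A \<subseteq> carrier G" "B \<subseteq> carrier G"
  shows "translate u A \<subset> translate u B \<longleftrightarrow> A \<subset> B" "translate u A = translate u B \<longleftrightarrow> A = B"
  unfolding psubset_eq
  using inj_on_image_subset_iff[OF mult_inj[OF assms(1)] assms(2,3)]
    inj_on_image_eq_iff[OF mult_inj[OF assms(1)] assms(2,3)] by simp_all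

lemma translate_mult:
  "u \<in> carrier G \<Longrightarrow> v \<in> carrier G \<Longrightarrow> A \<subseteq> carrier G \<Longrightarrow> translate (u \<otimes> v) A = translate u (translate v A)"
  unfolding image_image by (intro image_cong) (auto simp: m_assoc)

lemma translate_one: "A \<subseteq> carrier G \<Longrightarrow> translate \<one> A = A"
  by (force simp: subset_iff)

lemma translate_far:
  assumes "u \<in> carrier G" "p \<in> carrier G" "x \<in> L"
  shows "translate u (far p x) = far (u \<otimes> p) (relabel u x)"
proof -
  have mem: "u \<otimes> a \<in> far (u \<otimes> p) (relabel u x) \<longleftrightarrow> a \<in> far p x" if a: "a \<in> carrier G" for a
  proof -
    obtain w where w: "w \<in> lists L" "a = path p w" using connect[OF assms(2) a] by blast
    have uaG: "u \<otimes> a \<in> carrier G" using assms a by simp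
    moreover have "u \<otimes> a = path (u \<otimes> p) (map (relabel u) w)" using mult_path assms w by simp
    ultimately have "u \<otimes> a \<in> far (u \<otimes> p) (relabel u x) \<longleftrightarrow>
      odd (count_list (walls (u \<otimes> p) (map (relabel u) w)) (wall (u \<otimes> p) (relabel u x)))"
      using sep_path[OF _ relabel_list[OF assms(1) w(1)], of "u \<otimes> p"] assms a by (simp add: far_def)
    also have "\<dots> \<longleftrightarrow> a \<in> far p x"
      using mult_count[OF assms(1,2,2,3) w(1)] sep_path[OF assms(2) w(1)] w(2) a by (simp add: far_def)
    finally show ?thesis .
  qed
  show ?thesis
  proof
    show "translate u (far p x) \<subseteq> far (u \<otimes> p) (relabel u x)"
      using mem by (auto simp: far_def)
    show "far (u \<otimes> p) (relabel u x) \<subseteq> translate u (far p x)"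
    proof
      fix b assume b: "b \<in> far (u \<otimes> p) (relabel u x)"
      then have bG: "b \<in> carrier G" by (simp add: far_def)
      then have eq: "u \<otimes> (inv u \<otimes> b) = b" using assms by (simp add: m_assoc[symmetric])
      then have "inv u \<otimes> b \<in> far p x" using mem[of "inv u \<otimes> b"] b bG assms by simp
      then show "b \<in> translate u (far p x)" using eq by (metis imageI)
    qed
  qed
qed

lemma walls_step_commute:
  assumes "v \<in> carrier G" "x \<in> L" "w \<in> lists {y. adj x y}"
  shows "walls (step v x) w = walls v w"
  using assms(3,1)
proof (induction w arbitrary: v rule: list.induct)
  case (Cons y w)
  then have y: "adj x y" "w \<in> lists {y. adj x y}" by auto
  have yL: "y \<in> L" using adj_L[OF adj_sym[OF y(1)]] .
  have "wall (step v x) y = wall v y" using wall_step_adj[OF Cons.prems(2) adj_sym[OF y(1)]] .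
  moreover have "walls (step (step v y) x) w = walls (step v y) w"
    using Cons.IH[OF y(2)] step_V[OF Cons.prems(2) yL] by simp
  ultimately show ?case using step_commute[OF Cons.prems(2) y(1)] by simp
qed simp

text \<open>The element \<open>u\<close> moves the gates of the ray \<open>z\<close> by \<open>c\<close> places. This is only required for late gates: the ray
  has a starting point, and near it \<open>u\<close> may move gates off the ray.\<close>

definition shifts :: "(nat \<Rightarrow> 'l) \<Rightarrow> 'g \<Rightarrow> int \<Rightarrow> bool" where
  "shifts z u c \<longleftrightarrow> (\<forall>\<^sub>F m in sequentially.
    0 \<le> int m + c \<and> translate u (gate \<one> z m) = gate \<one> z (nat (int m + c)))"

context
  fixes z :: "nat \<Rightarrow> 'l" and k :: nat and g :: 'g
  assumes z: "\<And>n. apart (z n) (z (Suc n))"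
    and often: "\<And>x n. x \<in> L \<Longrightarrow> \<exists>m\<ge>n. z m = x"
    and g: "g \<in> carrier G" and relabel_g: "\<And>x. x \<in> L \<Longrightarrow> relabel g x = x"
    and k: "k > 0" and period: "\<And>n. ray \<one> z (n + k) = g \<otimes> ray \<one> z n"
begin

abbreviation axis :: "nat \<Rightarrow> 'g" where "axis \<equiv> ray \<one> z"
abbreviation gt :: "nat \<Rightarrow> 'g set" where "gt \<equiv> gate \<one> z"

lemma axis_G: "axis n \<in> carrier G"
  using ray_in_V[of \<one> z, OF one_closed z] .

lemma label_L: "z n \<in> L"
  using z unfolding apart_def by blast

lemma gt_HS: "gt n \<in> HS" and gt_G: "gt n \<subseteq> carrier G"
  using gate_HS[of \<one> z, OF one_closed z] HS_sub by blast+

lemma axis_gt: "axis n \<in> gt m \<longleftrightarrow> m < n"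
  using ray_gate[of \<one> z, OF one_closed z] .

lemma gt_less: "gt n \<subset> gt m \<longleftrightarrow> m < n"
proof
  have anti: "gt j \<subseteq> gt i" if "i \<le> j" for i j using gate_antimono[of \<one> z, OF one_closed z that] .
  show "m < n" if "gt n \<subset> gt m" using anti[of n m] that by (meson leI less_le_not_le)
  show "gt n \<subset> gt m" if "m < n"
    using anti[of "Suc m" n] gate_Suc[of \<one> z m, OF one_closed z] that by (meson Suc_leI subset_psubset_trans)
qed

lemma gt_inj: "gt m = gt n \<longleftrightarrow> m = n"
  using gt_less by (metis less_irrefl nat_neq_iff psubset_eq)

lemma translate_gt: "u \<in> carrier G \<Longrightarrow> translate u (gt j) = far (u \<otimes> axis j) (relabel u (z j))"
  unfolding gate_def using translate_far axis_G label_L by blast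

text \<open>By periodicity, \<open>u\<close> moves the point \<open>n + k\<close> of the axis exactly as far as the point \<open>n\<close>.\<close>

lemma stays_near_axis:
  assumes u: "u \<in> carrier G" "u \<otimes> g = g \<otimes> u"
  shows "\<exists>C. \<forall>n. \<exists>w\<in>lists L. length w \<le> C \<and> path (u \<otimes> axis n) w = axis n"
proof -
  have "\<forall>i. \<exists>w. w \<in> lists L \<and> axis i = path (u \<otimes> axis i) w"
    using connect axis_G u(1) by (meson m_closed)
  then obtain W where W: "\<And>i. W i \<in> lists L" "\<And>i. axis i = path (u \<otimes> axis i) (W i)" by metis
  define C where "C = Max ((length \<circ> W) ` {..<k})"
  have "\<exists>w\<in>lists L. length w \<le> C \<and> path (u \<otimes> axis n) w = axis n" for n
  proof (induction n rule: less_induct)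
    case (less n)
    show ?case
    proof (cases "n < k")
      case True
      then have "length (W n) \<le> C" unfolding C_def by (intro Max_ge) auto
      then show ?thesis using W[of n] by (intro bexI[of _ "W n"]) auto
    next
      case False
      then obtain m where m: "n = m + k" by (metis add.commute le_Suc_ex linorder_not_less)
      then obtain w where w: "w \<in> lists L" "length w \<le> C" "path (u \<otimes> axis m) w = axis m"
        using less[of m] k by auto
      have "map (relabel g) w = w" using w(1) relabel_g by (intro map_idI) auto
      then have "g \<otimes> path (u \<otimes> axis m) w = path (g \<otimes> (u \<otimes> axis m)) w"
        using mult_path[OF g _ w(1), of "u \<otimes> axis m"] u axis_G by simp
      moreover have "g \<otimes> (u \<otimes> axis m) = u \<otimes> (g \<otimes> axis m)"
        using u g axis_G by (simp add: m_assoc[symmetric])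
      ultimately have "path (u \<otimes> axis n) w = axis n" using w(3) m period by simp
      then show ?thesis using w by blast
    qed
  qed
  then show ?thesis by blast
qed

text \<open>A late gate does not contain the start of the translated axis. It contains late points of the translated axis,
  because they are near the axis: if a point near \<open>axis n\<close> were outside \<open>gt m\<close>, it would be separated
  from \<open>axis n\<close> by all the gates between \<open>m\<close> and \<open>n\<close>. So the translated axis crosses this gate.\<close>

lemma gates_translated:
  assumes u: "u \<in> carrier G" "u \<otimes> g = g \<otimes> u"
  shows "\<exists>M. \<forall>m\<ge>M. \<exists>j. gt m = translate u (gt j)"
proof -
  obtain C where C: "\<And>n. \<exists>w\<in>lists L. length w \<le> C \<and> path (u \<otimes> axis n) w = axis n"
    using stays_near_axis[OF u] by blast
  have uG: "u \<otimes> axis n \<in> carrier G" for n using u axis_G by simp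
  have "\<forall>\<^sub>F m in sequentially. u \<otimes> axis 0 \<notin> gt m"
    using chain_escape[of gt "u \<otimes> axis 0"] gt_HS gt_less uG by blast
  then obtain M where M: "\<And>m. m \<ge> M \<Longrightarrow> u \<otimes> axis 0 \<notin> gt m"
    unfolding eventually_sequentially by blast
  have "\<exists>j. gt m = translate u (gt j)" if m: "m \<ge> M" for m
  proof -
    \<comment> \<open>More than \<open>C\<close> gates lie between \<open>m\<close> and \<open>n\<close>, too many for the distance between \<open>axis n\<close> and its translate.\<close>
    define n where "n = m + C + 1"
    have "u \<otimes> axis n \<in> gt m"
    proof (rule ccontr)
      assume out: "u \<otimes> axis n \<notin> gt m"
      obtain w where w: "w \<in> lists L" "length w \<le> C" "path (u \<otimes> axis n) w = axis n" using C by blast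
      let ?S = "{h \<in> HS. u \<otimes> axis n \<notin> h \<and> path (u \<otimes> axis n) w \<in> h}"
      have "gt j \<in> ?S" if "j \<in> {m..<n}" for j
      proof -
        have "gt j \<subseteq> gt m" using gt_less[of j m] that by (cases "j = m") auto
        then show ?thesis using out gt_HS axis_gt that w(3) by auto
      qed
      then have sub: "gt ` {m..<n} \<subseteq> ?S" by blast
      have "card (gt ` {m..<n}) = C + 1"
        using gt_inj by (subst card_image) (auto simp: inj_on_def n_def)
      then show False
        using card_mono[OF finite_sep(1)[OF uG w(1)] sub] finite_sep(2)[OF uG w(1), of n] w(2) by simp
    qed
    moreover have "u \<otimes> axis i \<notin> gt m" if "\<And>j. u \<otimes> axis j \<notin> gt m \<Longrightarrow> u \<otimes> axis (Suc j) \<notin> gt m" for i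
      by (induction i) (use M[OF m] that in blast)+
    ultimately obtain j where j: "u \<otimes> axis j \<notin> gt m" "u \<otimes> axis (Suc j) \<in> gt m" by blast
    have "u \<otimes> axis (Suc j) = step (u \<otimes> axis j) (relabel u (z j))"
      using mult_step u axis_G label_L by simp
    then have "gt m = far (u \<otimes> axis j) (relabel u (z j))"
      using far_eqI[OF gt_HS uG _ j(1)] j(2) relabel_L[OF u(1) label_L] by simp
    then show ?thesis using translate_gt[OF u(1)] by metis
  qed
  then show ?thesis by blast
qed

text \<open>The translations by \<open>u\<close> and by its inverse map late gates to gates and preserve their order. An
  order-preserving map of the natural numbers that eventually skips no value is eventually a shift.\<close>

lemma shift_exists:
  assumes u: "u \<in> carrier G" "u \<otimes> g = g \<otimes> u"
  shows "\<exists>c. shifts z u c"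
proof -
  have u': "inv u \<in> carrier G" "inv u \<otimes> g = g \<otimes> inv u"
    using u g by (auto simp: inv_solve_left' inv_solve_right' m_assoc) (metis g inv_closed inv_solve_left inv_solve_right m_assoc m_closed)
  obtain M1 where M1: "\<And>m. m \<ge> M1 \<Longrightarrow> \<exists>j. gt m = translate u (gt j)"
    using gates_translated[OF u] by blast
  obtain M2 where M2: "\<And>m. m \<ge> M2 \<Longrightarrow> \<exists>j. gt m = translate (inv u) (gt j)"
    using gates_translated[OF u'] by blast
  have "\<exists>j. translate u (gt m) = gt j" if m: "m \<ge> M2" for m
  proof -
    obtain j where "gt m = translate (inv u) (gt j)" using M2[OF m] by blast
    then have "translate u (gt m) = translate (u \<otimes> inv u) (gt j)"
      using translate_mult[OF u(1) u'(1) gt_G] by simp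
    then show ?thesis using u translate_one[OF gt_G] by auto
  qed
  then obtain f where f: "\<And>m. m \<ge> M2 \<Longrightarrow> translate u (gt m) = gt (f m)" by metis
  have mono: "f m < f (Suc m)" if "m \<ge> M2" for m
    using translate_mono(1)[OF u(1) gt_G gt_G, of "Suc m" m] f[of m] f[of "Suc m"] that gt_less by simp
  have ge: "f (M2 + i) \<ge> i" for i
  proof (induction i)
    case (Suc i)
    then show ?case using mono[of "M2 + i"] by simp
  qed simp
  \<comment> \<open>From here on \<open>f m\<close> is at least \<open>M1\<close>, so that the gates after \<open>gt (f m)\<close> are translates, too.\<close>
  define M where "M = M1 + M2"
  have suc: "f (Suc m) = Suc (f m)" if m: "m \<ge> M" for m
  proof (rule ccontr)
    assume "f (Suc m) \<noteq> Suc (f m)"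
    then have lt: "Suc (f m) < f (Suc m)" using mono[of m] m by (simp add: M_def)
    have "f m \<ge> M1" using ge[of "m - M2"] m by (simp add: M_def)
    then obtain j where j: "gt (Suc (f m)) = translate u (gt j)" using M1[of "Suc (f m)"] by auto
    have fm: "translate u (gt m) = gt (f m)" "translate u (gt (Suc m)) = gt (f (Suc m))"
      using f m by (simp_all add: M_def)
    have "gt j \<subset> gt m"
      using translate_mono(1)[OF u(1) gt_G gt_G, of j m] gt_less[of "Suc (f m)" "f m"] fm(1) j by simp
    moreover have "gt (Suc m) \<subset> gt j"
      using translate_mono(1)[OF u(1) gt_G gt_G, of "Suc m" j] gt_less[of "f (Suc m)" "Suc (f m)"] lt fm(2) j by simp
    ultimately show False unfolding gt_less by simp
  qed
  have fM: "f (M + i) = f M + i" for i by (induction i) (use suc in auto)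
  have "0 \<le> int m + (int (f M) - int M) \<and> translate u (gt m) = gt (nat (int m + (int (f M) - int M)))"
    if m: "m \<ge> M" for m
  proof -
    have "int (f m) = int m + (int (f M) - int M)" using fM[of "m - M"] m by simp
    then show ?thesis using f[of m] m by (metis M_def add_leD2 nat_int of_nat_0_le_iff)
  qed
  then show ?thesis unfolding shifts_def eventually_sequentially by blast
qed

lemma shifts_unique:
  assumes "shifts z u c" "shifts z u d" shows "c = d"
proof -
  obtain m where m: "(0 \<le> int m + c \<and> translate u (gt m) = gt (nat (int m + c))) \<and>
    (0 \<le> int m + d \<and> translate u (gt m) = gt (nat (int m + d)))"
    using eventually_happens'[OF sequentially_bot eventually_conj[OF assms[unfolded shifts_def]]] by (elim exE)
  then have "nat (int m + c) = nat (int m + d)" using gt_inj by metis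
  then show ?thesis using m by (simp add: eq_nat_nat_iff)
qed

lemma shifts_one: "shifts z \<one> 0"
  unfolding shifts_def using translate_one[OF gt_G] by simp

lemma shifts_mult:
  assumes "u \<in> carrier G" "v \<in> carrier G" "shifts z u c" "shifts z v d"
  shows "shifts z (u \<otimes> v) (c + d)"
proof -
  obtain M where M: "\<And>m. m \<ge> M \<Longrightarrow> 0 \<le> int m + c \<and> translate u (gt m) = gt (nat (int m + c))"
    using assms(3) unfolding shifts_def eventually_sequentially by blast
  obtain N where N: "\<And>m. m \<ge> N \<Longrightarrow> 0 \<le> int m + d \<and> translate v (gt m) = gt (nat (int m + d))"
    using assms(4) unfolding shifts_def eventually_sequentially by blast
  have "0 \<le> int m + (c + d) \<and> translate (u \<otimes> v) (gt m) = gt (nat (int m + (c + d)))"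
    \<comment> \<open>The last summand ensures that also \<open>m + d\<close> is at least \<open>M\<close>.\<close>
    if m: "m \<ge> N + M + nat \<bar>d\<bar>" for m
  proof -
    let ?m = "nat (int m + d)"
    have v: "0 \<le> int m + d" "translate v (gt m) = gt ?m" using N[of m] m by auto
    have "?m \<ge> M" using m by linarith
    then have u: "0 \<le> int ?m + c" "translate u (gt ?m) = gt (nat (int ?m + c))" using M[of ?m] by auto
    have eq: "int ?m + c = int m + (c + d)" using v(1) by simp
    have "translate (u \<otimes> v) (gt m) = translate u (gt ?m)"
      using translate_mult[OF assms(1,2) gt_G] v(2) by simp
    then show ?thesis using u unfolding eq by simp
  qed
  then show ?thesis unfolding shifts_def eventually_sequentially by blast
qed

lemma shifts_pow:
  assumes "u \<in> carrier G" "shifts z u c" shows "shifts z (u [^] (n::nat)) (int n * c)"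
proof (induction n)
  case 0
  then show ?case using shifts_one by simp
next
  case (Suc n)
  then have "shifts z (u [^] n \<otimes> u) (int n * c + c)" using shifts_mult assms by simp
  then show ?case by (simp add: algebra_simps)
qed

text \<open>If \<open>u\<close> fixes a gate, then \<open>axis m\<close> and \<open>u \<otimes> axis m\<close> have edges of the same wall on the same side, and so a
  shortest word \<open>w\<close> between them uses only labels adjacent to the label of the gate. Then the same word joins the
  next points \<open>axis (m + 1)\<close> and \<open>u \<otimes> axis (m + 1)\<close>, and so on. Since the axis uses all labels, each label
  in \<open>w\<close> would have to be adjacent to itself.\<close>

lemma shifts_zero:
  assumes u: "u \<in> carrier G" and s: "shifts z u 0" shows "u = \<one>"
proof -
  obtain M where M: "\<And>m. m \<ge> M \<Longrightarrow> translate u (gt m) = gt m"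
    using s unfolding shifts_def eventually_sequentially by auto
  have uG: "u \<otimes> axis n \<in> carrier G" for n using u axis_G by simp
  obtain s where "s \<in> lists L" "u \<otimes> axis M = path (axis M) s" using connect[OF axis_G uG] by blast
  then obtain w where w: "w \<in> lists L" "path (axis M) w = u \<otimes> axis M" "distinct (walls (axis M) w)"
    using geodesic[OF axis_G] by metis
  have main: "path (axis (M + i)) w = u \<otimes> axis (M + i) \<and> distinct (walls (axis (M + i)) w) \<and>
     w \<in> lists {y. adj (z (M + i)) y}" for i
  proof (induction i)
    have *: "w \<in> lists {y. adj (z m) y}" 
      if m: "m \<ge> M" and p: "path (axis m) w = u \<otimes> axis m" and d: "distinct (walls (axis m) w)" for m
    proof -
      have far: "far (u \<otimes> axis m) (relabel u (z m)) = far (axis m) (z m)"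
        using M[OF m] translate_gt[OF u] by (simp add: gate_def)
      have rL: "relabel u (z m) \<in> L" using relabel_L u label_L by blast
      have "u \<otimes> axis m \<notin> far (axis m) (z m)" "step (u \<otimes> axis m) (relabel u (z m)) \<in> far (axis m) (z m)"
        using not_in_far[OF uG] step_in_far[OF uG rL] far by metis+
      then have we: "wall (axis m) (z m) = wall (u \<otimes> axis m) (relabel u (z m))"
        and out: "u \<otimes> axis m \<notin> far (axis m) (z m)"
        using crossing_wall(1)[OF axis_G uG rL] by auto
      obtain t where t: "t \<in> lists (star (z m))" "u \<otimes> axis m = path (axis m) t" using wall_eqD[OF we] .
      have tL: "t \<in> lists L" using t(1) star_L[OF label_L] by auto
      have ws: "set w \<subseteq> star (z m)"
        using distinct_support[OF axis_G w(1) tL _ d] p t by auto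
      have "z m \<notin> set w"
      proof
        assume "z m \<in> set w"
        then obtain w1 w2 where ww: "w = w1 @ z m # w2" by (meson split_list)
        have "wall (path (axis m) w1) (z m) = wall (axis m) (z m)"
          using wall_path[OF axis_G label_L, of w1] ws ww by auto
        then have "wall (axis m) (z m) \<in> set (walls (axis m) w)" using ww by (simp add: walls_append)
        then have "count_list (walls (axis m) w) (wall (axis m) (z m)) = 1"
          using count_list_distinct[OF d] by blast
        then have "sep (wall (axis m) (z m)) (axis m) (u \<otimes> axis m)"
          using sep_path[OF axis_G w(1), of _ m] p by simp
        then show False using out uG by (simp add: far_def)
      qed
      then show ?thesis using ws by (auto simp: star_def)
    qed
    {
      case 0
      then show ?case using w *[of M] by simp
    next
      case (Suc i)
      let ?m = "M + i"
      have lk: "w \<in> lists {y. adj (z ?m) y}" using Suc by blast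
      have "path (axis (Suc ?m)) w = step (path (axis ?m) w) (z ?m)"
        using path_snoc_commute[OF axis_G label_L lk] by simp
      also have "\<dots> = u \<otimes> axis (Suc ?m)"
      proof -
        have "far (u \<otimes> axis ?m) (relabel u (z ?m)) = far (axis ?m) (z ?m)"
          using M[of ?m] translate_gt[OF u] by (simp add: gate_def)
        moreover have rL: "relabel u (z ?m) \<in> L" using relabel_L u label_L by blast
        ultimately have "relabel u (z ?m) = z ?m"
          using crossing_wall(2)[of "axis ?m" "u \<otimes> axis ?m" "relabel u (z ?m)" "z ?m"] axis_G uG
            not_in_far[OF uG, of ?m] step_in_far[OF uG rL, of ?m] by metis
        then show ?thesis using Suc mult_step[OF u axis_G label_L] by simp
      qed
      finally have p: "path (axis (M + Suc i)) w = u \<otimes> axis (M + Suc i)" by simp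
      moreover have d: "distinct (walls (axis (M + Suc i)) w)"
        using walls_step_commute[OF axis_G label_L lk] Suc by simp
      ultimately show ?case using *[OF _ p d] by simp
    }
  qed
  have "w = []"
  proof (rule ccontr)
    assume "w \<noteq> []"
    then obtain y where y: "y \<in> set w" "y \<in> L" using w(1) by (cases w) auto
    obtain m where m: "m \<ge> M" "z m = y" using often[OF y(2)] by blast
    have "adj (z m) y" using main[of "m - M"] m(1) y(1) by auto
    then show False using m(2) adj_irrefl by blast
  qed
  then have "u \<otimes> axis M = axis M" using w(2) by simp
  then show ?thesis using u axis_G by (metis r_cancel_one)
qed

text \<open>In a product of two nontrivial groups choose nontrivial \<open>a\<close> and \<open>b\<close> in the two factors that commute with
  \<open>g\<close>. With \<open>c\<close> and \<open>d\<close> their shifts, \<open>a\<^bsup>|d|\<^esup>\<close> and \<open>b\<^bsup>|c|\<^esup>\<close> have the same shift up to sign, so they are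
  equal or inverse to each other. As the factors intersect trivially, \<open>a\<close> would have finite order, but its shift
  is not zero.\<close>

lemma not_splits_periodic: "\<not> splits_as_direct_product G"
proof
  assume "splits_as_direct_product G"
  then obtain H K :: "'g monoid" where HK: "group H" "group K"
      "carrier H \<noteq> {\<one>\<^bsub>H\<^esub>}" "carrier K \<noteq> {\<one>\<^bsub>K\<^esub>}" "G \<cong> H \<times>\<times> K"
    unfolding splits_as_direct_product_def by blast
  interpret H: group H by fact
  interpret K: group K by fact
  obtain f where f: "f \<in> iso G (H \<times>\<times> K)" using HK(5) unfolding is_iso_def by blast
  have hom: "f (x \<otimes> y) = (fst (f x) \<otimes>\<^bsub>H\<^esub> fst (f y), snd (f x) \<otimes>\<^bsub>K\<^esub> snd (f y))"
    if "x \<in> carrier G" "y \<in> carrier G" for x y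
    using hom_mult[of f G "H \<times>\<times> K" x y] f that unfolding iso_def by (cases "f x"; cases "f y") auto
  have carr: "fst (f x) \<in> carrier H" "snd (f x) \<in> carrier K" if "x \<in> carrier G" for x
    using hom_in_carrier[of f G "H \<times>\<times> K" x] f that unfolding iso_def by (cases "f x"; auto)+
  have inj: "x = y" if "x \<in> carrier G" "y \<in> carrier G" "f x = f y" for x y
    using f that unfolding iso_def bij_betw_def inj_on_def by blast
  have surj: "\<exists>x\<in>carrier G. f x = (p, q)" if "p \<in> carrier H" "q \<in> carrier K" for p q
  proof -
    have "(p, q) \<in> f ` carrier G" using f that by (simp add: iso_def bij_betw_def)
    then show ?thesis by (metis imageE)
  qed
  have one: "f \<one> = (\<one>\<^bsub>H\<^esub>, \<one>\<^bsub>K\<^esub>)"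
    using hom_one[of f G "H \<times>\<times> K"] f DirProd_group[OF HK(1,2)] is_group unfolding iso_def by simp
  obtain p where p: "p \<in> carrier H" "p \<noteq> \<one>\<^bsub>H\<^esub>" "p \<otimes>\<^bsub>H\<^esub> fst (f g) = fst (f g) \<otimes>\<^bsub>H\<^esub> p"
  proof (cases "fst (f g) = \<one>\<^bsub>H\<^esub>")
    case True
    obtain p where "p \<in> carrier H" "p \<noteq> \<one>\<^bsub>H\<^esub>" using HK(3) H.one_closed by blast
    then show thesis using that[of p] True by simp
  next
    case False
    then show thesis using that[of "fst (f g)"] carr[OF g] by simp
  qed
  obtain q where q: "q \<in> carrier K" "q \<noteq> \<one>\<^bsub>K\<^esub>" "q \<otimes>\<^bsub>K\<^esub> snd (f g) = snd (f g) \<otimes>\<^bsub>K\<^esub> q"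
  proof (cases "snd (f g) = \<one>\<^bsub>K\<^esub>")
    case True
    obtain q where "q \<in> carrier K" "q \<noteq> \<one>\<^bsub>K\<^esub>" using HK(4) K.one_closed by blast
    then show thesis using that[of q] True by simp
  next
    case False
    then show thesis using that[of "snd (f g)"] carr[OF g] by simp
  qed
  obtain a where a: "a \<in> carrier G" "f a = (p, \<one>\<^bsub>K\<^esub>)" using surj[OF p(1) K.one_closed] by blast
  obtain b where b: "b \<in> carrier G" "f b = (\<one>\<^bsub>H\<^esub>, q)" using surj[OF H.one_closed q(1)] by blast
  have "a \<otimes> g = g \<otimes> a" "b \<otimes> g = g \<otimes> b"
    using a b g p q carr[OF g] by (auto intro!: inj simp: hom)
  then obtain c d where c: "shifts z a c" and d: "shifts z b d" using shift_exists a b by meson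
  have "a \<noteq> \<one>" "b \<noteq> \<one>" using a b one p q by auto
  then have cd: "c \<noteq> 0" "d \<noteq> 0" using shifts_zero a b c d by blast+
  define x where "x = a [^] nat \<bar>d\<bar>"
  define y where "y = b [^] nat \<bar>c\<bar>"
  have xy: "x \<in> carrier G" "y \<in> carrier G" using a b by (simp_all add: x_def y_def)
  have sx: "shifts z x (\<bar>d\<bar> * c)" and sy: "shifts z y (\<bar>c\<bar> * d)"
    using shifts_pow[OF a(1) c, of "nat \<bar>d\<bar>"] shifts_pow[OF b(1) d, of "nat \<bar>c\<bar>"] by (simp_all add: x_def y_def)
  have fa: "snd (f (a [^] n)) = \<one>\<^bsub>K\<^esub>" for n :: nat
    by (induction n) (use a in \<open>simp_all add: one hom\<close>)
  have fb: "fst (f (b [^] n)) = \<one>\<^bsub>H\<^esub>" for n :: nat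
    by (induction n) (use b in \<open>simp_all add: one hom\<close>)
  have fx: "snd (f x) = \<one>\<^bsub>K\<^esub>" and fy: "fst (f y) = \<one>\<^bsub>H\<^esub>"
    unfolding x_def y_def by (rule fa, rule fb)
  have "\<bar>d\<bar> * c = \<bar>c\<bar> * d \<or> \<bar>d\<bar> * c = - (\<bar>c\<bar> * d)" by (simp add: abs_if)
  then have "x = \<one>"
  proof
    assume eq: "\<bar>d\<bar> * c = \<bar>c\<bar> * d"
    have "inv y \<otimes> g = g \<otimes> inv y"
    proof -
      have "y \<otimes> g = g \<otimes> y" unfolding y_def using \<open>b \<otimes> g = g \<otimes> b\<close> b g by (metis pow_mult_distrib group_commutes_pow)
      then show ?thesis using xy g by (metis inv_closed inv_solve_left inv_solve_right m_assoc m_closed)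
    qed
    then obtain e where e: "shifts z (inv y) e" using shift_exists xy by blast
    have "shifts z \<one> (\<bar>c\<bar> * d + e)" using shifts_mult[OF xy(2) _ sy e] xy by simp
    then have "e = - (\<bar>c\<bar> * d)" using shifts_unique[OF _ shifts_one] by fastforce
    then have "shifts z (x \<otimes> inv y) 0" using shifts_mult[OF xy(1) _ sx e] xy eq by simp
    then have "x \<otimes> inv y = \<one>" using shifts_zero xy by simp
    then have "x = y" using xy by (metis inv_equality inv_inv inv_closed)
    then have "f x = f \<one>" using fx fy one by (simp add: prod_eq_iff)
    then show ?thesis using inj xy by simp
  next
    assume "\<bar>d\<bar> * c = - (\<bar>c\<bar> * d)"
    then have "shifts z (x \<otimes> y) 0" using shifts_mult[OF xy sx sy] by simp
    then have "x \<otimes> y = \<one>" using shifts_zero xy by simp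
    then have "fst (f x) \<otimes>\<^bsub>H\<^esub> fst (f y) = \<one>\<^bsub>H\<^esub>" using hom[OF xy] one by simp
    then have "f x = f \<one>" using fx fy one carr[OF xy(1)] by (simp add: prod_eq_iff)
    then show ?thesis using inj xy by simp
  qed
  then have "shifts z \<one> (\<bar>d\<bar> * c)" using sx by simp
  then have "\<bar>d\<bar> * c = 0" by (rule shifts_unique[OF _ shifts_one])
  then show False using cd by simp
qed

end

lemma path_cycle: "path v (map (cycle w) [0..<n]) = ray v (cycle w) n"
  by (induction n) auto

text \<open>Repeating a closed walk through all labels gives a periodic axis. The walk is done twice, so that the
  translation along the axis permutes the labels trivially.\<close>

theorem not_joined_not_splits:
  assumes nj: "\<not> joined L adj" and a: "apart a a'"
  shows "\<not> splits_as_direct_product G"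
proof -
  have "a \<in> L" using a by (simp add: apart_def)
  then obtain ws where ws: "apart_walk a ws a" "set ws = L" "ws \<noteq> []"
    using closed_covering_walk[OF nj a] by blast
  let ?w = "ws @ ws" and ?z = "cycle (ws @ ws)"
  define g where "g = path \<one> ?w"
  have wL: "ws \<in> lists L" "?w \<in> lists L" using ws(2) by auto
  have w: "apart_walk a ?w a" "?w \<noteq> []" using ws by (auto simp: apart_walk_append)
  have g: "g \<in> carrier G" unfolding g_def using path_V[OF one_closed wL(2)] .
  have rg: "relabel g x = x" if "x \<in> L" for x unfolding g_def using relabel_square[OF wL(1) that] .
  have zL: "?z n \<in> L" for n using cycle_apart(2)[OF w, of n] by (simp add: apart_def)
  have map: "map ?z [0..<length ?w] = ?w"
    by (rule nth_equalityI) (auto simp: cycle_def)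
  have period: "ray \<one> ?z (n + length ?w) = g \<otimes> ray \<one> ?z n" for n
  proof (induction n)
    case 0
    have "ray \<one> ?z (length ?w) = g" unfolding g_def path_cycle[symmetric] map ..
    then show ?case using g by simp
  next
    case (Suc n)
    have r: "ray \<one> ?z n \<in> carrier G" using ray_V[OF one_closed, of ?z n] zL by blast
    have "?z (n + length ?w) = ?z n" by (simp add: cycle_def)
    then show ?case using Suc mult_step[OF g r zL] rg[OF zL] by simp
  qed
  show ?thesis
    by (rule not_splits_periodic[of ?z g "length ?w"])
       (use cycle_apart(2)[OF w] cycle_often[of _ ?w] ws g rg period in auto)
qed

end

context right_angled
begin

section \<open>Cubes as orbits of cliques\<close>

text \<open>A shortest word in commuting labels repeats none of them, since all edges with the same label that it could meet
  belong to one wall.\<close>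

lemma clique_word:
  assumes T: "T \<subseteq> L" "pairwise adj T" and v: "v \<in> V" and s: "s \<in> lists T"
  shows "path v s \<in> cube v T"
proof -
  have "s \<in> lists L" using s T(1) by auto
  then obtain w where w: "w \<in> lists L" "path v w = path v s" "distinct (walls v w)" "set w \<subseteq> set s"
    using geodesic[OF v] by metis
  have wT: "set w \<subseteq> T" using w(4) s by auto
  have "distinct w"
  proof (rule ccontr)
    assume "\<not> distinct w"
    then obtain a b c x where abc: "w = a @ [x] @ b @ [x] @ c" using not_distinct_decomp by blast
    have x: "x \<in> T" "x \<in> L" using wT abc T(1) by auto
    have "path v a \<in> V" using path_V[OF v, of a] w(1) abc by simp
    moreover have "x # b \<in> lists (star x)"
      using wT abc x T(2) by (auto simp: star_def pairwise_def)
    ultimately have "wall (path (path v a) (x # b)) x = wall (path v a) x" using wall_path x by blast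
    then show False using w(3) abc by (simp add: walls_append)
  qed
  then show ?thesis unfolding cube_def using w(2) wT by (intro CollectI exI[of _ w]) auto
qed

lemma cube_eq_orbit:
  assumes "T \<subseteq> L" "pairwise adj T" "v \<in> V" shows "cube v T = path v ` lists T"
proof
  show "cube v T \<subseteq> path v ` lists T" unfolding cube_def by (auto simp: in_lists_conv_set)
  show "path v ` lists T \<subseteq> cube v T" using clique_word[OF assms] by blast
qed

lemma cube_move:
  assumes T: "T \<subseteq> L" "pairwise adj T" and v: "v \<in> V" and l: "l \<in> lists T"
  shows "cube (path v l) T = cube v T"
proof -
  have lL: "l \<in> lists L" using l T(1) by auto
  have "path (path v l) ` lists T = path v ` lists T"
  proof
    show "path (path v l) ` lists T \<subseteq> path v ` lists T"
    proof
      fix u assume "u \<in> path (path v l) ` lists T"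
      then obtain s where "s \<in> lists T" "u = path v (l @ s)" by auto
      then show "u \<in> path v ` lists T" using l by (intro image_eqI[of _ _ "l @ s"]) auto
    qed
    show "path v ` lists T \<subseteq> path (path v l) ` lists T"
    proof
      fix u assume "u \<in> path v ` lists T"
      then obtain s where "s \<in> lists T" "u = path v s" by auto
      then show "u \<in> path (path v l) ` lists T"
        using l path_rev[OF v lL] by (intro image_eqI[of _ _ "rev l @ s"]) auto
    qed
  qed
  then show ?thesis using cube_eq_orbit[OF T v] cube_eq_orbit[OF T path_V[OF v lL]] by simp
qed

text \<open>If all labels commute, every vertex belongs to one cube.\<close>

lemma infinite_apart:
  assumes "infinite V" obtains a a' where "apart a a'"
proof (rule ccontr)
  assume "\<not> thesis"
  then have "pairwise adj L" using that unfolding pairwise_def apart_def by blast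
  then have "cube base L = path base ` lists L" using cube_eq_orbit base by blast
  then have "V \<subseteq> cube base L" using reach by blast
  then show False using assms finite_cube[of L base] finite_subset by blast
qed

end

section \<open>Presented groups\<close>

abbreviation word_class :: "'a set \<Rightarrow> ('a word \<times> 'a word) set \<Rightarrow> 'a word \<Rightarrow> 'a word set" where
  "word_class S R w \<equiv> pres_rel S R `` {w}"

lemma words_append [simp]: "u @ v \<in> words S \<longleftrightarrow> u \<in> words S \<and> v \<in> words S"
  by (auto simp: words_def)

lemma words_Cons [simp]: "x # w \<in> words S \<longleftrightarrow> fst x \<in> S \<and> w \<in> words S"
  by (cases x) (auto simp: words_def)

lemma words_Nil [simp]: "[] \<in> words S"
  by (auto simp: words_def)

lemma word_class_eq_iff: "u \<in> words S \<Longrightarrow> v \<in> words S \<Longrightarrow>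
    word_class S R u = word_class S R v \<longleftrightarrow> (u, v) \<in> pres_rel S R"
  using eq_equiv_class_iff[OF equiv_pres_rel] .

lemma word_class_carrier: "w \<in> words S \<Longrightarrow> word_class S R w \<in> carrier (presented_group S R)"
  by (simp add: presented_group_def quotientI)

lemma carrier_presented: 
  assumes "x \<in> carrier (presented_group S R)" obtains w where "w \<in> words S" "x = word_class S R w"
  using assms by (auto simp: presented_group_def elim: quotientE)

lemma one_presented: "\<one>\<^bsub>presented_group S R\<^esub> = word_class S R []"
  by (simp add: presented_group_def)

lemma relI: "(l, r) \<in> R \<Longrightarrow> l \<in> words S \<Longrightarrow> r \<in> words S \<Longrightarrow> (l, r) \<in> pres_rel S R"
  using pres_rel.rel[of "[]" S "[]" l r R] by simp

lemma cancelI: "s \<in> S \<Longrightarrow> ([(s, b), (s, \<not> b)], []) \<in> pres_rel S R"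
  using pres_rel.cancel[of "[]" S "[]" s b R] by simp

lemma letter_inverse:
  assumes "s \<in> S"
  shows "inv\<^bsub>presented_group S R\<^esub> (word_class S R [(s, True)]) = word_class S R [(s, False)]"
proof -
  interpret group "presented_group S R" by (rule group_presented_group)
  have "word_class S R [(s, False)] \<otimes>\<^bsub>presented_group S R\<^esub> word_class S R [(s, True)] = \<one>\<^bsub>presented_group S R\<^esub>"
    using assms cancelI[OF assms, of False R] word_class_eq_iff[of "[(s, False), (s, True)]" S "[]" R]
    by (simp add: presented_mult one_presented)
  then show ?thesis using assms by (intro inv_equality) (simp_all add: word_class_carrier)
qed

lemma (in group) inv_commute:
  assumes "x \<in> carrier G" "y \<in> carrier G" "x \<otimes> y = y \<otimes> x" shows "inv x \<otimes> y = y \<otimes> inv x"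
  using assms by (metis inv_closed inv_solve_left inv_solve_right m_assoc m_closed)

lemma letters_commute:
  assumes S: "s \<in> S" "t \<in> S"
    and st: "([(s, True), (t, True)], [(t, True), (s, True)]) \<in> pres_rel S R"
  shows "([(s, b), (t, c)], [(t, c), (s, b)]) \<in> pres_rel S R"
proof -
  interpret group "presented_group S R" by (rule group_presented_group)
  let ?G = "presented_group S R"
  define x where "x b = word_class S R [(s, b)]" for b
  define y where "y c = word_class S R [(t, c)]" for c
  have xy: "x b \<in> carrier ?G" "y c \<in> carrier ?G" for b c
    using S by (simp_all add: x_def y_def word_class_carrier)
  have inv: "x False = inv\<^bsub>?G\<^esub> x True" "y False = inv\<^bsub>?G\<^esub> y True"
    using S by (simp_all add: x_def y_def letter_inverse)
  have TT: "x True \<otimes>\<^bsub>?G\<^esub> y True = y True \<otimes>\<^bsub>?G\<^esub> x True"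
    using st S word_class_eq_iff[of "[(s, True), (t, True)]" S] by (simp add: x_def y_def presented_mult)
  have FT: "x False \<otimes>\<^bsub>?G\<^esub> y True = y True \<otimes>\<^bsub>?G\<^esub> x False"
    using inv_commute[OF xy TT] inv(1) by simp
  have "x b \<otimes>\<^bsub>?G\<^esub> y c = y c \<otimes>\<^bsub>?G\<^esub> x b"
  proof (cases c)
    case True
    then show ?thesis using TT FT by (cases b) simp_all
  next
    case False
    then show ?thesis using inv_commute[OF xy(2,1) TT[symmetric]] inv_commute[OF xy(2,1) FT[symmetric]] inv(2)
      by (cases b) simp_all
  qed
  then show ?thesis using S word_class_eq_iff[of "[(s, b), (t, c)]" S "[(t, c), (s, b)]" R] 
    by (simp add: x_def y_def presented_mult)
qed

lemma words_commute:
  assumes AB: "A \<union> B \<subseteq> S"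
    and st: "\<And>s t. s \<in> A \<Longrightarrow> t \<in> B \<Longrightarrow> ([(s, True), (t, True)], [(t, True), (s, True)]) \<in> pres_rel S R"
    and u: "u \<in> words A" and v: "v \<in> words B"
  shows "(u @ v, v @ u) \<in> pres_rel S R"
proof -
  have sub: "w \<in> words C \<Longrightarrow> C \<subseteq> S \<Longrightarrow> w \<in> words S" for w C by (auto simp: words_def)
  have one: "([(s, b)] @ v, v @ [(s, b)]) \<in> pres_rel S R" if s: "s \<in> A" for s b
    using v
  proof (induction v)
    case Nil
    then show ?case using s AB by (auto intro!: pres_rel.refl)
  next
    case (Cons y v)
    obtain t c where y: "y = (t, c)" by fastforce
    have t: "t \<in> B" "v \<in> words B" using Cons.prems y by auto
    have W: "s \<in> S" "t \<in> S" "v \<in> words S" using s t AB sub[OF t(2)] by auto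
    have "([] @ [(s, b), (t, c)] @ v, [] @ [(t, c), (s, b)] @ v) \<in> pres_rel S R"
      using pres_rel_context[OF letters_commute[OF W(1,2) st[OF s t(1)]] words_Nil W(3)] .
    moreover have "([(t, c)] @ ([(s, b)] @ v) @ [], [(t, c)] @ (v @ [(s, b)]) @ []) \<in> pres_rel S R"
      using pres_rel_context[OF Cons.IH[OF t(2)], of "[(t, c)]" "[]"] W by simp
    ultimately have "((s, b) # (t, c) # v, (t, c) # v @ [(s, b)]) \<in> pres_rel S R"
      using pres_rel.trans[of "(s, b) # (t, c) # v" "(t, c) # (s, b) # v"] by simp
    then show ?case using y by simp
  qed
  show ?thesis using u
  proof (induction u)
    case Nil
    then show ?case using sub[OF v] AB by (auto intro!: pres_rel.refl)
  next
    case (Cons x u)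
    obtain s b where x: "x = (s, b)" by fastforce
    have s: "s \<in> A" "u \<in> words A" using Cons.prems x by auto
    have W: "s \<in> S" "u \<in> words S" "v \<in> words S" using s AB sub[OF s(2)] sub[OF v] by auto
    have "([(s, b)] @ (u @ v) @ [], [(s, b)] @ (v @ u) @ []) \<in> pres_rel S R"
      using pres_rel_context[OF Cons.IH[OF s(2)], of "[(s, b)]" "[]"] W by simp
    moreover have "([] @ ([(s, b)] @ v) @ u, [] @ (v @ [(s, b)]) @ u) \<in> pres_rel S R"
      using pres_rel_context[OF one[OF s(1)] words_Nil W(2)] .
    ultimately have "((s, b) # u @ v, v @ (s, b) # u) \<in> pres_rel S R"
      using pres_rel.trans[of "(s, b) # u @ v" "(s, b) # v @ u"] by simp
    then show ?case using x by simp
  qed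
qed

lemma pres_rel_filter:
  assumes "(u, v) \<in> pres_rel S R"
    and R: "\<And>l r. (l, r) \<in> R \<Longrightarrow> l \<in> words S \<Longrightarrow> r \<in> words S \<Longrightarrow>
      (filter (\<lambda>x. fst x \<in> A) l, filter (\<lambda>x. fst x \<in> A) r) \<in> pres_rel S R"
  shows "(filter (\<lambda>x. fst x \<in> A) u, filter (\<lambda>x. fst x \<in> A) v) \<in> pres_rel S R"
proof -
  have F: "w \<in> words S \<Longrightarrow> filter (\<lambda>x. fst x \<in> A) w \<in> words S" for w by (auto simp: words_def)
  show ?thesis using assms(1)
  proof (induction rule: pres_rel.induct)
    case (refl w)
    then show ?case using F pres_rel.refl by blast
  next
    case (sym v w)
    then show ?case using pres_rel.sym by blast
  next
    case (trans u v w)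
    then show ?case using pres_rel.trans by blast
  next
    case (cancel u v s b)
    then show ?case using F[OF cancel(1)] F[OF cancel(2)] pres_rel.cancel[of _ S _ s b R]
      by (auto intro: pres_rel.refl)
  next
    case (rel u v l r)
    then show ?case using pres_rel_context[OF R[OF rel(5,3,4)] F[OF rel(1)] F[OF rel(2)]] by simp
  qed
qed

lemma sort_word:
  assumes AB: "A \<union> B = S"
    and st: "\<And>s t. s \<in> A \<Longrightarrow> t \<in> B \<Longrightarrow> ([(s, True), (t, True)], [(t, True), (s, True)]) \<in> pres_rel S R"
    and w: "w \<in> words S"
  shows "(filter (\<lambda>x. fst x \<in> A) w @ filter (\<lambda>x. fst x \<notin> A) w, w) \<in> pres_rel S R"
  using w
proof (induction w)
  case Nil
  then show ?case by (simp add: pres_rel.refl)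
next
  case (Cons x w)
  let ?a = "filter (\<lambda>x. fst x \<in> A) w" and ?b = "filter (\<lambda>x. fst x \<notin> A) w"
  have W: "w \<in> words S" "[x] \<in> words S" "fst x \<in> S" using Cons.prems by auto
  have ab: "?a \<in> words A" "?b \<in> words B" using W(1) AB by (auto simp: words_def)
  have abS: "?b \<in> words S" using W(1) by (auto simp: words_def)
  have IH: "([x] @ (?a @ ?b) @ [], [x] @ w @ []) \<in> pres_rel S R"
    using pres_rel_context[OF Cons.IH[OF W(1)] W(2) words_Nil] .
  show ?case
  proof (cases "fst x \<in> A")
    case True
    then show ?thesis using IH by simp
  next
    case False
    then have x: "[x] \<in> words B" using W(3) AB by auto
    have "(?a @ [x], [x] @ ?a) \<in> pres_rel S R" using words_commute[OF _ st ab(1) x] AB by simp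
    from pres_rel_context[OF this words_Nil abS]
    have "(?a @ x # ?b, x # ?a @ ?b) \<in> pres_rel S R" by simp
    then have "(?a @ x # ?b, x # w) \<in> pres_rel S R" using IH by (auto intro: pres_rel.trans)
    then show ?thesis using False by simp
  qed
qed

text \<open>The words in \<open>A\<close> and the words in \<open>B\<close> give two commuting subgroups whose product is everything. Deleting all
  letters outside \<open>A\<close> is a well-defined retraction onto the first subgroup and kills the second, so they
  intersect trivially.\<close>

lemma presented_group_splits:
  assumes AB: "A \<union> B = S" "A \<inter> B = {}"
    and st: "\<And>s t. s \<in> A \<Longrightarrow> t \<in> B \<Longrightarrow> ([(s, True), (t, True)], [(t, True), (s, True)]) \<in> pres_rel S R"
    and R: "\<And>l r. (l, r) \<in> R \<Longrightarrow> l \<in> words S \<Longrightarrow> r \<in> words S \<Longrightarrow>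
      (filter (\<lambda>x. fst x \<in> A) l, filter (\<lambda>x. fst x \<in> A) r) \<in> pres_rel S R"
    and nt: "a \<in> A" "([(a, True)], []) \<notin> pres_rel S R" "b \<in> B" "([(b, True)], []) \<notin> pres_rel S R"
  shows "splits_as_direct_product (presented_group S R)"
proof -
  let ?G = "presented_group S R"
  interpret group ?G by (rule group_presented_group)
  define sub where "sub C = word_class S R ` words C" for C
  have W: "w \<in> words S" if "w \<in> words C" "C \<subseteq> S" for w C using that by (auto simp: words_def)
  have subgroup: "subgroup (sub C) ?G" if C: "C \<subseteq> S" for C
  proof (rule subgroupI)
    show "sub C \<subseteq> carrier ?G" using W[OF _ C] by (auto simp: sub_def intro!: word_class_carrier)
    show "sub C \<noteq> {}" using words_Nil[of C] unfolding sub_def by blast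
    fix x assume "x \<in> sub C"
    then obtain u where u: "u \<in> words C" "x = word_class S R u" by (auto simp: sub_def)
    let ?u = "rev (map (\<lambda>(s, b). (s, \<not> b)) u)"
    have u': "?u \<in> words C" using u(1) by (auto simp: words_def)
    have "word_class S R ?u \<otimes>\<^bsub>?G\<^esub> x = \<one>\<^bsub>?G\<^esub>"
      using u presented_mult[OF W[OF u' C] W[OF u(1) C]] pres_rel_inverse[OF W[OF u(1) C], of R]
        word_class_eq_iff[of "?u @ u" S "[]" R] W[OF u' C] W[OF u(1) C] by (simp add: one_presented)
    then have "inv\<^bsub>?G\<^esub> x = word_class S R ?u"
      using u W[OF u' C] W[OF u(1) C] by (intro inv_equality) (auto intro: word_class_carrier)
    then show "inv\<^bsub>?G\<^esub> x \<in> sub C" using u' by (auto simp: sub_def)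
    fix y assume "y \<in> sub C"
    then obtain v where v: "v \<in> words C" "y = word_class S R v" by (auto simp: sub_def)
    then have "x \<otimes>\<^bsub>?G\<^esub> y = word_class S R (u @ v)" using u W[OF _ C] by (simp add: presented_mult)
    then show "x \<otimes>\<^bsub>?G\<^esub> y \<in> sub C" using u v by (auto simp: sub_def)
  qed
  let ?H = "?G\<lparr>carrier := sub A\<rparr>" and ?K = "?G\<lparr>carrier := sub B\<rparr>"
  have sA: "A \<subseteq> S" and sB: "B \<subseteq> S" using AB by auto
  have H: "group ?H" and K: "group ?K"
    using subgroup[OF sA] subgroup[OF sB] by (auto intro: subgroup.subgroup_is_group is_group)
  have HG: "x \<in> carrier ?G" if "x \<in> sub A" for x using that subgroup.subset[OF subgroup[OF sA]] by blast
  have KG: "x \<in> carrier ?G" if "x \<in> sub B" for x using that subgroup.subset[OF subgroup[OF sB]] by blast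
  have comm: "x \<otimes>\<^bsub>?G\<^esub> y = y \<otimes>\<^bsub>?G\<^esub> x" if xy: "x \<in> sub A" "y \<in> sub B" for x y
  proof -
    obtain u v where u: "u \<in> words A" "x = word_class S R u" and v: "v \<in> words B" "y = word_class S R v"
      using xy by (auto simp: sub_def)
    have "(u @ v, v @ u) \<in> pres_rel S R" using words_commute[OF _ st u(1) v(1)] AB by simp
    moreover have "u \<in> words S" "v \<in> words S" using W u v sA sB by blast+
    ultimately show ?thesis using u v by (simp add: presented_mult word_class_eq_iff)
  qed
  have uniq: "x = x'" if xy: "x \<in> sub A" "x' \<in> sub A" "y \<in> sub B" "y' \<in> sub B" "x \<otimes>\<^bsub>?G\<^esub> y = x' \<otimes>\<^bsub>?G\<^esub> y'" for x x' y y'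
  proof -
    obtain u u' v v' where u: "u \<in> words A" "x = word_class S R u" "u' \<in> words A" "x' = word_class S R u'"
      and v: "v \<in> words B" "y = word_class S R v" "v' \<in> words B" "y' = word_class S R v'"
      using xy(1-4) unfolding sub_def by (elim imageE)
    note WS = W[OF u(1) sA] W[OF u(3) sA] W[OF v(1) sB] W[OF v(3) sB]
    have "word_class S R (u @ v) = word_class S R (u' @ v')"
      using xy(5) u v WS by (simp add: presented_mult)
    then have "(u @ v, u' @ v') \<in> pres_rel S R" using WS by (simp add: word_class_eq_iff)
    then have *: "(filter (\<lambda>x. fst x \<in> A) (u @ v), filter (\<lambda>x. fst x \<in> A) (u' @ v')) \<in> pres_rel S R"
      by (rule pres_rel_filter[OF _ R])
    have f: "filter (\<lambda>x. fst x \<in> A) w = w" if "w \<in> words A" for w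
      using that by (auto simp: words_def intro!: filter_True)
    have g: "filter (\<lambda>x. fst x \<in> A) w = []" if "w \<in> words B" for w
      using that AB(2) by (auto simp: words_def filter_empty_conv)
    have "(u, u') \<in> pres_rel S R" using * f[OF u(1)] f[OF u(3)] g[OF v(1)] g[OF v(3)] by simp
    then show ?thesis using u WS by (simp add: word_class_eq_iff)
  qed
  have iso: "(\<lambda>(x, y). x \<otimes>\<^bsub>?G\<^esub> y) \<in> iso (?H \<times>\<times> ?K) ?G"
  proof (rule isoI)
    show "(\<lambda>(x, y). x \<otimes>\<^bsub>?G\<^esub> y) \<in> hom (?H \<times>\<times> ?K) ?G"
    proof (rule homI)
      fix p q assume "p \<in> carrier (?H \<times>\<times> ?K)" "q \<in> carrier (?H \<times>\<times> ?K)"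
      then obtain x y x' y' where p: "p = (x, y)" "x \<in> sub A" "y \<in> sub B" and q: "q = (x', y')" "x' \<in> sub A" "y' \<in> sub B"
        by (auto simp: DirProd_def)
      have c: "x \<in> carrier ?G" "y \<in> carrier ?G" "x' \<in> carrier ?G" "y' \<in> carrier ?G"
        using p q HG KG by auto
      have "(x \<otimes>\<^bsub>?G\<^esub> x') \<otimes>\<^bsub>?G\<^esub> (y \<otimes>\<^bsub>?G\<^esub> y') = x \<otimes>\<^bsub>?G\<^esub> ((x' \<otimes>\<^bsub>?G\<^esub> y) \<otimes>\<^bsub>?G\<^esub> y')" using c by (simp add: m_assoc)
      also have "\<dots> = x \<otimes>\<^bsub>?G\<^esub> ((y \<otimes>\<^bsub>?G\<^esub> x') \<otimes>\<^bsub>?G\<^esub> y')" using comm[OF q(2) p(3)] by simp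
      also have "\<dots> = (x \<otimes>\<^bsub>?G\<^esub> y) \<otimes>\<^bsub>?G\<^esub> (x' \<otimes>\<^bsub>?G\<^esub> y')" using c by (simp add: m_assoc)
      finally show "(case p \<otimes>\<^bsub>?H \<times>\<times> ?K\<^esub> q of (x, y) \<Rightarrow> x \<otimes>\<^bsub>?G\<^esub> y) =
        (case p of (x, y) \<Rightarrow> x \<otimes>\<^bsub>?G\<^esub> y) \<otimes>\<^bsub>?G\<^esub> (case q of (x, y) \<Rightarrow> x \<otimes>\<^bsub>?G\<^esub> y)"
        using p q by simp
    next
      fix p assume "p \<in> carrier (?H \<times>\<times> ?K)"
      then show "(case p of (x, y) \<Rightarrow> x \<otimes>\<^bsub>?G\<^esub> y) \<in> carrier ?G" using HG KG by auto
    qed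
    show "bij_betw (\<lambda>(x, y). x \<otimes>\<^bsub>?G\<^esub> y) (carrier (?H \<times>\<times> ?K)) (carrier ?G)"
    proof (rule bij_betw_imageI)
      show "inj_on (\<lambda>(x, y). x \<otimes>\<^bsub>?G\<^esub> y) (carrier (?H \<times>\<times> ?K))"
      proof (rule inj_onI)
        fix p q assume "p \<in> carrier (?H \<times>\<times> ?K)" "q \<in> carrier (?H \<times>\<times> ?K)"
          and eq: "(case p of (x, y) \<Rightarrow> x \<otimes>\<^bsub>?G\<^esub> y) = (case q of (x, y) \<Rightarrow> x \<otimes>\<^bsub>?G\<^esub> y)"
        then obtain x y x' y' where p: "p = (x, y)" "x \<in> sub A" "y \<in> sub B" and q: "q = (x', y')" "x' \<in> sub A" "y' \<in> sub B"
          by (auto simp: DirProd_def)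
        have e: "x \<otimes>\<^bsub>?G\<^esub> y = x' \<otimes>\<^bsub>?G\<^esub> y'" using eq p q by simp
        then have "x = x'" using uniq p q by blast
        then show "p = q" using e p q HG KG by simp
      qed
      show "(\<lambda>(x, y). x \<otimes>\<^bsub>?G\<^esub> y) ` carrier (?H \<times>\<times> ?K) = carrier ?G"
      proof
        show "(\<lambda>(x, y). x \<otimes>\<^bsub>?G\<^esub> y) ` carrier (?H \<times>\<times> ?K) \<subseteq> carrier ?G" using HG KG by auto
        show "carrier ?G \<subseteq> (\<lambda>(x, y). x \<otimes>\<^bsub>?G\<^esub> y) ` carrier (?H \<times>\<times> ?K)"
        proof
          fix g assume "g \<in> carrier ?G"
          then obtain w where w: "w \<in> words S" "g = word_class S R w" by (rule carrier_presented)
          let ?a = "filter (\<lambda>x. fst x \<in> A) w" and ?b = "filter (\<lambda>x. fst x \<notin> A) w"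
          have ab: "?a \<in> words A" "?b \<in> words B" using w(1) AB(1) by (auto simp: words_def)
          have "word_class S R (?a @ ?b) = g"
            using sort_word[OF AB(1) st w(1)] w W[OF ab(1) sA] W[OF ab(2) sB] by (simp add: word_class_eq_iff)
          then have "word_class S R ?a \<otimes>\<^bsub>?G\<^esub> word_class S R ?b = g"
            using presented_mult[OF W[OF ab(1) sA] W[OF ab(2) sB]] by simp
          moreover have "word_class S R ?a \<in> sub A" "word_class S R ?b \<in> sub B" using ab by (auto simp: sub_def)
          ultimately show "g \<in> (\<lambda>(x, y). x \<otimes>\<^bsub>?G\<^esub> y) ` carrier (?H \<times>\<times> ?K)"
            by (intro image_eqI[of _ _ "(word_class S R ?a, word_class S R ?b)"]) auto
        qed
      qed
    qed
  qed
  have nontrivial: "sub C \<noteq> {\<one>\<^bsub>?G\<^esub>}" if "c \<in> C" "C \<subseteq> S" "([(c, True)], []) \<notin> pres_rel S R" for c C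
  proof
    assume triv: "sub C = {\<one>\<^bsub>?G\<^esub>}"
    have "word_class S R [(c, True)] \<in> sub C" using that(1) by (auto simp: sub_def)
    then have "word_class S R [(c, True)] = word_class S R []" using triv by (simp add: one_presented)
    then show False using that word_class_eq_iff[of "[(c, True)]" S "[]" R] by auto
  qed
  have "(?H \<times>\<times> ?K) \<cong> ?G" using iso by (rule is_isoI)
  then have "?G \<cong> ?H \<times>\<times> ?K" using group.iso_sym[OF DirProd_group[OF H K]] by blast
  then show ?thesis unfolding splits_as_direct_product_def
    using H K nontrivial[OF nt(1) sA nt(2)] nontrivial[OF nt(3) sB nt(4)]
    by (intro exI[of _ ?H] exI[of _ ?K]) simp
qed

lemma trivial_not_splits:
  assumes "carrier G = {x}" shows "\<not> splits_as_direct_product G"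
proof
  assume "splits_as_direct_product G"
  then obtain H K :: "'a monoid" where HK: "group H" "group K" "carrier H \<noteq> {\<one>\<^bsub>H\<^esub>}" "G \<cong> H \<times>\<times> K"
    unfolding splits_as_direct_product_def by blast
  obtain f where "f \<in> iso G (H \<times>\<times> K)" using HK(4) unfolding is_iso_def by blast
  then have "carrier (H \<times>\<times> K) = {f x}" using assms unfolding iso_def bij_betw_def by auto
  then have *: "carrier H \<times> carrier K = {f x}" by simp
  have one: "\<one>\<^bsub>H\<^esub> \<in> carrier H" "\<one>\<^bsub>K\<^esub> \<in> carrier K" using HK(1,2) by (auto simp: group_def monoid.one_closed)
  have "y = \<one>\<^bsub>H\<^esub>" if "y \<in> carrier H" for y
  proof -
    have "(y, \<one>\<^bsub>K\<^esub>) \<in> {f x}" "(\<one>\<^bsub>H\<^esub>, \<one>\<^bsub>K\<^esub>) \<in> {f x}" using that one unfolding *[symmetric] by auto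
    then show ?thesis by (metis singletonD prod.inject)
  qed
  then show False using HK(3) one(1) by blast
qed

section \<open>Right-angled Coxeter groups\<close>

lemma pair_graph_facts:
  assumes "pair_graph \<Gamma>"
  shows "finite (pverts \<Gamma>)" "(s, t) \<in> parcs \<Gamma> \<Longrightarrow> s \<in> pverts \<Gamma>" "(s, t) \<in> parcs \<Gamma> \<Longrightarrow> (t, s) \<in> parcs \<Gamma>"
    "(s, s) \<notin> parcs \<Gamma>"
proof -
  interpret pair_graph \<Gamma> by fact
  show "finite (pverts \<Gamma>)" by (rule pair_finite_verts)
  show "(s, t) \<in> parcs \<Gamma> \<Longrightarrow> s \<in> pverts \<Gamma>" using arc_fst_in_verts by fastforce
  show "(s, t) \<in> parcs \<Gamma> \<Longrightarrow> (t, s) \<in> parcs \<Gamma>" using pair_sym_arcs unfolding symmetric_def sym_def by simp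
  show "(s, s) \<notin> parcs \<Gamma>" using pair_no_loops by fastforce
qed

abbreviation adjacent :: "'a pair_pre_digraph \<Rightarrow> 'a \<Rightarrow> 'a \<Rightarrow> bool" where
  "adjacent \<Gamma> s t \<equiv> (s, t) \<in> parcs \<Gamma>"

definition racg_step :: "'a pair_pre_digraph \<Rightarrow> 'a word set \<Rightarrow> 'a \<Rightarrow> 'a word set" where
  "racg_step \<Gamma> A s = A \<otimes>\<^bsub>racg \<Gamma>\<^esub> racg_gen \<Gamma> s"

abbreviation positive :: "'a list \<Rightarrow> 'a word" where
  "positive \<equiv> map (\<lambda>s. (s, True))"

lemma positive_words: "positive l \<in> words S \<longleftrightarrow> l \<in> lists S"
  by (induction l) auto

lemma map_fst_lists: "w \<in> words S \<Longrightarrow> map fst w \<in> lists S"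
  by (induction w) auto

text \<open>Forgetting the signs of letters turns both kinds of relations, and free cancellation, into the rules for labels.\<close>

lemma racg_word_eq:
  assumes G: "pair_graph \<Gamma>" and "(v, w) \<in> pres_rel (pverts \<Gamma>) (racg_rels \<Gamma>)"
  shows "word_eq (pverts \<Gamma>) (adjacent \<Gamma>) (map fst v) (map fst w)"
  using assms(2)
proof (induction rule: pres_rel.induct)
  case (refl w)
  then show ?case by (intro word_eq.word_refl map_fst_lists)
next
  case (sym v w)
  show ?case using sym.IH by (rule word_eq.word_sym)
next
  case (trans u v w)
  show ?case using trans.IH by (rule word_eq.word_trans)
next
  case (cancel u v s b)
  then show ?case using word_eq.cancel[OF map_fst_lists[OF cancel(1)] map_fst_lists[OF cancel(2)] cancel(3), of "adjacent \<Gamma>"]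
    by simp
next
  case (rel u v l r)
  note uv = map_fst_lists[OF rel(1)] map_fst_lists[OF rel(2)]
  consider s where "l = [(s, True), (s, True)]" "r = []" "s \<in> pverts \<Gamma>" |
    s t where "l = [(s, True), (t, True)]" "r = [(t, True), (s, True)]" "adjacent \<Gamma> s t"
    using rel(5) by (auto simp: racg_rels_def raag_rels_def)
  then show ?case
  proof cases
    case 1
    then show ?thesis using word_eq.cancel[OF uv 1(3), of "adjacent \<Gamma>"] by simp
  next
    case 2
    then show ?thesis using word_eq.swap[where adj = "adjacent \<Gamma>", OF uv 2(3)] by simp
  qed
qed

lemma racg_step_class:
  assumes "w \<in> words (pverts \<Gamma>)" "s \<in> pverts \<Gamma>"
  shows "racg_step \<Gamma> (word_class (pverts \<Gamma>) (racg_rels \<Gamma>) w) s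
    = word_class (pverts \<Gamma>) (racg_rels \<Gamma>) (w @ [(s, True)])"
  using presented_mult[OF assms(1), of "[(s, True)]"] assms(2)
  by (simp add: racg_step_def racg_def racg_gen_def presented_gen_def)

lemma racg_path_class:
  assumes "w \<in> words (pverts \<Gamma>)" "l \<in> lists (pverts \<Gamma>)"
  shows "foldl (racg_step \<Gamma>) (word_class (pverts \<Gamma>) (racg_rels \<Gamma>) w) l
    = word_class (pverts \<Gamma>) (racg_rels \<Gamma>) (w @ positive l)"
  using assms(2,1)
proof (induction l arbitrary: w rule: list.induct)
  case (Cons s l)
  then show ?case by (simp add: racg_step_class)
qed simp

lemma racg_square: "s \<in> pverts \<Gamma> \<Longrightarrow> ([(s, True), (s, True)], []) \<in> pres_rel (pverts \<Gamma>) (racg_rels \<Gamma>)"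
  by (rule relI) (auto simp: racg_rels_def)

text \<open>Generators are involutions, so every element is the class of a word without formal inverses.\<close>

lemma racg_letter: "s \<in> pverts \<Gamma> \<Longrightarrow> ([(s, b)], [(s, True)]) \<in> pres_rel (pverts \<Gamma>) (racg_rels \<Gamma>)"
proof (cases b)
  case False
  assume s: "s \<in> pverts \<Gamma>"
  let ?P = "pres_rel (pverts \<Gamma>) (racg_rels \<Gamma>)"
  have "([(s, False), (s, True), (s, True)], [(s, False)]) \<in> ?P"
    using pres_rel_context[OF racg_square[OF s], of "[(s, False)]" "[]"] s by simp
  then have "([(s, False)], [(s, False), (s, True), (s, True)]) \<in> ?P" by (rule pres_rel.sym)
  moreover have "([(s, False), (s, True), (s, True)], [(s, True)]) \<in> ?P"
    using pres_rel_context[OF cancelI[OF s, of False], of "[]" "[(s, True)]"] s by simp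
  ultimately have "([(s, False)], [(s, True)]) \<in> ?P" by (rule pres_rel.trans)
  then show ?thesis using False by simp
qed (simp add: pres_rel.refl)

lemma racg_positive:
  "w \<in> words (pverts \<Gamma>) \<Longrightarrow> (w, positive (map fst w)) \<in> pres_rel (pverts \<Gamma>) (racg_rels \<Gamma>)"
proof (induction w)
  case (Cons x w)
  then show ?case
    using pres_rel_append[OF racg_letter[of "fst x" \<Gamma> "snd x"] Cons.IH] by simp
qed (simp add: pres_rel.refl)

lemma racg_commute:
  assumes G: "pair_graph \<Gamma>" and "adjacent \<Gamma> s t"
  shows "([(s, True), (t, True)], [(t, True), (s, True)]) \<in> pres_rel (pverts \<Gamma>) (racg_rels \<Gamma>)"
  using assms pair_graph_facts(2,3)[OF G] by (intro relI) (auto simp: racg_rels_def raag_rels_def)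

lemma racg_right_angled:
  assumes G: "pair_graph \<Gamma>"
  shows "right_angled_group (racg \<Gamma>) (pverts \<Gamma>) (adjacent \<Gamma>) (racg_step \<Gamma>) (\<lambda>u s. s)"
proof -
  let ?S = "pverts \<Gamma>" and ?R = "racg_rels \<Gamma>"
  note gr = pair_graph_facts[OF G]
  interpret group "racg \<Gamma>" unfolding racg_def by (rule group_presented_group)
  have carr: "word_class ?S ?R w \<in> carrier (racg \<Gamma>)" if "w \<in> words ?S" for w
    unfolding racg_def using that by (rule word_class_carrier)
  have carrE: "\<exists>w\<in>words ?S. A = word_class ?S ?R w" if "A \<in> carrier (racg \<Gamma>)" for A
    using that unfolding racg_def by (elim carrier_presented) blast
  have one: "\<one>\<^bsub>racg \<Gamma>\<^esub> = word_class ?S ?R []" unfolding racg_def by (rule one_presented)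
  have gen: "racg_gen \<Gamma> s \<in> carrier (racg \<Gamma>)" if "s \<in> ?S" for s
    using carr[of "[(s, True)]"] that by (simp add: racg_gen_def presented_gen_def)
  show ?thesis
  proof
    show "finite ?S" by (rule gr(1))
    show "s \<in> ?S" if "adjacent \<Gamma> s t" for s t using gr(2) that .
    show "adjacent \<Gamma> t s" if "adjacent \<Gamma> s t" for s t using gr(3) that .
    show "\<not> adjacent \<Gamma> s s" for s using gr(4) .
    show "\<one>\<^bsub>racg \<Gamma>\<^esub> \<in> carrier (racg \<Gamma>)" by simp
    show "racg_step \<Gamma> v s \<in> carrier (racg \<Gamma>)" if "v \<in> carrier (racg \<Gamma>)" "s \<in> ?S" for v s
      using that gen by (simp add: racg_step_def)
    show "racg_step \<Gamma> (racg_step \<Gamma> v s) s = v" if v: "v \<in> carrier (racg \<Gamma>)" and s: "s \<in> ?S" for v s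
    proof -
      obtain w where w: "w \<in> words ?S" "v = word_class ?S ?R w" using carrE[OF v] by blast
      have "(w @ [(s, True), (s, True)], w) \<in> pres_rel ?S ?R"
        using pres_rel_context[OF racg_square[OF s] w(1) words_Nil] by simp
      then show ?thesis using w s by (simp add: racg_step_class word_class_eq_iff)
    qed
    show "racg_step \<Gamma> (racg_step \<Gamma> v s) t = racg_step \<Gamma> (racg_step \<Gamma> v t) s"
      if v: "v \<in> carrier (racg \<Gamma>)" and st: "adjacent \<Gamma> s t" for v s t
    proof -
      obtain w where w: "w \<in> words ?S" "v = word_class ?S ?R w" using carrE[OF v] by blast
      have S: "s \<in> ?S" "t \<in> ?S" using gr(2) gr(3) st by blast+
      have "(w @ [(s, True), (t, True)], w @ [(t, True), (s, True)]) \<in> pres_rel ?S ?R"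
        using pres_rel_context[OF racg_commute[OF G st] w(1) words_Nil] by simp
      then show ?thesis using w S by (simp add: racg_step_class word_class_eq_iff)
    qed
    show "\<exists>l\<in>lists ?S. v = foldl (racg_step \<Gamma>) \<one>\<^bsub>racg \<Gamma>\<^esub> l" if v: "v \<in> carrier (racg \<Gamma>)" for v
    proof -
      obtain w where w: "w \<in> words ?S" "v = word_class ?S ?R w" using carrE[OF v] by blast
      have l: "map fst w \<in> lists ?S" using map_fst_lists[OF w(1)] .
      have "v = word_class ?S ?R (positive (map fst w))"
        using w racg_positive[OF w(1)] word_class_eq_iff[OF w(1), of "positive (map fst w)"] l
        by (simp only: positive_words simp_thms)
      then show ?thesis using l racg_path_class[OF words_Nil l] by (intro bexI[OF _ l]) (simp add: one)
    qed
    show "word_eq ?S (adjacent \<Gamma>) u w"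
      if u: "u \<in> lists ?S" and w: "w \<in> lists ?S"
        and eq: "foldl (racg_step \<Gamma>) \<one>\<^bsub>racg \<Gamma>\<^esub> u = foldl (racg_step \<Gamma>) \<one>\<^bsub>racg \<Gamma>\<^esub> w" for u w
    proof -
      have "word_class ?S ?R (positive u) = word_class ?S ?R (positive w)"
        using eq racg_path_class[OF words_Nil u] racg_path_class[OF words_Nil w] by (simp add: one)
      then have "(positive u, positive w) \<in> pres_rel ?S ?R"
        using u w by (simp only: word_class_eq_iff positive_words)
      from racg_word_eq[OF G this] show ?thesis by (simp add: comp_def)
    qed
    show "u \<otimes>\<^bsub>racg \<Gamma>\<^esub> racg_step \<Gamma> v s = racg_step \<Gamma> (u \<otimes>\<^bsub>racg \<Gamma>\<^esub> v) s"
      if "u \<in> carrier (racg \<Gamma>)" "v \<in> carrier (racg \<Gamma>)" "s \<in> ?S" for u v s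
      using that gen by (simp add: racg_step_def m_assoc)
  qed auto
qed

text \<open>The subgroup generated by a clique consists of the products of its subsets.\<close>

lemma davis_complex_eq:
  assumes G: "pair_graph \<Gamma>"
  shows "davis_complex \<Gamma> = right_angled.cubes (pverts \<Gamma>) (adjacent \<Gamma>) (carrier (racg \<Gamma>)) (racg_step \<Gamma>)"
proof -
  interpret right_angled_group "racg \<Gamma>" "pverts \<Gamma>" "adjacent \<Gamma>" "racg_step \<Gamma>" "\<lambda>u s. s"
    by (rule racg_right_angled[OF G])
  have gen: "racg_gen \<Gamma> s \<in> carrier (racg \<Gamma>)" "racg_gen \<Gamma> s = racg_step \<Gamma> \<one>\<^bsub>racg \<Gamma>\<^esub> s" if "s \<in> pverts \<Gamma>" for s
  proof -
    show c: "racg_gen \<Gamma> s \<in> carrier (racg \<Gamma>)" 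
      unfolding racg_def racg_gen_def presented_gen_def using that by (intro word_class_carrier) simp
    show "racg_gen \<Gamma> s = racg_step \<Gamma> \<one>\<^bsub>racg \<Gamma>\<^esub> s" unfolding racg_step_def using c by simp
  qed
  have sub: "generate (racg \<Gamma>) (racg_gen \<Gamma> ` T) = cube \<one>\<^bsub>racg \<Gamma>\<^esub> T" if T: "T \<subseteq> pverts \<Gamma>" "pairwise (adjacent \<Gamma>) T" for T
  proof
    have TL: "s \<in> lists (pverts \<Gamma>)" if "s \<in> lists T" for s using that T(1) by auto
    have "x \<in> foldl (racg_step \<Gamma>) \<one>\<^bsub>racg \<Gamma>\<^esub> ` lists T" if "x \<in> generate (racg \<Gamma>) (racg_gen \<Gamma> ` T)" for x
      using that
    proof (induction rule: generate.induct)
      case one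
      then show ?case by (intro image_eqI[of _ _ "[]"]) auto
    next
      case (incl h)
      then obtain s where "s \<in> T" "h = racg_gen \<Gamma> s" by blast
      then show ?case using gen T(1) by (intro image_eqI[of _ _ "[s]"]) auto
    next
      case (inv h)
      then obtain s where s: "s \<in> T" "h = racg_gen \<Gamma> s" by blast
      then have sL: "s \<in> pverts \<Gamma>" using T by blast
      have "h \<otimes>\<^bsub>racg \<Gamma>\<^esub> h = racg_step \<Gamma> (racg_step \<Gamma> \<one>\<^bsub>racg \<Gamma>\<^esub> s) s"
        using s gen(1)[OF sL] by (simp add: racg_step_def)
      then have "h \<otimes>\<^bsub>racg \<Gamma>\<^esub> h = \<one>\<^bsub>racg \<Gamma>\<^esub>" using step_step[OF one_closed sL] by simp
      then have "inv\<^bsub>racg \<Gamma>\<^esub> h = h" using gen(1)[OF sL] s by (intro inv_equality) auto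
      then show ?case using s gen[OF sL] by (intro image_eqI[of _ _ "[s]"]) auto
    next
      case (eng h k)
      then obtain s t where s: "h = foldl (racg_step \<Gamma>) \<one>\<^bsub>racg \<Gamma>\<^esub> s" "s \<in> lists T"
         and t: "k = foldl (racg_step \<Gamma>) \<one>\<^bsub>racg \<Gamma>\<^esub> t" "t \<in> lists T" by (elim imageE)
      have h: "h \<in> carrier (racg \<Gamma>)" using s path_V[OF one_closed TL[OF s(2)]] by simp
      have "h \<otimes>\<^bsub>racg \<Gamma>\<^esub> k = foldl (racg_step \<Gamma>) \<one>\<^bsub>racg \<Gamma>\<^esub> (s @ t)"
        using mult_path[OF h one_closed TL[OF t(2)]] h s(1) t(1) by simp
      then show ?case using s t by (intro image_eqI[of _ _ "s @ t"]) auto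
    qed
    then show "generate (racg \<Gamma>) (racg_gen \<Gamma> ` T) \<subseteq> cube \<one>\<^bsub>racg \<Gamma>\<^esub> T"
      unfolding cube_eq_orbit[OF T one_closed] by blast
    have "foldl (racg_step \<Gamma>) \<one>\<^bsub>racg \<Gamma>\<^esub> s \<in> generate (racg \<Gamma>) (racg_gen \<Gamma> ` T)" if "s \<in> lists T" for s
      using that
    proof (induction s rule: rev_induct)
      case Nil
      then show ?case by (simp add: generate.one)
    next
      case (snoc x s)
      have "racg_gen \<Gamma> x \<in> generate (racg \<Gamma>) (racg_gen \<Gamma> ` T)"
        by (rule generate.incl) (use snoc.prems in auto)
      moreover have "foldl (racg_step \<Gamma>) \<one>\<^bsub>racg \<Gamma>\<^esub> s \<in> generate (racg \<Gamma>) (racg_gen \<Gamma> ` T)"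
        using snoc by auto
      ultimately have "foldl (racg_step \<Gamma>) \<one>\<^bsub>racg \<Gamma>\<^esub> s \<otimes>\<^bsub>racg \<Gamma>\<^esub> racg_gen \<Gamma> x \<in> generate (racg \<Gamma>) (racg_gen \<Gamma> ` T)"
        by (intro generate.eng)
      then show ?case by (simp add: racg_step_def[of _ "foldl (racg_step \<Gamma>) _ _"])
    qed
    then show "cube \<one>\<^bsub>racg \<Gamma>\<^esub> T \<subseteq> generate (racg \<Gamma>) (racg_gen \<Gamma> ` T)"
      unfolding cube_eq_orbit[OF T one_closed] by blast
  qed
  have coset: "w <#\<^bsub>racg \<Gamma>\<^esub> generate (racg \<Gamma>) (racg_gen \<Gamma> ` T) = cube w T"
    if w: "w \<in> carrier (racg \<Gamma>)" and T: "T \<subseteq> pverts \<Gamma>" "pairwise (adjacent \<Gamma>) T" for w T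
  proof -
    have "w \<otimes>\<^bsub>racg \<Gamma>\<^esub> foldl (racg_step \<Gamma>) \<one>\<^bsub>racg \<Gamma>\<^esub> s = foldl (racg_step \<Gamma>) w s" if "s \<in> lists T" for s
    proof -
      have "s \<in> lists (pverts \<Gamma>)" using that T(1) by auto
      then show ?thesis using mult_path[OF w one_closed] w by simp
    qed
    then show ?thesis unfolding sub[OF T] cube_eq_orbit[OF T one_closed] cube_eq_orbit[OF T w] l_coset_def
      by auto
  qed
  show ?thesis unfolding davis_complex_def cubes_def clique_def
    using coset by (intro Collect_cong iff_exI) auto
qed

section \<open>Right-angled Artin groups\<close>

text \<open>The parity of the exponent of \<open>s\<close>: both signs of a letter count alike.\<close>

definition parity :: "'a word set \<Rightarrow> 'a \<Rightarrow> bool" where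
  "parity A s \<longleftrightarrow> (\<exists>w\<in>A. odd (count_list (map fst w) s))"

definition raag_labels :: "'a pair_pre_digraph \<Rightarrow> ('a \<times> bool) set" where
  "raag_labels \<Gamma> = pverts \<Gamma> \<times> UNIV"

definition raag_adj :: "'a pair_pre_digraph \<Rightarrow> 'a \<times> bool \<Rightarrow> 'a \<times> bool \<Rightarrow> bool" where
  "raag_adj \<Gamma> x y \<longleftrightarrow> (fst x, fst y) \<in> parcs \<Gamma>"

text \<open>The edge from \<open>A\<close> to \<open>As\<close> is labelled by \<open>s\<close> and the parity of \<open>s\<close> in \<open>A\<close>. So the label with the parity of \<open>A\<close>
  leads to \<open>As\<close> and the other one leads to \<open>As\<^sup>-\<^sup>1\<close>; as this changes the parity, the same label leads back.\<close>

definition raag_step :: "'a pair_pre_digraph \<Rightarrow> 'a word set \<Rightarrow> 'a \<times> bool \<Rightarrow> 'a word set" where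
  "raag_step \<Gamma> A x = A \<otimes>\<^bsub>raag \<Gamma>\<^esub>
    word_class (pverts \<Gamma>) (raag_rels \<Gamma>) [(fst x, parity A (fst x) = snd x)]"

definition raag_relabel :: "'a word set \<Rightarrow> 'a \<times> bool \<Rightarrow> 'a \<times> bool" where
  "raag_relabel A x = (fst x, parity A (fst x) \<noteq> snd x)"

text \<open>Translates between words in the letters of the group and words in labels. A letter and a label determine each
  other once the current parities \<open>\<pi>\<close> are known, and the same rule works in both directions.\<close>

primrec recode :: "('a \<Rightarrow> bool) \<Rightarrow> ('a \<times> bool) list \<Rightarrow> ('a \<times> bool) list" where
  "recode \<pi> [] = []"
| "recode \<pi> (x # w) = (fst x, \<pi> (fst x) = snd x) # recode (\<pi>(fst x := \<not> \<pi> (fst x))) w"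

lemma recode_fst: "map fst (recode \<pi> w) = map fst w"
  by (induction w arbitrary: \<pi>) auto

lemma recode_recode: "recode \<pi> (recode \<pi> w) = w"
  by (induction w arbitrary: \<pi>) auto

lemma recode_append:
  "recode \<pi> (u @ v) = recode \<pi> u @ recode (\<lambda>s. \<pi> s \<noteq> odd (count_list (map fst u) s)) v"
proof (induction u arbitrary: \<pi>)
  case (Cons x u)
  have "(\<lambda>s. (\<pi>(fst x := \<not> \<pi> (fst x))) s \<noteq> odd (count_list (map fst u) s))
    = (\<lambda>s. \<pi> s \<noteq> odd (count_list (map fst (x # u)) s))" by (rule ext) auto
  then have "recode (\<pi>(fst x := \<not> \<pi> (fst x))) (u @ v) = recode (\<pi>(fst x := \<not> \<pi> (fst x))) u
      @ recode (\<lambda>s. \<pi> s \<noteq> odd (count_list (map fst (x # u)) s)) v"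
    unfolding Cons[of "\<pi>(fst x := \<not> \<pi> (fst x))"] by (rule arg_cong)
  then show ?case by (simp only: append_Cons recode.simps)
qed simp

lemma recode_lists: "recode \<pi> w \<in> lists (S \<times> UNIV) \<longleftrightarrow> w \<in> lists (S \<times> UNIV)"
  by (induction w arbitrary: \<pi>) (auto simp: mem_Times_iff)

lemma raag_parity:
  "(v, w) \<in> pres_rel S (raag_rels \<Gamma>) \<Longrightarrow> odd (count_list (map fst v) s) = odd (count_list (map fst w) s)"
proof (induction rule: pres_rel.induct)
  case (rel u v l r)
  then obtain a b where "l = [(a, True), (b, True)]" "r = [(b, True), (a, True)]"
    by (auto simp: raag_rels_def)
  then have "count_list (map fst l) s = count_list (map fst r) s" by simp
  then show ?case by simp
qed auto

lemma parity_class: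
  assumes "w \<in> words S"
  shows "parity (word_class S (raag_rels \<Gamma>) w) s = odd (count_list (map fst w) s)"
  using raag_parity[of w _ S \<Gamma> s] pres_rel.refl[OF assms, of "raag_rels \<Gamma>"] unfolding parity_def by blast

text \<open>A letter followed by its inverse gives the same label twice, as the parity has changed in between. Commuting letters
  are distinct, so neither changes the parity that determines the label of the other.\<close>

lemma raag_word_eq:
  assumes G: "pair_graph \<Gamma>" and "(v, w) \<in> pres_rel (pverts \<Gamma>) (raag_rels \<Gamma>)"
  shows "word_eq (raag_labels \<Gamma>) (raag_adj \<Gamma>) (recode \<pi> v) (recode \<pi> w)"
  using assms(2)
proof (induction arbitrary: \<pi> rule: pres_rel.induct)
  case (refl w)
  then show ?case by (intro word_eq.word_refl) (simp add: raag_labels_def recode_lists words_def)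
next
  case (sym v w)
  show ?case using sym.IH by (rule word_eq.word_sym)
next
  case (trans u v w)
  show ?case using trans.IH by (rule word_eq.word_trans)
next
  case (cancel u v s b)
  let ?\<pi> = "\<lambda>t. \<pi> t \<noteq> odd (count_list (map fst u) t)"
  have L: "recode \<pi> u \<in> lists (raag_labels \<Gamma>)" "recode ?\<pi> v \<in> lists (raag_labels \<Gamma>)" "(s, ?\<pi> s = b) \<in> raag_labels \<Gamma>"
    using cancel by (simp_all add: raag_labels_def recode_lists words_def)
  have e: "?\<pi>(s := \<not> ?\<pi> s, s := \<not> (?\<pi>(s := \<not> ?\<pi> s)) s) = ?\<pi>" by auto
  have "recode \<pi> (u @ [(s, b), (s, \<not> b)] @ v) = recode \<pi> u @ [(s, ?\<pi> s = b), (s, ?\<pi> s = b)] @ recode ?\<pi> v"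
    unfolding recode_append by (simp add: e) (auto simp: fun_upd_def)
  moreover have "recode \<pi> (u @ v) = recode \<pi> u @ recode ?\<pi> v" by (rule recode_append)
  ultimately show ?case using word_eq.cancel[OF L, of "raag_adj \<Gamma>"] by simp
next
  case (rel u v l r)
  let ?\<pi> = "\<lambda>t. \<pi> t \<noteq> odd (count_list (map fst u) t)"
  obtain s t where lr: "l = [(s, True), (t, True)]" "r = [(t, True), (s, True)]" "(s, t) \<in> parcs \<Gamma>"
    using rel(5) by (auto simp: raag_rels_def)
  have st: "s \<noteq> t" using lr(3) pair_graph_facts(4)[OF G] by blast
  let ?\<pi>2 = "?\<pi>(s := \<not> ?\<pi> s, t := \<not> ?\<pi> t)"
  have L: "recode \<pi> u \<in> lists (raag_labels \<Gamma>)" "recode ?\<pi>2 v \<in> lists (raag_labels \<Gamma>)"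
    using rel by (simp_all add: raag_labels_def recode_lists words_def)
  have a: "raag_adj \<Gamma> (s, ?\<pi> s = True) (t, ?\<pi> t = True)" using lr(3) by (simp add: raag_adj_def)
  have "recode \<pi> (u @ l @ v) = recode \<pi> u @ [(s, ?\<pi> s = True), (t, ?\<pi> t = True)] @ recode ?\<pi>2 v"
    unfolding recode_append[of \<pi> u] lr using st by simp
  moreover have "recode \<pi> (u @ r @ v) = recode \<pi> u @ [(t, ?\<pi> t = True), (s, ?\<pi> s = True)] @ recode ?\<pi>2 v"
    unfolding recode_append[of \<pi> u] lr using st by (simp add: fun_upd_twist)
  ultimately show ?case
    using word_eq.swap[where adj = "raag_adj \<Gamma>" and x = "(s, ?\<pi> s = True)" and y = "(t, ?\<pi> t = True)", OF L a]
    by simp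
qed

lemma raag_step_class:
  assumes "w \<in> words (pverts \<Gamma>)" "s \<in> pverts \<Gamma>"
  shows "raag_step \<Gamma> (word_class (pverts \<Gamma>) (raag_rels \<Gamma>) w) (s, p)
    = word_class (pverts \<Gamma>) (raag_rels \<Gamma>) (w @ [(s, odd (count_list (map fst w) s) = p)])"
  unfolding raag_step_def raag_def parity_class[OF assms(1)] fst_conv snd_conv
  by (rule presented_mult) (use assms in simp_all)

lemma raag_path_class:
  assumes "w \<in> words (pverts \<Gamma>)" "l \<in> lists (raag_labels \<Gamma>)"
  shows "foldl (raag_step \<Gamma>) (word_class (pverts \<Gamma>) (raag_rels \<Gamma>) w) l
    = word_class (pverts \<Gamma>) (raag_rels \<Gamma>) (w @ recode (\<lambda>s. odd (count_list (map fst w) s)) l)"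
  using assms(2,1)
proof (induction l arbitrary: w rule: list.induct)
  case (Cons x l)
  obtain s p where x: "x = (s, p)" by fastforce
  have s: "s \<in> pverts \<Gamma>" "l \<in> lists (raag_labels \<Gamma>)" using Cons.prems x by (auto simp: raag_labels_def)
  let ?w = "w @ [(s, odd (count_list (map fst w) s) = p)]"
  have "(\<lambda>t. odd (count_list (map fst ?w) t)) 
    = (\<lambda>t. odd (count_list (map fst w) t))(s := \<not> odd (count_list (map fst w) s))" by (rule ext) auto
  moreover have "?w \<in> words (pverts \<Gamma>)" using Cons.prems s by simp
  ultimately show ?case
    using Cons.IH[OF s(2), of ?w] raag_step_class[OF Cons.prems(2) s(1), of p] x by simp
qed simp

lemma raag_commute:
  assumes G: "pair_graph \<Gamma>" and "adjacent \<Gamma> s t"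
  shows "([(s, True), (t, True)], [(t, True), (s, True)]) \<in> pres_rel (pverts \<Gamma>) (raag_rels \<Gamma>)"
  using assms pair_graph_facts(2,3)[OF G] by (intro relI) (auto simp: raag_rels_def)

lemma raag_right_angled:
  assumes G: "pair_graph \<Gamma>"
  shows "right_angled_group (raag \<Gamma>) (raag_labels \<Gamma>) (raag_adj \<Gamma>) (raag_step \<Gamma>) raag_relabel"
proof -
  let ?S = "pverts \<Gamma>" and ?R = "raag_rels \<Gamma>" and ?L = "raag_labels \<Gamma>"
  note gr = pair_graph_facts[OF G]
  interpret group "raag \<Gamma>" unfolding raag_def by (rule group_presented_group)
  have carr: "word_class ?S ?R w \<in> carrier (raag \<Gamma>)" if "w \<in> words ?S" for w
    unfolding raag_def using that by (rule word_class_carrier)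
  have carrE: "\<exists>w\<in>words ?S. A = word_class ?S ?R w" if "A \<in> carrier (raag \<Gamma>)" for A
    using that unfolding raag_def by (elim carrier_presented) blast
  have one: "\<one>\<^bsub>raag \<Gamma>\<^esub> = word_class ?S ?R []" unfolding raag_def by (rule one_presented)
  have mult: "word_class ?S ?R u \<otimes>\<^bsub>raag \<Gamma>\<^esub> word_class ?S ?R v = word_class ?S ?R (u @ v)"
    if "u \<in> words ?S" "v \<in> words ?S" for u v unfolding raag_def using that by (rule presented_mult)
  have lab: "x \<in> ?L \<longleftrightarrow> fst x \<in> ?S" for x by (simp add: raag_labels_def mem_Times_iff)
  show ?thesis
  proof
    show "finite ?L" using gr(1) by (simp add: raag_labels_def)
    show "x \<in> ?L" if "raag_adj \<Gamma> x y" for x y using gr(2) that by (simp add: raag_adj_def lab)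
    show "raag_adj \<Gamma> y x" if "raag_adj \<Gamma> x y" for x y using gr(3) that by (simp add: raag_adj_def)
    show "\<not> raag_adj \<Gamma> x x" for x using gr(4) by (simp add: raag_adj_def)
    show "\<one>\<^bsub>raag \<Gamma>\<^esub> \<in> carrier (raag \<Gamma>)" by simp
    show "raag_step \<Gamma> v x \<in> carrier (raag \<Gamma>)" if "v \<in> carrier (raag \<Gamma>)" "x \<in> ?L" for v x
      using that carr by (simp add: raag_step_def lab)
    show "raag_step \<Gamma> (raag_step \<Gamma> v x) x = v" if v: "v \<in> carrier (raag \<Gamma>)" and x: "x \<in> ?L" for v x
    proof -
      obtain w where w: "w \<in> words ?S" "v = word_class ?S ?R w" using carrE[OF v] by blast
      obtain s p where sp: "x = (s, p)" "s \<in> ?S" using x by (cases x) (simp add: lab)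
      define b where "b = (odd (count_list (map fst w) s) = p)"
      have "(w @ [(s, b), (s, \<not> b)], w) \<in> pres_rel ?S ?R"
        using pres_rel_context[OF cancelI[OF sp(2), of b] w(1) words_Nil] by simp
      moreover have "raag_step \<Gamma> v x = word_class ?S ?R (w @ [(s, b)])"
        using raag_step_class[OF w(1) sp(2), of p] w sp b_def by simp
      moreover have "raag_step \<Gamma> (word_class ?S ?R (w @ [(s, b)])) x = word_class ?S ?R (w @ [(s, b), (s, \<not> b)])"
        using raag_step_class[of "w @ [(s, b)]" \<Gamma> s p] w sp b_def by auto
      ultimately show ?thesis using w sp by (simp add: word_class_eq_iff)
    qed
    show "raag_step \<Gamma> (raag_step \<Gamma> v x) y = raag_step \<Gamma> (raag_step \<Gamma> v y) x"
      if v: "v \<in> carrier (raag \<Gamma>)" and xy: "raag_adj \<Gamma> x y" for v x y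
    proof -
      obtain w where w: "w \<in> words ?S" "v = word_class ?S ?R w" using carrE[OF v] by blast
      obtain s p t q where x: "x = (s, p)" and y: "y = (t, q)" by fastforce
      have st: "adjacent \<Gamma> s t" using xy x y by (simp add: raag_adj_def)
      then have S: "s \<in> ?S" "t \<in> ?S" "s \<noteq> t" using gr by blast+
      define b where "b = (odd (count_list (map fst w) s) = p)"
      define c where "c = (odd (count_list (map fst w) t) = q)"
      have "(w @ [(s, b), (t, c)], w @ [(t, c), (s, b)]) \<in> pres_rel ?S ?R"
        using pres_rel_context[OF letters_commute[OF S(1,2) raag_commute[OF G st]] w(1) words_Nil] by simp
      then have eq: "word_class ?S ?R (w @ [(s, b), (t, c)]) = word_class ?S ?R (w @ [(t, c), (s, b)])"
        using w S by (simp add: word_class_eq_iff)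
      have "raag_step \<Gamma> (raag_step \<Gamma> v x) y = word_class ?S ?R (w @ [(s, b), (t, c)])"
        using raag_step_class[OF w(1) S(1), of p] raag_step_class[of "w @ [(s, b)]" \<Gamma> t q] w S x y b_def c_def by simp
      moreover have "raag_step \<Gamma> (raag_step \<Gamma> v y) x = word_class ?S ?R (w @ [(t, c), (s, b)])"
        using raag_step_class[OF w(1) S(2), of q] raag_step_class[of "w @ [(t, c)]" \<Gamma> s p] w S x y b_def c_def by simp
      ultimately show ?thesis using eq by simp
    qed
    show "\<exists>l\<in>lists ?L. v = foldl (raag_step \<Gamma>) \<one>\<^bsub>raag \<Gamma>\<^esub> l" if v: "v \<in> carrier (raag \<Gamma>)" for v
    proof -
      obtain w where w: "w \<in> words ?S" "v = word_class ?S ?R w" using carrE[OF v] by blast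
      have l: "recode (\<lambda>s. False) w \<in> lists ?L" using w(1) by (simp add: raag_labels_def recode_lists words_def)
      show ?thesis using raag_path_class[OF words_Nil l] w by (intro bexI[OF _ l]) (simp add: one recode_recode)
    qed
    show "word_eq ?L (raag_adj \<Gamma>) u w"
      if u: "u \<in> lists ?L" and w: "w \<in> lists ?L"
        and eq: "foldl (raag_step \<Gamma>) \<one>\<^bsub>raag \<Gamma>\<^esub> u = foldl (raag_step \<Gamma>) \<one>\<^bsub>raag \<Gamma>\<^esub> w" for u w
    proof -
      have W: "recode (\<lambda>s. False) u \<in> words ?S" "recode (\<lambda>s. False) w \<in> words ?S"
        using u w by (simp_all add: raag_labels_def recode_lists words_def)
      have "word_class ?S ?R (recode (\<lambda>s. False) u) = word_class ?S ?R (recode (\<lambda>s. False) w)"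
        using eq raag_path_class[OF words_Nil u] raag_path_class[OF words_Nil w] by (simp add: one)
      then have "(recode (\<lambda>s. False) u, recode (\<lambda>s. False) w) \<in> pres_rel ?S ?R"
        using W by (simp only: word_class_eq_iff)
      from raag_word_eq[OF G this, of "\<lambda>s. False"] show ?thesis by (simp add: recode_recode)
    qed
    show "raag_relabel u x \<in> ?L" if "u \<in> carrier (raag \<Gamma>)" "x \<in> ?L" for u x
      using that by (simp add: raag_relabel_def lab)
    show "raag_adj \<Gamma> (raag_relabel u x) (raag_relabel u y)" if "u \<in> carrier (raag \<Gamma>)" "raag_adj \<Gamma> x y" for u x y
      using that by (simp add: raag_relabel_def raag_adj_def)
    show "u \<otimes>\<^bsub>raag \<Gamma>\<^esub> raag_step \<Gamma> v x = raag_step \<Gamma> (u \<otimes>\<^bsub>raag \<Gamma>\<^esub> v) (raag_relabel u x)"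
      if u: "u \<in> carrier (raag \<Gamma>)" and v: "v \<in> carrier (raag \<Gamma>)" and x: "x \<in> ?L" for u v x
    proof -
      obtain a where a: "a \<in> words ?S" "u = word_class ?S ?R a" using carrE[OF u] by blast
      obtain b where b: "b \<in> words ?S" "v = word_class ?S ?R b" using carrE[OF v] by blast
      obtain s p where sp: "x = (s, p)" "s \<in> ?S" using x by (cases x) (simp add: lab)
      have "u \<otimes>\<^bsub>raag \<Gamma>\<^esub> raag_step \<Gamma> v x = word_class ?S ?R (a @ b @ [(s, odd (count_list (map fst b) s) = p)])"
        using raag_step_class[OF b(1) sp(2), of p] a b sp mult by simp
      moreover have "raag_step \<Gamma> (u \<otimes>\<^bsub>raag \<Gamma>\<^esub> v) (raag_relabel u x)
        = word_class ?S ?R ((a @ b) @ [(s, odd (count_list (map fst (a @ b)) s) = (odd (count_list (map fst a) s) \<noteq> p))])"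
        using raag_step_class[of "a @ b" \<Gamma> s] a b sp mult parity_class[OF a(1)] by (simp add: raag_relabel_def)
      moreover have "(odd (count_list (map fst (a @ b)) s) = (odd (count_list (map fst a) s) \<noteq> p))
        = (odd (count_list (map fst b) s) = p)" by auto
      ultimately show ?thesis by simp
    qed
    show "raag_relabel (foldl (raag_step \<Gamma>) \<one>\<^bsub>raag \<Gamma>\<^esub> (w @ w)) x = x" if w: "w \<in> lists ?L" and "x \<in> ?L" for w x
    proof -
      have ww: "w @ w \<in> lists ?L" using w by auto
      then have W: "recode (\<lambda>s. False) (w @ w) \<in> words ?S"
        by (simp only: raag_labels_def recode_lists words_def)
      have "foldl (raag_step \<Gamma>) \<one>\<^bsub>raag \<Gamma>\<^esub> (w @ w) = word_class ?S ?R (recode (\<lambda>s. False) (w @ w))"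
        using raag_path_class[OF words_Nil ww] by (simp add: one)
      then have "parity (foldl (raag_step \<Gamma>) \<one>\<^bsub>raag \<Gamma>\<^esub> (w @ w)) (fst x) = False"
        using parity_class[OF W, of \<Gamma> "fst x"] by (simp add: recode_fst)
      then show ?thesis by (simp add: raag_relabel_def)
    qed
  qed
qed

text \<open>As long as no letter is repeated, the labels that carry the initial parities are those of the positive letters.\<close>

lemma recode_distinct:
  "distinct ss \<Longrightarrow> \<forall>s\<in>set ss. \<pi> s = p s \<Longrightarrow> recode \<pi> (map (\<lambda>s. (s, p s)) ss) = positive ss"
proof (induction ss arbitrary: \<pi>)
  case (Cons s ss)
  then have "\<forall>t\<in>set ss. (\<pi>(s := \<not> \<pi> s)) t = p t" by auto
  then have "recode (\<pi>(s := \<not> \<pi> s)) (map (\<lambda>s. (s, p s)) ss) = positive ss"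
    using Cons.IH Cons.prems(1) by simp
  then show ?case using Cons.prems(2) by simp
qed simp

text \<open>The cube of the torus at \<open>g\<close> is spanned by the labels with the parities of \<open>g\<close>. A clique of labels contains each
  generator at most once, and moving within the cube to the vertex with matching parities brings every
  cube into this form.\<close>

lemma salvetti_eq:
  assumes G: "pair_graph \<Gamma>"
  shows "salvetti_universal_cover \<Gamma>
    = right_angled.cubes (raag_labels \<Gamma>) (raag_adj \<Gamma>) (carrier (raag \<Gamma>)) (raag_step \<Gamma>)"
proof -
  let ?S = "pverts \<Gamma>" and ?R = "raag_rels \<Gamma>" and ?L = "raag_labels \<Gamma>"
  interpret right_angled_group "raag \<Gamma>" ?L "raag_adj \<Gamma>" "raag_step \<Gamma>" raag_relabel
    by (rule raag_right_angled[OF G])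
  note gr = pair_graph_facts[OF G]
  define P where "P T = {foldr (\<lambda>s x. raag_gen \<Gamma> s \<otimes>\<^bsub>raag \<Gamma>\<^esub> x) ss \<one>\<^bsub>raag \<Gamma>\<^esub> | ss. distinct ss \<and> set ss \<subseteq> T}" for T
  define lift where "lift g T = (\<lambda>s. (s, parity g s)) ` T" for g :: "'a word set" and T
  have prod: "foldr (\<lambda>s x. raag_gen \<Gamma> s \<otimes>\<^bsub>raag \<Gamma>\<^esub> x) ss \<one>\<^bsub>raag \<Gamma>\<^esub> = word_class ?S ?R (positive ss)"
    if "ss \<in> lists ?S" for ss
    using that
  proof (induction ss rule: list.induct)
    case Nil
    then show ?case by (simp add: raag_def one_presented)
  next
    case (Cons s ss)
    then show ?case
      using presented_mult[of "[(s, True)]" ?S "positive ss" ?R]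
      by (simp add: raag_gen_def presented_gen_def raag_def positive_words)
  qed
  have cube_lift: "g <#\<^bsub>raag \<Gamma>\<^esub> P T = cube g (lift g T)" if g: "g \<in> carrier (raag \<Gamma>)" and T: "T \<subseteq> ?S" for g T
  proof -
    obtain w where w: "w \<in> words ?S" "g = word_class ?S ?R w"
      using g unfolding raag_def by (rule carrier_presented)
    have par: "parity g s = odd (count_list (map fst w) s)" for s using parity_class[OF w(1)] w(2) by simp
    have val: "g \<otimes>\<^bsub>raag \<Gamma>\<^esub> foldr (\<lambda>s x. raag_gen \<Gamma> s \<otimes>\<^bsub>raag \<Gamma>\<^esub> x) ss \<one>\<^bsub>raag \<Gamma>\<^esub>
      = path g (map (\<lambda>s. (s, parity g s)) ss)" if ss: "distinct ss" "set ss \<subseteq> T" for ss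
    proof -
      have S: "ss \<in> lists ?S" using ss T by auto
      have L: "map (\<lambda>s. (s, parity g s)) ss \<in> lists ?L" using S by (auto simp: raag_labels_def)
      have "path g (map (\<lambda>s. (s, parity g s)) ss) = word_class ?S ?R (w @ positive ss)"
        using raag_path_class[OF w(1) L] recode_distinct[OF ss(1), of "\<lambda>s. odd (count_list (map fst w) s)" "parity g"] par w(2)
        by simp
      then show ?thesis
        using prod[OF S] presented_mult[OF w(1), of "positive ss" ?R] S w(2)
        by (simp add: positive_words raag_def)
    qed
    have lists: "(\<exists>ss. distinct ss \<and> set ss \<subseteq> T \<and> ts = map (\<lambda>s. (s, parity g s)) ss) \<longleftrightarrow> distinct ts \<and> set ts \<subseteq> lift g T" for ts
    proof
      assume "\<exists>ss. distinct ss \<and> set ss \<subseteq> T \<and> ts = map (\<lambda>s. (s, parity g s)) ss"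
      then obtain ss where ss: "distinct ss" "set ss \<subseteq> T" "ts = map (\<lambda>s. (s, parity g s)) ss"
        by (elim exE conjE)
      then show "distinct ts \<and> set ts \<subseteq> lift g T"
        unfolding lift_def by (simp add: distinct_map inj_on_def image_mono)
    next
      assume ts: "distinct ts \<and> set ts \<subseteq> lift g T"
      have x: "snd x = parity g (fst x)" "fst x \<in> T" if "x \<in> set ts" for x
        using ts that by (auto simp: lift_def)
      then have "ts = map (\<lambda>s. (s, parity g s)) (map fst ts)"
        by (simp add: map_idI[symmetric] prod_eq_iff)
      moreover have "distinct (map fst ts)"
        unfolding distinct_map inj_on_def using ts x(1) by (simp add: prod_eq_iff)
      moreover have "set (map fst ts) \<subseteq> T" using x(2) by auto
      ultimately show "\<exists>ss. distinct ss \<and> set ss \<subseteq> T \<and> ts = map (\<lambda>s. (s, parity g s)) ss" by blast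
    qed
    let ?D = "{ss. distinct ss \<and> set ss \<subseteq> T}"
    have "g <#\<^bsub>raag \<Gamma>\<^esub> P T
      = (\<lambda>ss. g \<otimes>\<^bsub>raag \<Gamma>\<^esub> foldr (\<lambda>s x. raag_gen \<Gamma> s \<otimes>\<^bsub>raag \<Gamma>\<^esub> x) ss \<one>\<^bsub>raag \<Gamma>\<^esub>) ` ?D"
      unfolding l_coset_def P_def by auto
    also have "\<dots> = (\<lambda>ss. path g (map (\<lambda>s. (s, parity g s)) ss)) ` ?D"
      by (rule image_cong[OF HOL.refl]) (use val in simp)
    also have "\<dots> = path g ` map (\<lambda>s. (s, parity g s)) ` ?D" by (simp only: image_image)
    also have "map (\<lambda>s. (s, parity g s)) ` ?D = {ts. distinct ts \<and> set ts \<subseteq> lift g T}"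
      unfolding lists[symmetric] by auto
    also have "path g ` {ts. distinct ts \<and> set ts \<subseteq> lift g T} = cube g (lift g T)"
      unfolding cube_def by (simp only: setcompr_eq_image)
    finally show ?thesis .
  qed
  have lift_clique: "lift g T \<subseteq> ?L" "pairwise (raag_adj \<Gamma>) (lift g T)" if "clique \<Gamma> T" for g T
    using that by (auto simp: lift_def clique_def raag_labels_def raag_adj_def pairwise_def)
  show ?thesis
  proof
    show "salvetti_universal_cover \<Gamma> \<subseteq> cubes"
    proof
      fix Q assume "Q \<in> salvetti_universal_cover \<Gamma>"
      then obtain g T where Q: "Q = g <#\<^bsub>raag \<Gamma>\<^esub> P T" "g \<in> carrier (raag \<Gamma>)" "clique \<Gamma> T"
        unfolding salvetti_universal_cover_def P_def by blast
      then have "Q = cube g (lift g T)" using cube_lift by (simp add: clique_def)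
      then show "Q \<in> cubes" using cube_in_cubes[OF Q(2) lift_clique[OF Q(3)]] by simp
    qed
    show "cubes \<subseteq> salvetti_universal_cover \<Gamma>"
    proof
      fix Q assume "Q \<in> cubes"
      then obtain g T where Q: "Q = cube g T" "g \<in> carrier (raag \<Gamma>)" "T \<subseteq> ?L" "pairwise (raag_adj \<Gamma>) T"
        by (rule cubesE)
      have uniq: "p = q" if "(s, p) \<in> T" "(s, q) \<in> T" for s p q
        using Q(4) that gr(4) unfolding pairwise_def raag_adj_def by fastforce
      have "finite T" using Q(3) finite_L finite_subset by blast
      then have "finite {x \<in> T. snd x \<noteq> parity g (fst x)}" by simp
      then obtain l where l: "set l = {x \<in> T. snd x \<noteq> parity g (fst x)}" "distinct l"
        using finite_distinct_list by blast
      have lT: "l \<in> lists T" using l by auto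
      then have lL: "l \<in> lists ?L" using Q(3) by auto
      define g' where "g' = path g l"
      have g': "g' \<in> carrier (raag \<Gamma>)" using path_V[OF Q(2) lL] by (simp add: g'_def)
      obtain w where w: "w \<in> words ?S" "g = word_class ?S ?R w"
        using Q(2) unfolding raag_def by (rule carrier_presented)
      let ?r = "recode (\<lambda>s. odd (count_list (map fst w) s)) l"
      have r: "?r \<in> words ?S" using lL by (simp add: words_def raag_labels_def recode_lists)
      have par: "parity g' s = (parity g s \<noteq> odd (count_list (map fst l) s))" for s
        using parity_class[of "w @ ?r" ?S \<Gamma> s] parity_class[OF w(1), of \<Gamma> s] raag_path_class[OF w(1) lL] w r
        by (simp add: g'_def recode_fst)
      have inj: "distinct (map fst l)"
        using l uniq by (auto simp: distinct_map inj_on_def)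
      have par': "parity g' s = p" if "(s, p) \<in> T" for s p
      proof (cases "parity g s = p")
        case True
        then have "s \<notin> set (map fst l)" using l(1) uniq that by fastforce
        then show ?thesis using par True by simp
      next
        case False
        then have "(s, p) \<in> set l" using l(1) that by simp
        then have "s \<in> set (map fst l)" by (metis fst_conv image_eqI set_map)
        then have "count_list (map fst l) s = 1" using count_list_distinct[OF inj] by blast
        then show ?thesis using par False by auto
      qed
      have T: "T = lift g' (fst ` T)"
      proof -
        have "x = (fst x, parity g' (fst x))" if "x \<in> T" for x using par'[of "fst x" "snd x"] that by (cases x) simp
        then show ?thesis unfolding lift_def by force
      qed
      have cl: "clique \<Gamma> (fst ` T)"
        unfolding clique_def pairwise_def
      proof (intro conjI ballI impI)
        show "fst ` T \<subseteq> ?S" using Q(3) by (auto simp: raag_labels_def)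
        fix s t assume "s \<in> fst ` T" "t \<in> fst ` T" "s \<noteq> t"
        then show "(s, t) \<in> parcs \<Gamma>" using Q(4) unfolding pairwise_def raag_adj_def by fastforce
      qed
      have "Q = cube g' T" using cube_move[OF Q(3,4,2) lT] Q(1) by (simp add: g'_def)
      also have "\<dots> = cube g' (lift g' (fst ` T))" using T by simp
      also have "\<dots> = g' <#\<^bsub>raag \<Gamma>\<^esub> P (fst ` T)" using cube_lift[OF g'] cl by (simp add: clique_def)
      finally show "Q \<in> salvetti_universal_cover \<Gamma>"
        unfolding salvetti_universal_cover_def P_def using g' cl by blast
    qed
  qed
qed

section \<open>Joins and splittings\<close>

text \<open>The two labels of one generator are not adjacent, hence they lie in the same part of a join.\<close>

lemma joined_labels:
  assumes G: "pair_graph \<Gamma>"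
  shows "joined (raag_labels \<Gamma>) (raag_adj \<Gamma>) \<longleftrightarrow> joined (pverts \<Gamma>) (adjacent \<Gamma>)"
proof
  assume "joined (raag_labels \<Gamma>) (raag_adj \<Gamma>)"
  then obtain A B where AB: "A \<noteq> {}" "B \<noteq> {}" "A \<union> B = raag_labels \<Gamma>" "\<forall>a\<in>A. \<forall>b\<in>B. raag_adj \<Gamma> a b"
    unfolding joined_def by (elim exE conjE)
  have adj: "(s, t) \<in> parcs \<Gamma>" if "s \<in> fst ` A" "t \<in> fst ` B" for s t
    using AB(4) that by (auto simp: raag_adj_def)
  have "fst ` A \<union> fst ` B = pverts \<Gamma>"
    unfolding image_Un[symmetric] AB(3) by (simp add: raag_labels_def)
  moreover have "fst ` A \<inter> fst ` B = {}" using adj pair_graph_facts(4)[OF G] by blast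
  ultimately show "joined (pverts \<Gamma>) (adjacent \<Gamma>)" unfolding joined_def
    using AB(1,2) adj by (intro exI[of _ "fst ` A"] exI[of _ "fst ` B"]) simp
next
  assume "joined (pverts \<Gamma>) (adjacent \<Gamma>)"
  then obtain A B where AB: "A \<noteq> {}" "B \<noteq> {}" "A \<inter> B = {}" "A \<union> B = pverts \<Gamma>" "\<forall>a\<in>A. \<forall>b\<in>B. adjacent \<Gamma> a b"
    unfolding joined_def by (elim exE conjE)
  show "joined (raag_labels \<Gamma>) (raag_adj \<Gamma>)" unfolding joined_def
  proof (intro exI conjI)
    show "A \<times> (UNIV :: bool set) \<noteq> {}" "B \<times> (UNIV :: bool set) \<noteq> {}" using AB by auto
    show "A \<times> UNIV \<inter> B \<times> UNIV = {}" "A \<times> UNIV \<union> B \<times> UNIV = raag_labels \<Gamma>"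
      using AB(3,4) by (auto simp: raag_labels_def)
    show "\<forall>a\<in>A \<times> UNIV. \<forall>b\<in>B \<times> UNIV. raag_adj \<Gamma> a b" using AB(5) by (auto simp: raag_adj_def)
  qed
qed

lemma racg_joined_splits:
  assumes G: "pair_graph \<Gamma>" and "joined (pverts \<Gamma>) (adjacent \<Gamma>)"
  shows "splits_as_direct_product (racg \<Gamma>)"
proof -
  interpret right_angled_group "racg \<Gamma>" "pverts \<Gamma>" "adjacent \<Gamma>" "racg_step \<Gamma>" "\<lambda>u s. s"
    by (rule racg_right_angled[OF G])
  obtain A B where AB: "A \<noteq> {}" "B \<noteq> {}" "A \<inter> B = {}" "A \<union> B = pverts \<Gamma>" "\<forall>a\<in>A. \<forall>b\<in>B. adjacent \<Gamma> a b"
    using assms(2) unfolding joined_def by (elim exE conjE)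
  obtain a b where ab: "a \<in> A" "b \<in> B" using AB(1,2) by blast
  have nt: "([(s, True)], []) \<notin> pres_rel (pverts \<Gamma>) (racg_rels \<Gamma>)" if "s \<in> pverts \<Gamma>" for s
  proof -
    have "racg_step \<Gamma> \<one>\<^bsub>racg \<Gamma>\<^esub> s \<noteq> \<one>\<^bsub>racg \<Gamma>\<^esub>" using step_neq[OF one_closed that] .
    then show ?thesis using racg_step_class[OF words_Nil that] that
      by (simp add: racg_def one_presented word_class_eq_iff)
  qed
  have filt: "(filter (\<lambda>x. fst x \<in> A) l, filter (\<lambda>x. fst x \<in> A) r) \<in> pres_rel (pverts \<Gamma>) (racg_rels \<Gamma>)"
    if lr: "(l, r) \<in> racg_rels \<Gamma>" "l \<in> words (pverts \<Gamma>)" "r \<in> words (pverts \<Gamma>)" for l r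
  proof -
    have P: "(l, r) \<in> pres_rel (pverts \<Gamma>) (racg_rels \<Gamma>)" using lr by (rule relI)
    consider s where "l = [(s, True), (s, True)]" "r = []" |
      s t where "l = [(s, True), (t, True)]" "r = [(t, True), (s, True)]"
      using lr(1) by (auto simp: racg_rels_def raag_rels_def)
    then show ?thesis
    proof cases
      case 1
      then show ?thesis using P by (simp add: pres_rel.refl)
    next
      case 2
      then show ?thesis using P lr(2) by (simp add: pres_rel.refl)
    qed
  qed
  have "a \<in> pverts \<Gamma>" "b \<in> pverts \<Gamma>" using ab AB(4) by blast+
  then show ?thesis unfolding racg_def
    using presented_group_splits[OF AB(4,3) _ filt ab(1) nt ab(2) nt] racg_commute[OF G] AB(5) by blast
qed

lemma raag_joined_splits:
  assumes G: "pair_graph \<Gamma>" and "joined (pverts \<Gamma>) (adjacent \<Gamma>)"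
  shows "splits_as_direct_product (raag \<Gamma>)"
proof -
  interpret right_angled_group "raag \<Gamma>" "raag_labels \<Gamma>" "raag_adj \<Gamma>" "raag_step \<Gamma>" raag_relabel
    by (rule raag_right_angled[OF G])
  obtain A B where AB: "A \<noteq> {}" "B \<noteq> {}" "A \<inter> B = {}" "A \<union> B = pverts \<Gamma>" "\<forall>a\<in>A. \<forall>b\<in>B. adjacent \<Gamma> a b"
    using assms(2) unfolding joined_def by (elim exE conjE)
  obtain a b where ab: "a \<in> A" "b \<in> B" using AB(1,2) by blast
  have nt: "([(s, True)], []) \<notin> pres_rel (pverts \<Gamma>) (raag_rels \<Gamma>)" if "s \<in> pverts \<Gamma>" for s
    using raag_parity[of "[(s, True)]" "[]" "pverts \<Gamma>" \<Gamma> s] by auto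
  have filt: "(filter (\<lambda>x. fst x \<in> A) l, filter (\<lambda>x. fst x \<in> A) r) \<in> pres_rel (pverts \<Gamma>) (raag_rels \<Gamma>)"
    if lr: "(l, r) \<in> raag_rels \<Gamma>" "l \<in> words (pverts \<Gamma>)" "r \<in> words (pverts \<Gamma>)" for l r
  proof -
    have "(l, r) \<in> pres_rel (pverts \<Gamma>) (raag_rels \<Gamma>)" using lr by (rule relI)
    moreover obtain s t where "l = [(s, True), (t, True)]" "r = [(t, True), (s, True)]"
      using lr(1) by (auto simp: raag_rels_def)
    ultimately show ?thesis using lr(2) by (simp add: pres_rel.refl)
  qed
  have "a \<in> pverts \<Gamma>" "b \<in> pverts \<Gamma>" using ab AB(4) by blast+
  then show ?thesis unfolding raag_def
    using presented_group_splits[OF AB(4,3) _ filt ab(1) nt ab(2) nt] raag_commute[OF G] AB(5) by blast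
qed

theorem theorem4:
  fixes \<Gamma> :: "'a pair_pre_digraph"
  assumes "pair_graph \<Gamma>"
  shows "(infinite (carrier (racg \<Gamma>)) \<longrightarrow>
            (B_boundary (davis_complex \<Gamma>) = roller_boundary (davis_complex \<Gamma>) \<longleftrightarrow>
             \<not> splits_as_direct_product (racg \<Gamma>)))
       \<and> (B_boundary (salvetti_universal_cover \<Gamma>) = roller_boundary (salvetti_universal_cover \<Gamma>) \<longleftrightarrow>
             \<not> splits_as_direct_product (raag \<Gamma>))"
proof (intro conjI impI)
  assume inf: "infinite (carrier (racg \<Gamma>))"
  interpret right_angled_group "racg \<Gamma>" "pverts \<Gamma>" "adjacent \<Gamma>" "racg_step \<Gamma>" "\<lambda>u s. s"
    by (rule racg_right_angled[OF assms])
  obtain a a' where a: "apart a a'" using infinite_apart[OF inf] .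
  have "splits_as_direct_product (racg \<Gamma>) \<longleftrightarrow> joined (pverts \<Gamma>) (adjacent \<Gamma>)"
    using racg_joined_splits[OF assms] not_joined_not_splits[OF _ a] by blast
  then show "B_boundary (davis_complex \<Gamma>) = roller_boundary (davis_complex \<Gamma>) \<longleftrightarrow>
      \<not> splits_as_direct_product (racg \<Gamma>)"
    using B_boundary_cubes_iff[OF a] unfolding davis_complex_eq[OF assms] by simp
next
  interpret right_angled_group "raag \<Gamma>" "raag_labels \<Gamma>" "raag_adj \<Gamma>" "raag_step \<Gamma>" raag_relabel
    by (rule raag_right_angled[OF assms])
  show "B_boundary (salvetti_universal_cover \<Gamma>) = roller_boundary (salvetti_universal_cover \<Gamma>) \<longleftrightarrow>
      \<not> splits_as_direct_product (raag \<Gamma>)"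
  proof (cases "pverts \<Gamma> = {}")
    \<comment> \<open>Without generators there are no halfspaces, and the group is trivial.\<close>
    case True
    then have "raag_labels \<Gamma> = {}" by (simp add: raag_labels_def)
    then have "B_boundary (salvetti_universal_cover \<Gamma>) = roller_boundary (salvetti_universal_cover \<Gamma>)"
      unfolding salvetti_eq[OF assms] by (rule B_boundary_no_labels)
    moreover have "carrier (raag \<Gamma>) = {word_class {} (raag_rels \<Gamma>) []}"
    proof -
      have "words {} = {[]}" by (auto simp: words_def)
      then show ?thesis using True by (auto simp: raag_def presented_group_def quotient_def)
    qed
    ultimately show ?thesis using trivial_not_splits[of "raag \<Gamma>"] by simp
  next
    case False
    then obtain s where "s \<in> pverts \<Gamma>" by blast
    then have "(s, p) \<in> raag_labels \<Gamma>" for p by (simp add: raag_labels_def)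
    \<comment> \<open>Already the two labels of one generator are not adjacent, so a single generator is no exception.\<close>
    then have a: "apart (s, False) (s, True)"
      using pair_graph_facts(4)[OF assms] by (simp add: apart_def raag_adj_def)
    have "splits_as_direct_product (raag \<Gamma>) \<longleftrightarrow> joined (raag_labels \<Gamma>) (raag_adj \<Gamma>)"
      using raag_joined_splits[OF assms] not_joined_not_splits[OF _ a] joined_labels[OF assms] by blast
    then show ?thesis using B_boundary_cubes_iff[OF a] unfolding salvetti_eq[OF assms] by simp
  qed
qed

end
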